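(* Let $r\in\mathbb{Q}$ with $H(r)>4$ and let $\mathfrak{m}$ be the set of Mersenne primes. Then $$(\log B)^{0.60839}\ll\#\Big\{t=((r^{q_1}+1)^{q_2}\cdots +1)^{q_s}+1 \;\Big|\; q_1,\dots, q_s\in\mathfrak{m},\ H(t)\leq B\Big\}\ll (\log B)^{0.60872},$$ where the set consists of the distinct rational numbers $t$ of the indicated form with $s$ arbitrary, and the implicit constants depend on $r$.
   Context: A Mersenne prime is a prime of the form $2^n-1$. The expression $((r^{q_1}+1)^{q_2}\cdots+1)^{q_s}+1$ denotes the value at $r$ of the composition $\theta_{q_s}\circ\cdots\circ\theta_{q_1}$, where $\theta_q(z)=z^q+1$. $H$ is the standard multiplicative Weil height on $\mathbb{Q}$: $H(a/b)=\max\{|a|,|b|\}$ for coprime integers $a,b$ with $b\ne0$. The notation $F(B)\ll G(B)$ means that there are a constant $c>0$ and a $B_0$ such that $F(B)\le c\,G(B)$ for all $B\ge B_0$. *)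

theory Defs
  imports Complex_Main "HOL-Computational_Algebra.Primes"
begin

definition mersenne_primes :: "nat set" where
  "mersenne_primes = {p. prime p \<and> (\<exists>n::nat. p = 2 ^ n - 1)}"

(* quotient_of returns the coprime representation a/b with b > 0 *)
definition height :: "rat \<Rightarrow> int" where
  "height r = (case quotient_of r of (a, b) \<Rightarrow> max \<bar>a\<bar> \<bar>b\<bar>)"

definition theta :: "nat \<Rightarrow> rat \<Rightarrow> rat" where
  "theta q z = z ^ q + 1"

(* For qs = [q1, ..., qs], fold theta qs r is theta qs (... (theta q1 r)),
   i.e. the head of the list is the innermost exponent; at least one map
   is applied.  The result is a set, so distinct words giving the same
   rational number are counted once. *)
definition mersenne_values :: "rat \<Rightarrow> real \<Rightarrow> rat set" where
  "mersenne_values r B =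
     {t. (\<exists>qs. qs \<noteq> [] \<and> set qs \<subseteq> mersenne_primes \<and> t = fold theta qs r)
         \<and> of_int (height t) \<le> B}"

(* Hence card is the true cardinality. *)
lemma finite_mersenne_values: "finite (mersenne_values r B)"
proof -
  let ?N = "{- \<lfloor>B\<rfloor>..\<lfloor>B\<rfloor>}"
  have "mersenne_values r B \<subseteq> (\<lambda>(a, b). of_int a / of_int b) ` (?N \<times> ?N)"
  proof
    fix t assume "t \<in> mersenne_values r B"
    then have le: "height t \<le> \<lfloor>B\<rfloor>"
      by (simp add: mersenne_values_def le_floor_iff)
    obtain a b where ab: "quotient_of t = (a, b)" by (cases "quotient_of t")
    have "(a, b) \<in> ?N \<times> ?N"
      using le by (auto simp: height_def ab)
    moreover have "t = of_int a / of_int b" by (rule quotient_of_div [OF ab])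
    ultimately show "t \<in> (\<lambda>(a, b). of_int a / of_int b) ` (?N \<times> ?N)" by force
  qed
  then show ?thesis by (rule finite_subset) simp
qed

definition vinogradov :: "(real \<Rightarrow> real) \<Rightarrow> (real \<Rightarrow> real) \<Rightarrow> bool"  (infix "\<ll>" 50) where
  "F \<ll> G \<longleftrightarrow> (\<exists>c>0. \<exists>B\<^sub>0. \<forall>B\<ge>B\<^sub>0. F B \<le> c * G B)"

end

(* The logarithmic height of the value of a word in the maps z^q + 1 at r is, up to bounded factors, the product
   of the exponents, so the question is to count ordered factorizations into Mersenne primes.  Their
   generating sum over q of q^-s equals 1 at an exponent between 87/143 and 14/23; seven Mersenne primes give
   the lower estimate, and a geometric series bounds the contribution of all 2^n - 1 with n >= 23.

   Distinct words might give the same number.  If x^q + 1 = y^p + 1 with p <> q, then x = W^p, and x is itself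
   z^s + 1 unless x is the starting point.  Clearing denominators gives a Catalan or Fermat type equation
   C^q - E^q = A^n in integers whose denominator E is composed of the primes dividing the denominator of r.
   Factoring C^q - E^q = (C - E) * S with S congruent to (C - E)^(q-1) modulo E, two solutions in the same
   residue class satisfy a congruence modulo the smaller E which forces their heights to be far apart.
   Hence only O(log X) collisions occur up to X, with a constant that does not grow when the starting point
   is replaced by a later point of its orbit, and this cannot affect the exponential growth rate of the
   number of distinct values. *)
theory Submission
  imports Defs "HOL-Number_Theory.Number_Theory" "HOL-Computational_Algebra.Nth_Powers"
begin

section \<open>Two solutions of a power congruence\<close>

text \<open>Write Q for the product of the exponents of a word. The denominator E grows with Q, yet
  finitely many residue classes suffice: E divides a power of one fixed b, and if X and Y agree
  modulo n*b then (X^n - Y^n)/(X - Y) is n times a number coprime to b, so divisibility of X^n - Y^n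
  by the large E passes to n*(X - Y). For integral starting points E = 1 and the resulting
  inequality is one of pure size. The repulsion of heights comes from an exponent 3 standing against
  2, one for each of the two solutions. In the Catalan case the 3 is supplied by n >= 3*(q - 1),
  which any two of the seven Mersenne primes q < n satisfy. The recurrence for distinct values loses
  a multiple of log X and alone is consistent with no growth at all. Constants uniform along the
  orbit are therefore essential. They are available because the denominator of z^q + 1 is exactly
  the q-th power of that of z: its primes never change. The fractions 87/143 = 0.608391... and 14/23
  = 0.608695... have small terms and lie between the stated exponents and the true one, on either
  side of it.\<close>

lemma abs_power_diff_ge:
  fixes X Y :: "'a::linordered_idom"
  assumes "odd n"
  shows "\<bar>X - Y\<bar> * \<bar>X\<bar> ^ (n - 1) \<le> 2 * \<bar>X ^ n - Y ^ n\<bar>"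
proof -
  obtain m where n: "n = Suc m" "even m" using assms by (cases n) auto
  have main: "\<bar>X - Y\<bar> * X ^ m \<le> 2 * \<bar>X ^ n - Y ^ n\<bar>" if "X \<ge> 0" for X Y :: 'a
  proof (cases "Y \<ge> 0")
    case True
    have "\<bar>X - Y\<bar> * X ^ m \<le> \<bar>X ^ n - Y ^ n\<bar>"
    proof (cases "Y \<le> X")
      case le: True
      have "Y * Y ^ m \<le> Y * X ^ m" using True le by (intro mult_left_mono power_mono) auto
      moreover have "Y ^ n \<le> X ^ n" using True le by (intro power_mono) auto
      ultimately show ?thesis using le by (simp add: n algebra_simps)
    next
      case False
      have "Y * X ^ m \<le> Y * Y ^ m" using True that False by (intro mult_left_mono power_mono) auto
      moreover have "X ^ n \<le> Y ^ n" using that False by (intro power_mono) auto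
      ultimately show ?thesis using False by (simp add: n algebra_simps)
    qed
    moreover have "\<bar>X ^ n - Y ^ n\<bar> \<le> 2 * \<bar>X ^ n - Y ^ n\<bar>" by simp
    ultimately show ?thesis by (rule order_trans)
  next
    case False
    \<comment> \<open>Opposite signs cost the factor 2: as n is odd, X^n - Y^n = X^n + Z^n is at
      least the n-th power of the larger of X and Z, while X + Z is at most twice the larger
      one.\<close>
    define Z where "Z = - Y"
    have Z: "Z > 0" "Y = - Z" using False by (auto simp: Z_def)
    have Yn: "Y ^ n = - (Z ^ n)" using Z assms by simp
    have "(X + Z) * X ^ m \<le> 2 * (X ^ n + Z ^ n)"
    proof (cases "Z \<le> X")
      case True
      have "Z * X ^ m \<le> X * X ^ m" using True that by (intro mult_right_mono) auto
      moreover have "Z ^ n \<ge> 0" using Z by simp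
      moreover have "X ^ n \<ge> 0" using that by simp
      ultimately show ?thesis by (simp add: n algebra_simps)
    next
      case F: False
      have "X ^ m \<le> Z ^ m" using F that by (intro power_mono) auto
      then have "(X + Z) * X ^ m \<le> (Z + Z) * Z ^ m" using F that Z by (intro mult_mono) auto
      moreover have "X ^ n \<ge> 0" using that by simp
      ultimately show ?thesis by (simp add: n algebra_simps)
    qed
    moreover have "X ^ n \<ge> 0" "Z ^ n \<ge> 0" using that Z by auto
    ultimately show ?thesis using that Z Yn by simp
  qed
  show ?thesis
  proof (cases "X \<ge> 0")
    case True then show ?thesis using main[of X Y] n by simp
  next
    case False
    have "\<bar>- X - - Y\<bar> * (-X) ^ m \<le> 2 * \<bar>(-X) ^ n - (-Y) ^ n\<bar>"
      using main[of "-X" "-Y"] False by auto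
    moreover have "(-X)^n = - (X^n)" "(-Y)^n = - (Y^n)" using assms by auto
    ultimately show ?thesis using False n by (simp add: abs_minus_commute)
  qed
qed

text \<open>Modulo X - Y, hence modulo n*b, the quotient of X^n - Y^n by X - Y is n * X^(n-1). So it
  is n times a number congruent to X^(n-1) modulo b, which is coprime to b and therefore to E. A
  congruence to a fixed modulus thus controls divisibility by divisors of arbitrarily high powers of
  b.\<close>

lemma dvd_diff_of_dvd_power_diff:
  fixes X Y E b :: int
  assumes nb: "int n * b dvd X - Y" and cop: "coprime X b" and E: "E dvd b ^ m"
    and dvd: "E dvd X ^ n - Y ^ n"
  shows "E dvd int n * (X - Y)"
proof (cases "n = 0")
  case False
  obtain j where j: "X - Y = int n * b * j" using nb by (auto elim: dvdE)
  define S where "S = (\<Sum>i<n. Y ^ (n - Suc i) * X ^ i)"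
  have eq: "X ^ n - Y ^ n = (X - Y) * S" unfolding S_def by (rule power_diff_sumr2)
  have "[S = (\<Sum>i<n. X ^ (n - 1))] (mod (X - Y))"
    unfolding S_def
  proof (rule cong_sum)
    fix i assume "i \<in> {..<n}"
    then have "X ^ (n - 1) = X ^ (n - Suc i) * X ^ i" by (simp flip: power_add)
    moreover have "[Y = X] (mod (X - Y))" by (simp add: cong_iff_dvd_diff dvd_diff_commute)
    ultimately show "[Y ^ (n - Suc i) * X ^ i = X ^ (n - 1)] (mod (X - Y))"
      by (metis cong_mult cong_pow cong_refl)
  qed
  then have "X - Y dvd S - int n * X ^ (n - 1)" by (simp add: cong_iff_dvd_diff)
  then obtain k where "S - int n * X ^ (n - 1) = (X - Y) * k" by (auto elim: dvdE)
  then have S: "S = int n * (X ^ (n - 1) + b * (j * k))" using j by (simp add: algebra_simps)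
  have "coprime b (X ^ (n - 1))" using cop by (simp add: coprime_commute)
  then have "coprime b (X ^ (n - 1) + b * (j * k))" 
    by (metis coprime_iff_gcd_eq_1 gcd_add_mult add.commute mult.commute)
  then have "coprime (b ^ m) (X ^ (n - 1) + b * (j * k))" by simp
  then have cE: "coprime E (X ^ (n - 1) + b * (j * k))" using E by (rule coprime_divisors[OF _ dvd_refl, rotated])
  have "E dvd (int n * (X - Y)) * (X ^ (n - 1) + b * (j * k))"
    using dvd unfolding eq S by (simp add: mult_ac)
  then show ?thesis using cE by (simp only: coprime_dvd_mult_left_iff)
qed simp

text \<open>Cross-multiplication: for X = \<beta> * \<alpha>'^k and Y = \<beta>' * \<alpha>^k the
  main terms cancel in g * (X^n - Y^n), and both remaining error terms are divisible by E. Hence E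
  divides n * (X - Y), and E <= n * |X - Y| because X and Y differ. On the other hand |X - Y| is
  small because X^n - Y^n is. The constant T guarantees that |X| is not much smaller than |\<alpha>
  * \<alpha>'|^k.\<close>

lemma gap_of_congruent_solutions:
  fixes \<alpha> \<alpha>' \<beta> \<beta>' g h E E' R R' b :: int and K T :: real
  assumes n: "odd n" and gpos: "g > 0" and E1pos: "E > 0" and E12: "E dvd E'" "E' > 0" and E1b: "E dvd b ^ m"
    and eq1: "g * \<beta> ^ n = h * \<alpha> ^ (n * k) + E * R"
    and eq2: "g * \<beta>' ^ n = h * \<alpha>' ^ (n * k) + E' * R'"
    and k: "k \<ge> 1"
    and R: "real_of_int \<bar>R\<bar> \<le> K * \<bar>\<alpha>\<bar> ^ (n * (k - 1))" 
    and R': "real_of_int \<bar>R'\<bar> \<le> K * \<bar>\<alpha>'\<bar> ^ (n * (k - 1))"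
    and T: "T > 0" "real_of_int \<bar>\<alpha>\<bar> ^ k \<le> T * \<bar>\<beta>\<bar>"
    and cop: "coprime \<alpha> b" "coprime \<alpha>' b" "coprime \<beta> b" "coprime \<beta>' b" "coprime g b"
    and cong: "int n * b dvd \<alpha> - \<alpha>'" "int n * b dvd \<beta> - \<beta>'"
    and ne: "\<beta> * \<alpha>' ^ k \<noteq> \<beta>' * \<alpha> ^ k"
    and nz: "\<alpha> \<noteq> 0" "\<alpha>' \<noteq> 0" and K: "K \<ge> 0"
  shows "real_of_int E \<le> 2 * n * K * T ^ (n - 1) * (\<bar>\<alpha>\<bar> * \<bar>\<alpha>'\<bar>) ^ k * (E / \<bar>\<alpha>\<bar> ^ n + E' / \<bar>\<alpha>'\<bar> ^ n)"
proof -
  define X Y where "X = \<beta> * \<alpha>' ^ k" and "Y = \<beta>' * \<alpha> ^ k"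
  have gXY: "g * (X ^ n - Y ^ n) = E * R * \<alpha>' ^ (n * k) - E' * R' * \<alpha> ^ (n * k)"
  proof -
    have "g * (X ^ n - Y ^ n) = (g * \<beta> ^ n) * \<alpha>' ^ (n * k) - (g * \<beta>' ^ n) * \<alpha> ^ (n * k)"
      by (simp add: X_def Y_def algebra_simps power_mult_distrib flip: power_mult)
    then show ?thesis unfolding eq1 eq2 by (simp add: algebra_simps)
  qed
  have "E dvd g * (X ^ n - Y ^ n)" unfolding gXY using E12 by simp
  moreover have "coprime E g" using cop(5) E1b
    by (meson coprime_commute coprime_divisors coprime_power_right_iff dvd_refl)
  ultimately have d: "E dvd X ^ n - Y ^ n" by (simp add: coprime_dvd_mult_right_iff)
  have c: "int n * b dvd X - Y"
  proof -
    have "[\<alpha> = \<alpha>'] (mod (int n * b))" "[\<beta> = \<beta>'] (mod (int n * b))" using cong by (auto simp: cong_iff_dvd_diff)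
    then have "[X = Y] (mod (int n * b))" unfolding X_def Y_def
      by (intro cong_mult cong_pow) (auto simp: cong_sym)
    then show ?thesis by (simp add: cong_iff_dvd_diff)
  qed
  have "coprime X b" unfolding X_def using cop by simp
  from dvd_diff_of_dvd_power_diff[OF c this E1b d] have "E dvd int n * (X - Y)" .
  moreover have "n > 0" using n by (rule odd_pos)
  moreover have "X \<noteq> Y" using ne by (simp add: X_def Y_def)
  ultimately have "\<bar>E\<bar> \<le> \<bar>int n * (X - Y)\<bar>" by (intro dvd_imp_le_int) auto
  then have "E \<le> int n * \<bar>X - Y\<bar>" using E1pos by (simp add: abs_mult)
  then have "real_of_int E \<le> real_of_int (int n * \<bar>X - Y\<bar>)" by (simp only: of_int_le_iff)
  then have l1: "real_of_int E \<le> n * \<bar>X - Y\<bar>" by simp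
  define P where "P = real_of_int (\<bar>\<alpha>\<bar> * \<bar>\<alpha>'\<bar>) ^ k"
  have Ppos: "P > 0" using nz by (simp add: P_def)
  have PX: "P \<le> T * \<bar>real_of_int X\<bar>"
  proof -
    have "P = real_of_int \<bar>\<alpha>\<bar> ^ k * real_of_int \<bar>\<alpha>'\<bar> ^ k" by (simp add: P_def power_mult_distrib)
    also have "\<dots> \<le> (T * \<bar>\<beta>\<bar>) * real_of_int \<bar>\<alpha>'\<bar> ^ k" using T by (intro mult_right_mono) auto
    also have "\<dots> = T * \<bar>real_of_int X\<bar>" by (simp add: X_def abs_mult power_abs)
    finally show ?thesis .
  qed
  have "P ^ (n - 1) \<le> T ^ (n - 1) * \<bar>real_of_int X\<bar> ^ (n - 1)"
    using power_mono[OF PX, of "n - 1"] Ppos by (simp add: power_mult_distrib)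
  \<comment> \<open>The factor P^(n-1) is carried along to create the |X|^(n-1) that
    \<open>abs_power_diff_ge\<close> asks for; it is cancelled at the end.\<close>
  then have "real_of_int E * P ^ (n - 1) \<le> (n * \<bar>X - Y\<bar>) * (T ^ (n - 1) * \<bar>real_of_int X\<bar> ^ (n - 1))"
    using l1 E1pos Ppos by (intro mult_mono) auto
  also have "\<dots> = n * T ^ (n - 1) * (\<bar>real_of_int X - real_of_int Y\<bar> * \<bar>real_of_int X\<bar> ^ (n - 1))" by simp
  also have "\<dots> \<le> n * T ^ (n - 1) * (2 * \<bar>real_of_int X ^ n - real_of_int Y ^ n\<bar>)"
    using T abs_power_diff_ge[OF n, of "real_of_int X" "real_of_int Y"] by (intro mult_left_mono) auto
  also have "\<dots> \<le> n * T ^ (n - 1) * (2 * (K * P ^ n * (E / \<bar>\<alpha>\<bar> ^ n + E' / \<bar>\<alpha>'\<bar> ^ n)))"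
  proof (intro mult_left_mono)
    have "\<bar>real_of_int X ^ n - real_of_int Y ^ n\<bar> \<le> g * \<bar>real_of_int X ^ n - real_of_int Y ^ n\<bar>"
      using gpos by (simp add: mult_le_cancel_right1)
    also have "\<dots> = \<bar>real_of_int (g * (X ^ n - Y ^ n))\<bar>" using gpos by (simp add: abs_mult)
    also have "\<dots> \<le> real_of_int E * \<bar>R\<bar> * \<bar>\<alpha>'\<bar> ^ (n * k) + real_of_int E' * \<bar>R'\<bar> * \<bar>\<alpha>\<bar> ^ (n * k)"
      unfolding gXY using E1pos E12
      by (simp add: abs_mult power_abs order_trans[OF abs_triangle_ineq4])
    also have "\<dots> \<le> real_of_int E * (K * \<bar>\<alpha>\<bar> ^ (n * (k - 1))) * \<bar>\<alpha>'\<bar> ^ (n * k) + real_of_int E' * (K * \<bar>\<alpha>'\<bar> ^ (n * (k - 1))) * \<bar>\<alpha>\<bar> ^ (n * k)"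
      using R R' E1pos E12 by (intro add_mono mult_right_mono mult_left_mono) auto
    also have "\<dots> = K * P ^ n * (E / \<bar>\<alpha>\<bar> ^ n + E' / \<bar>\<alpha>'\<bar> ^ n)"
    proof -
      define u1 u2 w1 w2 where "u1 = real_of_int \<bar>\<alpha>\<bar> ^ (n * k)" and "u2 = real_of_int \<bar>\<alpha>'\<bar> ^ (n * k)"
        and "w1 = real_of_int (\<bar>\<alpha>\<bar> ^ n)" and "w2 = real_of_int (\<bar>\<alpha>'\<bar> ^ n)"
      have nk: "n * k = n * (k - 1) + n" using k by (simp add: algebra_simps)
      have P: "P ^ n = u1 * u2"
        by (simp add: P_def u1_def u2_def power_mult_distrib mult.commute flip: power_mult)
      have q: "real_of_int \<bar>\<alpha>\<bar> ^ (n * (k - 1)) = u1 / w1" "real_of_int \<bar>\<alpha>'\<bar> ^ (n * (k - 1)) = u2 / w2"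
        unfolding nk u1_def u2_def w1_def w2_def using nz by (simp_all add: power_add)
      have "E * (K * (u1 / w1)) * u2 + E' * (K * (u2 / w2)) * u1 = K * (u1 * u2) * (E / w1 + E' / w2)"
        by (simp add: algebra_simps)
      then show ?thesis
        unfolding P by (simp only: q of_int_power flip: u1_def u2_def w1_def[unfolded of_int_power] w2_def[unfolded of_int_power])
    qed
    finally show "\<bar>real_of_int X ^ n - real_of_int Y ^ n\<bar> \<le> K * P ^ n * (E / \<bar>\<alpha>\<bar> ^ n + E' / \<bar>\<alpha>'\<bar> ^ n)" .
  qed (use T in auto)
  also have "\<dots> = (2 * n * K * T ^ (n - 1) * P * (E / \<bar>\<alpha>\<bar> ^ n + E' / \<bar>\<alpha>'\<bar> ^ n)) * P ^ (n - 1)"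
  proof -
    have "P ^ n = P * P ^ (n - 1)" using \<open>n > 0\<close> by (simp flip: power_Suc)
    then show ?thesis by (simp add: algebra_simps)
  qed
  finally have "real_of_int E \<le> 2 * n * K * T ^ (n - 1) * P * (E / \<bar>\<alpha>\<bar> ^ n + E' / \<bar>\<alpha>'\<bar> ^ n)"
    using Ppos by (simp del: times_divide_eq_right)
  then show ?thesis by (simp add: P_def)
qed

section \<open>Factors of a perfect power that share a single prime\<close>

text \<open>Let a' be a without its powers of q. Then a' is coprime to the complementary factor of
  z^n, hence an n-th power itself. Reducing the exponent of q modulo n leaves only n possibilities
  for i, which is what makes a finite classification possible.\<close>

lemma prime_power_times_nth_power_nat:
  fixes a b z q n :: nat
  assumes "a * b = z ^ n" "a > 0" "b > 0" "n > 0" "prime q"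
    and q: "\<And>l. prime l \<Longrightarrow> l dvd a \<Longrightarrow> l dvd b \<Longrightarrow> l = q"
  shows "\<exists>i<n. \<exists>x. a = q ^ i * x ^ n"
proof -
  have nu: "\<not> is_unit q" using assms(5) by auto
  obtain a' where a': "a = q ^ multiplicity q a * a'" "\<not> q dvd a'"
    using multiplicity_decompose'[of a q] nu assms by (metis neq0_conv)
  define k where "k = multiplicity q a"
  have cq: "coprime a' q" using prime_imp_coprime[OF assms(5) a'(2)] by (simp add: coprime_commute)
  have cb: "coprime a' b"
  proof (rule ccontr)
    assume "\<not> coprime a' b"
    then obtain c where c: "c dvd a'" "c dvd b" "\<not> is_unit c" by (rule not_coprimeE)
    then obtain l where l: "prime l" "l dvd c" using prime_factor_nat[of c] by auto
    then have "l dvd a'" "l dvd b" using c dvd_trans by blast+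
    moreover from this have "l dvd a" using a'(1) dvd_mult by metis
    ultimately show False using q[OF l(1)] a'(2) by blast
  qed
  have "coprime a' (q ^ k * b)" using cq cb by simp
  moreover have "a' * (q ^ k * b) = q ^ k * a' * b" by (simp add: mult_ac)
  then have "a' * (q ^ k * b) = z ^ n" unfolding k_def a'(1)[symmetric] using assms(1) by simp
  then have "is_nth_power n (a' * (q ^ k * b))" by (auto simp: is_nth_power_def)
  moreover have "a' > 0" using a'(2) by (cases a') auto
  ultimately have "is_nth_power n a'" using assms(3,5)
    by (intro is_nth_power_mult_coprime_natD(1)[of a' "q ^ k * b" n]) (auto simp: prime_gt_0_nat)
  then obtain x where "a' = x ^ n" by (auto simp: is_nth_power_def)
  then have "a = q ^ (k mod n + k div n * n) * x ^ n"
    using a'(1) by (simp add: k_def[symmetric] del: mod_mult_div_eq)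
  then have "a = q ^ (k mod n) * (q ^ (k div n) * x) ^ n"
    by (simp only: power_add power_mult power_mult_distrib mult.assoc)
  then show ?thesis using mod_less_divisor[OF assms(4), of k] by blast
qed

text \<open>For odd n the sign of a can be absorbed into x.\<close>

lemma prime_power_times_nth_power:
  fixes a b z :: int
  assumes "a * b = z ^ n" "a \<noteq> 0" "b \<noteq> 0" "odd n" "prime q"
    and q: "\<And>l. prime l \<Longrightarrow> int l dvd a \<Longrightarrow> int l dvd b \<Longrightarrow> l = q"
  obtains i x where "i < n" "a = int q ^ i * x ^ n"
proof -
  have "nat \<bar>a\<bar> * nat \<bar>b\<bar> = nat \<bar>z\<bar> ^ n"
    using arg_cong[OF assms(1), of "\<lambda>x. nat \<bar>x\<bar>"] by (simp add: abs_mult power_abs nat_mult_distrib nat_power_eq)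
  moreover have "n > 0" using assms(4) by (rule odd_pos)
  moreover have "l = q" if "prime l" "l dvd nat \<bar>a\<bar>" "l dvd nat \<bar>b\<bar>" for l
    using that q by (simp add: dvd_nat_abs_iff)
  ultimately have "\<exists>i<n. \<exists>x. nat \<bar>a\<bar> = q ^ i * x ^ n"
    using assms(2,3,5) by (intro prime_power_times_nth_power_nat[of _ "nat \<bar>b\<bar>" "nat \<bar>z\<bar>"]) auto
  then obtain i x where ix: "i < n" "nat \<bar>a\<bar> = q ^ i * x ^ n" by blast
  have "\<bar>a\<bar> = int q ^ i * int x ^ n" using arg_cong[OF ix(2), of int] by simp
  moreover have "sgn a ^ n = sgn a" using assms(2,4) by (cases "a > 0") auto
  ultimately have "a = int q ^ i * (sgn a * int x) ^ n"
    using mult_sgn_abs[of a] by (simp add: power_mult_distrib mult_ac)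
  with ix(1) that show ?thesis by blast
qed

section \<open>Numerators, denominators and the quotient (C^q - E^q)/(C - E)\<close>

abbreviation num :: "rat \<Rightarrow> int" where "num v \<equiv> fst (quotient_of v)"
abbreviation den :: "rat \<Rightarrow> int" where "den v \<equiv> snd (quotient_of v)"

lemma den_pos: "den v > 0" by (rule quotient_of_denom_pos')

lemma coprime_num_den: "coprime (num v) (den v)"
  using quotient_of_coprime[of v "num v" "den v"] by simp

lemma rat_eq_num_den: "v = of_int (num v) / of_int (den v)"
  using quotient_of_div[of v "num v" "den v"] by simp

lemma num_den_eqI:
  assumes "v = of_int a / of_int b" "coprime a b" "b > 0"
  shows "num v = a" "den v = b"
  using assms by (simp_all add: quotient_of_Fract normalize_stable flip: Fract_of_int_quotient)

definition power_quotient :: "nat \<Rightarrow> int \<Rightarrow> int \<Rightarrow> int" where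
  "power_quotient q C E = (\<Sum>i<q. E ^ (q - Suc i) * C ^ i)"

lemma power_quotient: "C ^ q - E ^ q = (C - E) * power_quotient q C E"
  unfolding power_quotient_def by (rule power_diff_sumr2)

text \<open>Replace C by E in every term. Consequently a common divisor of C - E and the quotient
  divides q * E^(q-1).\<close>

lemma power_quotient_cong: "C - E dvd power_quotient q C E - int q * E ^ (q - 1)"
proof -
  have "[power_quotient q C E = (\<Sum>i<q. E ^ (q - 1))] (mod (C - E))"
    unfolding power_quotient_def
  proof (rule cong_sum)
    fix i assume "i \<in> {..<q}"
    then have "E ^ (q - 1) = E ^ (q - Suc i) * E ^ i" by (simp flip: power_add)
    moreover have "[C = E] (mod (C - E))" by (simp add: cong_iff_dvd_diff)
    ultimately show "[E ^ (q - Suc i) * C ^ i = E ^ (q - 1)] (mod (C - E))"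
      by (metis cong_mult cong_pow cong_refl)
  qed
  then show ?thesis by (simp add: cong_iff_dvd_diff)
qed

text \<open>All terms except C^(q-1) contain a factor E, and C^(q-1) differs from (C - E)^(q-1) by a
  multiple of C - (C - E) = E. Since |C| <= 2 * |C - E|, the cofactor R has one power of C - E less
  than the main term, apart from a constant.\<close>

lemma power_quotient_expand:
  assumes "\<bar>E\<bar> \<le> \<bar>C - E\<bar>" "q \<ge> 2"
  obtains R where "power_quotient q C E = (C - E) ^ (q - 1) + E * R"
    "\<bar>R\<bar> \<le> int q * 2 ^ q * \<bar>C - E\<bar> ^ (q - 2)"
proof -
  define D where "D = C - E"
  define m where "m = q - 2"
  have q: "q = Suc (Suc m)" using assms by (simp add: m_def)
  define S1 S2 where "S1 = (\<Sum>i<Suc m. E ^ (m - i) * C ^ i)" and "S2 = (\<Sum>i<Suc m. D ^ (m - i) * C ^ i)"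
  have C: "\<bar>C\<bar> \<le> 2 * \<bar>D\<bar>" using assms abs_triangle_ineq[of "C - E" E] by (simp add: D_def)
  have bd: "\<bar>\<Sum>i<Suc m. X ^ (m - i) * C ^ i\<bar> \<le> int (Suc m) * (2 ^ m * \<bar>D\<bar> ^ m)" if "\<bar>X\<bar> \<le> \<bar>D\<bar>" for X
  proof -
    have "\<bar>\<Sum>i<Suc m. X ^ (m - i) * C ^ i\<bar> \<le> (\<Sum>i<Suc m. \<bar>X ^ (m - i) * C ^ i\<bar>)" by (rule sum_abs)
    also have "\<dots> \<le> (\<Sum>i<Suc m. 2 ^ m * \<bar>D\<bar> ^ m)"
    proof (rule sum_mono)
      fix i assume i: "i \<in> {..<Suc m}"
      have "\<bar>X ^ (m - i) * C ^ i\<bar> \<le> \<bar>D\<bar> ^ (m - i) * (2 * \<bar>D\<bar>) ^ i"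
        unfolding abs_mult power_abs using that C by (intro mult_mono power_mono) auto
      also have "\<dots> = 2 ^ i * \<bar>D\<bar> ^ m" using i by (simp add: power_mult_distrib mult.left_commute flip: power_add)
      also have "\<dots> \<le> 2 ^ m * \<bar>D\<bar> ^ m" using i by (intro mult_right_mono power_increasing) auto
      finally show "\<bar>X ^ (m - i) * C ^ i\<bar> \<le> 2 ^ m * \<bar>D\<bar> ^ m" .
    qed
    finally show ?thesis by simp
  qed
  have "power_quotient q C E = (\<Sum>i<Suc m. E * (E ^ (m - i) * C ^ i)) + C ^ Suc m"
    unfolding power_quotient_def q
    by (simp add: Suc_diff_le mult.assoc)
  also have "C ^ Suc m = D ^ Suc m + (C - D) * (\<Sum>i<Suc m. D ^ (Suc m - Suc i) * C ^ i)"
    using power_diff_sumr2[of C "Suc m" D] by simp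
  finally have "power_quotient q C E = D ^ Suc m + E * (S1 + S2)"
    by (simp add: S1_def S2_def D_def sum_distrib_left algebra_simps)
  moreover have "\<bar>S1 + S2\<bar> \<le> int q * 2 ^ q * \<bar>D\<bar> ^ (q - 2)"
  proof -
    have "\<bar>S1 + S2\<bar> \<le> int (Suc m) * (2 ^ m * \<bar>D\<bar> ^ m) + int (Suc m) * (2 ^ m * \<bar>D\<bar> ^ m)"
      unfolding S1_def S2_def using assms by (intro order_trans[OF abs_triangle_ineq] add_mono bd) (auto simp: D_def)
    also have "\<dots> = int (Suc m) * 2 ^ Suc m * \<bar>D\<bar> ^ m" by (simp add: algebra_simps)
    also have "\<dots> \<le> int q * 2 ^ q * \<bar>D\<bar> ^ (q - 2)"
      unfolding q by (intro mult_mono) auto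
    finally show ?thesis .
  qed
  ultimately show ?thesis using that[of "S1 + S2"] by (simp only: D_def q diff_Suc_1)
qed

text \<open>Dividing by z - w would equate two sums of the same shape, one in z and w, the other in
  1 + z and 1 + w. As |z| < 1 + z and |w| < 1 + w, the second dominates term by term, strictly for i
  = 0.\<close>

lemma power_diff_shift_inj:
  fixes z w :: rat
  assumes "\<bar>z\<bar> < 1/2" "\<bar>w\<bar> < 1/2" "q \<ge> 2" and eq: "(1 + z) ^ q - z ^ q = (1 + w) ^ q - w ^ q"
  shows "z = w"
proof (rule ccontr)
  assume "z \<noteq> w"
  have "(1 + z) ^ q - (1 + w) ^ q = z ^ q - w ^ q" using eq by simp
  then have "(z - w) * (\<Sum>i<q. (1 + w) ^ (q - Suc i) * (1 + z) ^ i) = (z - w) * (\<Sum>i<q. w ^ (q - Suc i) * z ^ i)"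
    using power_diff_sumr2[of "1 + z" q "1 + w"] power_diff_sumr2[of z q w] by simp
  then have "(\<Sum>i<q. (1 + w) ^ (q - Suc i) * (1 + z) ^ i) = (\<Sum>i<q. w ^ (q - Suc i) * z ^ i)"
    using \<open>z \<noteq> w\<close> by simp
  moreover have "(\<Sum>i<q. w ^ (q - Suc i) * z ^ i) < (\<Sum>i<q. (1 + w) ^ (q - Suc i) * (1 + z) ^ i)"
  proof (rule sum_strict_mono_ex1)
    have l: "\<bar>z\<bar> < 1 + z" "\<bar>w\<bar> < 1 + w" using assms by (auto simp: abs_if split: if_splits)
    have le: "w ^ j * z ^ i \<le> \<bar>w\<bar> ^ j * \<bar>z\<bar> ^ i" for i j
      by (metis abs_ge_self abs_mult power_abs)
    show "\<forall>i\<in>{..<q}. w ^ (q - Suc i) * z ^ i \<le> (1 + w) ^ (q - Suc i) * (1 + z) ^ i"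
      using l by (intro ballI order_trans[OF le] mult_mono power_mono) auto
    have "w ^ (q - Suc 0) * z ^ 0 < (1 + w) ^ (q - Suc 0) * (1 + z) ^ 0"
    proof -
      have "\<bar>w\<bar> ^ (q - Suc 0) < (1 + w) ^ (q - Suc 0)" using l assms by (intro power_strict_mono) auto
      then show ?thesis using le[of "q - Suc 0" 0] by simp
    qed
    then show "\<exists>i\<in>{..<q}. w ^ (q - Suc i) * z ^ i < (1 + w) ^ (q - Suc i) * (1 + z) ^ i"
      using assms by (intro bexI[of _ 0]) auto
  qed simp
  ultimately show False by simp
qed

section \<open>Gap principle for equations of Fermat and Catalan type\<close>

text \<open>If \<open>v\<close> and \<open>w\<close> have logarithmic height \<open>Q\<close> and \<open>Q'\<close> up to a common factor, with
  \<open>Q \<le> Q'\<close>, the inequality says that \<open>Q'\<close> is at least about \<open>2 * Q\<close>.\<close>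

definition sparse :: "(rat \<Rightarrow> bool) \<Rightarrow> bool" where
  "sparse P \<longleftrightarrow> (\<exists>K\<ge>1. \<exists>F. \<exists>cls :: rat \<Rightarrow> nat \<times> nat \<times> int \<times> int. finite F \<and> (\<forall>v. P v \<longrightarrow> cls v \<in> F) \<and>
     (\<forall>v w. P v \<longrightarrow> P w \<longrightarrow> cls v = cls w \<longrightarrow> v \<noteq> w \<longrightarrow> den v dvd den w \<longrightarrow>
        (of_int (den v) * real_of_rat (min \<bar>v\<bar> \<bar>w\<bar>)) ^ 3 \<le> K * (of_int \<bar>num v\<bar> * of_int \<bar>num w\<bar>)))"

text \<open>The two divisibilities say that \<open>den v\<close> and b have the same prime divisors.
  So coprimality to \<open>den v\<close> and coprimality to b are interchangeable, and one modulus
  n*b serves a whole orbit although its denominators grow. The bound 4 makes \<open>num v\<close>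
  and \<open>num v - den v\<close> comparable.\<close>

definition admissible :: "int \<Rightarrow> rat \<Rightarrow> bool" where
  "admissible b v \<longleftrightarrow> \<bar>v\<bar> \<ge> 4 \<and> (\<exists>m. den v dvd b ^ m) \<and> (\<exists>m. b dvd den v ^ m)"

lemma odd_power_inject:
  fixes x y :: "'a::linordered_idom"
  assumes n: "odd n" and eq: "x ^ n = y ^ n"
  shows "x = y"
proof -
  have n0: "n \<noteq> 0" using n by (metis even_zero)
  show ?thesis
  proof (cases "x = 0")
    case True
    then have "y ^ n = 0" using eq n0 by (metis power_0_left)
    then show ?thesis using True n0 by (metis power_eq_0_iff)
  next
    case False
    have "\<bar>x - y\<bar> * \<bar>x\<bar> ^ (n - 1) \<le> 0" using abs_power_diff_ge[OF n, of x y] eq by simp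
    moreover have "\<bar>x\<bar> ^ (n - 1) > 0" using False by simp
    ultimately have "\<bar>x - y\<bar> \<le> 0" using mult_le_cancel_right_pos[of "\<bar>x\<bar> ^ (n - 1)" "\<bar>x - y\<bar>" 0] by simp
    then show ?thesis by simp
  qed
qed

lemma coprime_add_multiple:
  fixes a e x :: int
  assumes "coprime a e" "e dvd x" shows "coprime (a + x) e"
proof -
  obtain k where "x = k * e" using assms(2) by (metis dvdE mult.commute)
  then show ?thesis using assms(1) gcd_add_mult[of e k a]
    by (simp add: coprime_iff_gcd_eq_1 gcd.commute[of _ e] add.commute del: gcd_add_mult)
qed

lemma admissible_num_ge:
  assumes "\<bar>v\<bar> \<ge> 4" shows "4 * den v \<le> \<bar>num v\<bar>"
proof -
  have "4 \<le> \<bar>of_int (num v) / of_int (den v) :: rat\<bar>" using assms rat_eq_num_den[of v] by simp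
  then have "4 * of_int (den v) \<le> (of_int \<bar>num v\<bar> :: rat)" using den_pos[of v] by (simp add: field_simps)
  then have "of_int (4 * den v) \<le> (of_int \<bar>num v\<bar> :: rat)" by simp
  then show ?thesis by (simp only: of_int_le_iff)
qed

lemma real_abs_eq: "real_of_rat \<bar>v\<bar> = of_int \<bar>num v\<bar> / of_int (den v)"
proof -
  have "\<bar>v\<bar> = of_int \<bar>num v\<bar> / of_int (den v)"
    using rat_eq_num_den[of v] den_pos[of v] by (metis abs_divide abs_of_pos of_int_abs of_int_0_less_iff)
  then show ?thesis by (simp only: of_rat_divide of_rat_of_int_eq)
qed

lemma abs_le_of_power_le:
  fixes x y :: "'a::linordered_idom"
  assumes "\<bar>x\<bar> ^ n \<le> y ^ n" "y \<ge> 0" "n > 0" shows "\<bar>x\<bar> \<le> y"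
  using power_mono_iff[OF abs_ge_zero assms(2,3)] assms(1) by blast

text \<open>The gap inequality applies with k = 1, \<alpha> = \<open>num v\<close>, \<beta> = A, E =
  \<open>den v ^ n\<close> and R = 1. Its right side is then about |num v * num w| / V^n with V the
  smaller of |v| and |w|, so that (den v * V)^n, and a fortiori the cube, is bounded by a multiple
  of |num v * num w|.\<close>

lemma sparse_fermat:
  assumes n: "odd n" "n \<ge> 3" and b: "b > 0"
  shows "sparse (\<lambda>v. admissible b v \<and> (\<exists>A. num v ^ n + den v ^ n = A ^ n))"
proof -
  define P where "P = (\<lambda>v. admissible b v \<and> (\<exists>A. num v ^ n + den v ^ n = A ^ n))"
  have "\<forall>v. \<exists>A. P v \<longrightarrow> num v ^ n + den v ^ n = A ^ n" unfolding P_def by blast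
  then obtain A where A: "\<And>v. P v \<Longrightarrow> num v ^ n + den v ^ n = A v ^ n" by metis
  \<comment> \<open>The two zeros fill the places taken by the exponents i and j of q in the Catalan
    case.\<close>
  define cls where "cls = (\<lambda>v. (0::nat, 0::nat, num v mod (int n * b), A v mod (int n * b)))"
  define F where "F = {0::nat} \<times> {0::nat} \<times> {0..<int n * b} \<times> {0..<int n * b}"
  define K where "K = 2 * real n * 1 * 2 ^ (n - 1) * 2"
  have nb: "int n * b > 0" using n b by simp
  have facts: "coprime (num v) b" "coprime (A v) b" "num v \<noteq> 0" "\<bar>num v\<bar> \<le> 2 * \<bar>A v\<bar>" "4 * den v \<le> \<bar>num v\<bar>" if Pv: "P v" for v
  proof -
    obtain m where m: "b dvd den v ^ m" using Pv unfolding P_def admissible_def by blast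
    show cb: "coprime (num v) b"
      using coprime_divisors[OF dvd_refl m, of "num v"] coprime_num_den[of v] by simp
    have "coprime (num v ^ n) (den v)" using coprime_num_den[of v] by simp
    then have "coprime (A v ^ n) (den v)" unfolding A[OF Pv, symmetric]
      using n by (intro coprime_add_multiple dvd_power) auto
    then have "coprime (A v) (den v)" using n by simp
    then show "coprime (A v) b" 
      using coprime_divisors[OF dvd_refl m, of "A v"] by simp
    show 4: "4 * den v \<le> \<bar>num v\<bar>" using Pv by (auto simp: P_def admissible_def intro: admissible_num_ge)
    then show "num v \<noteq> 0" using den_pos[of v] by auto
    have "2 * den v ^ n \<le> \<bar>num v\<bar> ^ n" 
    proof -
      have "2 * den v ^ n \<le> 4 ^ n * den v ^ n" using den_pos[of v] n
        by (intro mult_right_mono) (auto intro!: order_trans[OF _ self_le_power])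
      also have "\<dots> \<le> \<bar>num v\<bar> ^ n" unfolding power_mult_distrib[symmetric] using 4 den_pos[of v] by (intro power_mono) auto
      finally show ?thesis .
    qed
    then have "\<bar>num v\<bar> ^ n \<le> 2 * \<bar>A v ^ n\<bar>"
      using abs_triangle_ineq4[of "num v ^ n + den v ^ n" "den v ^ n"] den_pos[of v]
      unfolding A[OF Pv, symmetric] by (simp add: power_abs)
    also have "\<dots> \<le> 2 ^ n * \<bar>A v ^ n\<bar>" using n by (intro mult_right_mono self_le_power) auto
    also have "\<dots> = (2 * \<bar>A v\<bar>) ^ n" by (simp add: power_mult_distrib power_abs)
    finally show "\<bar>num v\<bar> \<le> 2 * \<bar>A v\<bar>" using n by (intro abs_le_of_power_le) auto
  qed
  have main: "(of_int (den v) * real_of_rat (min \<bar>v\<bar> \<bar>w\<bar>)) ^ 3 \<le> K * (of_int \<bar>num v\<bar> * of_int \<bar>num w\<bar>)"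
    if P: "P v" "P w" "cls v = cls w" and ne: "v \<noteq> w" and d: "den v dvd den w" for v w
  proof -
    obtain m where m: "den v dvd b ^ m" using P unfolding P_def admissible_def by blast
    have ne': "A v * num w ^ 1 \<noteq> A w * num v ^ 1"
    proof
      assume "A v * num w ^ 1 = A w * num v ^ 1"
      then have "(A v * num w) ^ n = (A w * num v) ^ n" by simp
      then have "den v ^ n * num w ^ n = den w ^ n * num v ^ n"
        using A[OF P(1), symmetric] A[OF P(2), symmetric] by (simp add: power_mult_distrib algebra_simps)
      then have "(den v * num w) ^ n = (den w * num v) ^ n" by (simp add: power_mult_distrib)
      then have "den v * num w = den w * num v" using odd_power_inject[OF n(1)] by blast
      then have "(of_int (den v) * of_int (num w) :: rat) = of_int (den w) * of_int (num v)" by (metis of_int_mult)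
      then have "v = w" using rat_eq_num_den[of v] rat_eq_num_den[of w] den_pos[of v] den_pos[of w]
        by (metis (no_types, lifting) frac_eq_eq less_irrefl mult.commute of_int_eq_0_iff)
      with ne show False by simp
    qed
    let ?r = "real_of_int (den v ^ n) / real_of_int (\<bar>num v\<bar> ^ n) + real_of_int (den w ^ n) / real_of_int (\<bar>num w\<bar> ^ n)"
    have gap: "real_of_int (den v ^ n) \<le> 2 * real n * 1 * 2 ^ (n - 1) * real_of_int ((\<bar>num v\<bar> * \<bar>num w\<bar>) ^ 1) * ?r"
    proof (rule gap_of_congruent_solutions[where K = 1 and T = 2 and g = 1 and h = 1 and R = 1 and R' = 1 and b = b and m = "m * n" and k = 1 and \<beta> = "A v" and \<beta>' = "A w"])
      show "den v ^ n dvd b ^ (m * n)" using m by (simp add: power_mult dvd_power_same)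
      show "int n * b dvd num v - num w" "int n * b dvd A v - A w"
        using P(3) by (simp_all add: cls_def mod_eq_dvd_iff)
      have "real_of_int \<bar>num v\<bar> \<le> real_of_int (2 * \<bar>A v\<bar>)" using facts(4)[OF P(1)] by (simp only: of_int_le_iff)
      then show "real_of_int \<bar>num v\<bar> ^ 1 \<le> 2 * real_of_int \<bar>A v\<bar>" by simp
      show "(1::int) * A v ^ n = 1 * num v ^ (n * 1) + den v ^ n * 1"
        "(1::int) * A w ^ n = 1 * num w ^ (n * 1) + den w ^ n * 1"
        using A[OF P(1)] A[OF P(2)] by simp_all
      show "den v ^ n dvd den w ^ n" using d by (rule dvd_power_same)
      show "den v ^ n > 0" "den w ^ n > 0" using den_pos by simp_all
      show "coprime (num v) b" "coprime (num w) b" "coprime (A v) b" "coprime (A w) b" "num v \<noteq> 0" "num w \<noteq> 0"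
        using facts P by blast+
      show "A v * num w ^ 1 \<noteq> A w * num v ^ 1" by (rule ne')
      show "odd n" by (rule n)
    qed simp_all
    define V where "V = real_of_rat (min \<bar>v\<bar> \<bar>w\<bar>)"
    have V4: "V \<ge> 4" using P unfolding V_def P_def admissible_def by (metis min.bounded_iff of_rat_less_eq of_rat_numeral_eq)
    have t: "real_of_int (den u ^ n) / real_of_int (\<bar>num u\<bar> ^ n) \<le> 1 / V ^ n" if "u = v \<or> u = w" for u
    proof -
      have "V \<le> real_of_int \<bar>num u\<bar> / real_of_int (den u)"
        unfolding real_abs_eq[symmetric] V_def using that by (auto simp: of_rat_less_eq)
      then have "V ^ n \<le> (real_of_int \<bar>num u\<bar> / real_of_int (den u)) ^ n" using V4 by (intro power_mono) auto
      then have "1 / (real_of_int \<bar>num u\<bar> / real_of_int (den u)) ^ n \<le> 1 / V ^ n" using V4 by (intro frac_le) simp_all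
      then show ?thesis by (simp add: power_divide)
    qed
    have "?r \<le> 2 / V ^ n" using t[of v] t[of w] by simp
    then have "2 * real n * 1 * 2 ^ (n - 1) * real_of_int ((\<bar>num v\<bar> * \<bar>num w\<bar>) ^ 1) * ?r \<le> 2 * real n * 1 * 2 ^ (n - 1) * real_of_int ((\<bar>num v\<bar> * \<bar>num w\<bar>) ^ 1) * (2 / V ^ n)"
      by (intro mult_left_mono) auto
    with gap have "real_of_int (den v ^ n) \<le> K * (of_int \<bar>num v\<bar> * of_int \<bar>num w\<bar>) / V ^ n"
      by (simp add: K_def mult_ac)
    then have "(real_of_int (den v) * V) ^ n \<le> K * (of_int \<bar>num v\<bar> * of_int \<bar>num w\<bar>)"
      using V4 by (simp add: field_simps)
    moreover have "1 * 1 \<le> real_of_int (den v) * V" using den_pos[of v] V4 by (intro mult_mono) auto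
    then have "(real_of_int (den v) * V) ^ 3 \<le> (real_of_int (den v) * V) ^ n" using n by (intro power_increasing) auto
    ultimately show ?thesis by (simp add: V_def)
  qed
  have "1 * 1 \<le> real n * 2 ^ (n - 1)" using n by (intro mult_mono) auto
  then have "K \<ge> 1" unfolding K_def by simp
  moreover have "finite F" by (simp add: F_def)
  moreover have "cls v \<in> F" for v using nb by (simp add: F_def cls_def)
  ultimately show ?thesis using main unfolding sparse_def P_def by blast
qed

text \<open>A common prime of C - E and the quotient divides q * E^(q-1) and is coprime to E, so it
  is q. Coprimality to b is claimed for q^j and not for q: when q divides b, the quotient is coprime
  to q and j = 0.\<close>

lemma catalan_decompose:
  fixes C E A b :: int
  assumes eq: "C ^ q - E ^ q = A ^ n" and q: "prime q" "q \<ge> 3" and n: "odd n"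
    and cop: "coprime C E" and E: "E > 0" "4 * E \<le> \<bar>C\<bar>" and b: "b dvd E ^ m"
  shows "\<exists>i<n. \<exists>j<n. \<exists>\<alpha> \<beta>. C - E = int q ^ i * \<alpha> ^ n \<and> power_quotient q C E = int q ^ j * \<beta> ^ n \<and>
    coprime (int q ^ j) b \<and> coprime \<alpha> b \<and> coprime \<beta> b"
proof -
  define S where "S = power_quotient q C E"
  have DS: "(C - E) * S = A ^ n" using eq power_quotient[of C q E] by (simp add: S_def)
  have qodd: "odd q" using q prime_odd_nat by fastforce
  have D0: "C - E \<noteq> 0" using E by auto
  obtain R where R: "S = (C - E) ^ (q - 1) + E * R"
    using power_quotient_expand[of E C q] q E unfolding S_def by (auto simp: abs_if split: if_splits)
  have cD: "coprime (C - E) E" using coprime_add_multiple[OF cop, of "- E"] by simp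
  then have cS: "coprime S E" unfolding R by (intro coprime_add_multiple) auto
  have cb: "coprime x b" if "coprime x E" for x
    using coprime_divisors[OF dvd_refl b, of x] that by simp
  have S0: "S \<noteq> 0"
  proof
    assume "S = 0"
    then have "C ^ q = E ^ q" using power_quotient[of C q E] by (simp add: S_def)
    then show False using odd_power_inject[OF qodd, of C E] D0 by simp
  qed
  have l: "l = q" if l: "prime l" "int l dvd C - E" "int l dvd S" for l
  proof -
    have "int l dvd S - int q * E ^ (q - 1)"
      unfolding S_def by (rule dvd_trans[OF l(2) power_quotient_cong])
    from dvd_diff[OF l(3) this]
    have "int l dvd int q * E ^ (q - 1)" by simp
    moreover have "coprime (int l) E" by (rule coprime_divisors[OF l(2) dvd_refl cD])
    then have "coprime (int l) (E ^ (q - 1))" by simp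
    ultimately have "int l dvd int q" by (simp add: coprime_dvd_mult_left_iff)
    then show "l = q" using l(1) q(1) by (simp add: primes_dvd_imp_eq)
  qed
  obtain i \<alpha> where i: "i < n" "C - E = int q ^ i * \<alpha> ^ n"
    by (rule prime_power_times_nth_power[OF DS D0 S0 n q(1)]) (use l in blast)+
  have SD: "S * (C - E) = A ^ n" using DS by (simp add: mult.commute)
  obtain j \<beta> where j: "j < n" "S = int q ^ j * \<beta> ^ n"
    by (rule prime_power_times_nth_power[OF SD S0 D0 n q(1)]) (use l in blast)+
  have n0: "n > 0" using n by (rule odd_pos)
  have "coprime (int q ^ j) b" by (rule coprime_divisors[OF _ dvd_refl cb[OF cS]]) (simp add: j)
  moreover have "coprime \<beta> b" by (rule coprime_divisors[OF _ dvd_refl cb[OF cS]]) (simp add: j dvd_mult n0)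
  moreover have "coprime \<alpha> b" by (rule coprime_divisors[OF _ dvd_refl cb[OF cD]]) (simp add: i dvd_mult n0)
  ultimately show ?thesis using i j unfolding S_def by blast
qed

text \<open>With z = den/(num - den) = 1/(v - 1), the ratio of the quotient to (num - den)^(q-1)
  equals (1 + z)^q - z^q, and |v| >= 4 gives |z| < 1/2, where this function is injective. The ratio
  therefore determines v.\<close>

lemma catalan_ratio_inj:
  assumes q: "q \<ge> 2" and v: "\<bar>v\<bar> \<ge> 4" "\<bar>w\<bar> \<ge> 4"
    and eq: "power_quotient q (num v) (den v) * (num w - den w) ^ (q - 1) = power_quotient q (num w) (den w) * (num v - den v) ^ (q - 1)"
  shows "v = w"
proof -
  have D0: "num u - den u \<noteq> 0" if "\<bar>u\<bar> \<ge> 4" for u using admissible_num_ge[OF that] den_pos[of u] by auto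
  define z where "z = (\<lambda>u. of_int (den u) / of_int (num u - den u) :: rat)"
  have q1: "q = Suc (q - 1)" using q by simp
  have z: "(1 + z u) ^ q - z u ^ q = of_int (power_quotient q (num u) (den u)) / of_int (num u - den u) ^ (q - 1)"
    "\<bar>z u\<bar> < 1/2" "u = 1 + 1 / z u"
    if u: "\<bar>u\<bar> \<ge> 4" for u
  proof -
    let ?D = "of_int (num u - den u) :: rat"
    have D: "?D \<noteq> 0" using D0[OF u] by (simp only: of_int_eq_0_iff not_False_eq_True)
    have "1 + z u = of_int (num u) / ?D" using D by (simp add: z_def field_simps)
    then have "(1 + z u) ^ q - z u ^ q = of_int (num u ^ q - den u ^ q) / ?D ^ q"
      unfolding z_def by (simp add: power_divide diff_divide_distrib)
    also have "\<dots> = (?D * of_int (power_quotient q (num u) (den u))) / (?D * ?D ^ (q - 1))"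
      unfolding power_quotient by (subst q1) simp
    also have "\<dots> = of_int (power_quotient q (num u) (den u)) / ?D ^ (q - 1)" using D by simp
    finally show "(1 + z u) ^ q - z u ^ q = of_int (power_quotient q (num u) (den u)) / ?D ^ (q - 1)" .
    have "2 * den u < \<bar>num u - den u\<bar>" using admissible_num_ge[OF u] den_pos[of u] by linarith
    then have "of_int (2 * den u) < (of_int \<bar>num u - den u\<bar> :: rat)" by (simp only: of_int_less_iff)
    then show "\<bar>z u\<bar> < 1/2" using den_pos[of u] D by (simp add: z_def abs_divide field_simps)
    have "z u \<noteq> 0" using D den_pos[of u] by (simp add: z_def)
    have "1 + 1 / z u = of_int (num u) / of_int (den u)" using D den_pos[of u] by (simp add: z_def field_simps)
    then show "u = 1 + 1 / z u" using rat_eq_num_den[of u] by simp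
  qed
  have "(of_int (power_quotient q (num v) (den v)) * of_int (num w - den w) ^ (q - 1) :: rat) = of_int (power_quotient q (num w) (den w)) * of_int (num v - den v) ^ (q - 1)"
    using arg_cong[OF eq, of "of_int :: int \<Rightarrow> rat"] by (simp only: of_int_mult of_int_power)
  then have "(1 + z v) ^ q - z v ^ q = (1 + z w) ^ q - z w ^ q"
    unfolding z(1)[OF v(1)] z(1)[OF v(2)] using D0[OF v(1)] D0[OF v(2)] by (subst frac_eq_eq) (simp_all del: of_int_diff)
  then have "z v = z w" using power_diff_shift_inj z(2)[OF v(1)] z(2)[OF v(2)] q by blast
  then show ?thesis using z(3)[OF v(1)] z(3)[OF v(2)] by simp
qed

text \<open>Put k = q - 1 and E = \<open>den v\<close>. Since the quotient is (num v - den v)^k plus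
  a multiple of E, the two factors give q^j * \<beta>^n = q^(i*k) * \<alpha>^(n*k) + E * R, the form
  required by the gap inequality. It yields den v * V <= K1 * |\<alpha> v * \<alpha> w|^k with V the
  smaller of |v| and |w|. Cubing and 3*k <= n turn the right side into |\<alpha> v * \<alpha> w|^n,
  at most a constant times the product of the numerators.\<close>

lemma sparse_catalan:
  assumes q: "prime q" "q \<ge> 3" and n: "odd n" "n \<ge> 3 * (q - 1)"
  shows "sparse (\<lambda>v. admissible b v \<and> (\<exists>A. num v ^ q - den v ^ q = A ^ n))"
proof (cases "b = 0")
  case True
  have "\<not> admissible b v" for v
    using True den_pos[of v] by (auto simp: admissible_def)
  then show ?thesis unfolding sparse_def by (intro exI[of _ 1] conjI exI[of _ "{}"]) auto
next
  case b: False
  define P where "P = (\<lambda>v. admissible b v \<and> (\<exists>A. num v ^ q - den v ^ q = A ^ n))"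
  define dec where "dec = (\<lambda>v i j \<alpha> \<beta>. i < n \<and> j < n \<and> num v - den v = int q ^ i * \<alpha> ^ n \<and> power_quotient q (num v) (den v) = int q ^ j * \<beta> ^ n \<and>
    coprime (int q ^ j) b \<and> coprime \<alpha> b \<and> coprime \<beta> b)"
  have "\<exists>i j \<alpha> \<beta>. dec v i j \<alpha> \<beta>" if "P v" for v
  proof -
    obtain A where A: "num v ^ q - den v ^ q = A ^ n" using \<open>P v\<close> unfolding P_def by blast
    obtain m where m: "b dvd den v ^ m" using \<open>P v\<close> unfolding P_def admissible_def by blast
    have "4 * den v \<le> \<bar>num v\<bar>" using \<open>P v\<close> unfolding P_def admissible_def by (blast intro: admissible_num_ge)
    from catalan_decompose[OF A q n(1) coprime_num_den den_pos this m] show ?thesis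
      unfolding dec_def by blast
  qed
  then obtain i j \<alpha> \<beta> where dec: "\<And>v. P v \<Longrightarrow> dec v (i v) (j v) (\<alpha> v) (\<beta> v)" by metis
  define k where "k = q - 1"
  have k: "k \<ge> 1" "q = Suc k" "k - 1 = q - 2" using q by (auto simp: k_def)
  define N where "N = int n * \<bar>b\<bar>"
  have n0: "n > 0" "n \<ge> 3" using n q by auto
  have N: "N > 0" using n0 b by (simp add: N_def)
  \<comment> \<open>The exponents i and j belong to the class so that the coefficients g = q^j and h
    = q^(i*k) are the same for both solutions.\<close>
  define cls where "cls = (\<lambda>v. (i v, j v, \<alpha> v mod N, \<beta> v mod N))"
  define F where "F = {..<n} \<times> {..<n} \<times> {0..<N} \<times> {0..<N}"
  \<comment> \<open>A common bound for q^i and q^j, as i, j < n.\<close>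
  define U where "U = real q ^ n"
  define K0 where "K0 = real q * 2 ^ q * U ^ q"
  define T where "T = 2 ^ q * U"
  define K1 where "K1 = 2 * real n * K0 * T ^ (n - 1) * (4 * U)"
  have U1: "U \<ge> 1" using q by (simp add: U_def)
  have T1: "T \<ge> 1" using U1 unfolding T_def using mult_mono[of 1 "2 ^ q" 1 U] by simp
  have K01: "K0 \<ge> 1"
    using mult_mono[of 1 "real q * 2 ^ q" 1 "U ^ q"] mult_mono[of 1 "real q" 1 "2 ^ q"] U1 q by (simp add: K0_def)
  have K11: "K1 \<ge> 1"
  proof -
    have "1 * 1 * 1 * 1 \<le> (2 * real n) * K0 * T ^ (n - 1) * (4 * U)"
      using n0 K01 T1 U1 by (intro mult_mono) auto
    then show ?thesis by (simp add: K1_def)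
  qed
  have qp: "real q ^ l \<ge> 1" "real q ^ l \<le> U" if "l < n" for l
    using that q unfolding U_def by (auto intro: power_increasing)
  have facts: "\<alpha> v \<noteq> 0" "real_of_int \<bar>\<alpha> v\<bar> ^ k \<le> T * real_of_int \<bar>\<beta> v\<bar>" 
    "real_of_int \<bar>\<alpha> v\<bar> ^ n \<le> 2 * real_of_int \<bar>num v\<bar>"
    "real_of_int (den v) / real_of_int (\<bar>\<alpha> v\<bar> ^ n) \<le> 2 * U / real_of_rat \<bar>v\<bar>"
    "\<exists>R. power_quotient q (num v) (den v) = int q ^ (i v * k) * \<alpha> v ^ (n * k) + den v * R \<and>
      real_of_int \<bar>R\<bar> \<le> K0 * real_of_int (\<bar>\<alpha> v\<bar> ^ (n * (k - 1)))" if Pv: "P v" for v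
  proof -
    define C E D where "C = num v" and "E = den v" and "D = C - E"
    have v4: "\<bar>v\<bar> \<ge> 4" using Pv unfolding P_def admissible_def by blast
    have CE: "4 * E \<le> \<bar>C\<bar>" "E > 0" using admissible_num_ge[OF v4] den_pos[of v] by (auto simp: C_def E_def)
    have d: "i v < n" "j v < n" "D = int q ^ i v * \<alpha> v ^ n" "power_quotient q C E = int q ^ j v * \<beta> v ^ n"
      using dec[OF Pv] unfolding dec_def D_def C_def E_def by blast+
    have D0: "D \<noteq> 0" using CE by (auto simp: D_def)
    show \<alpha>0: "\<alpha> v \<noteq> 0" using d(3) D0 n0 by (metis mult_zero_right power_0_left less_irrefl)
    have Dr: "real_of_int \<bar>D\<bar> = real q ^ i v * real_of_int \<bar>\<alpha> v\<bar> ^ n"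
      by (simp add: d(3) abs_mult power_abs)
    have \<alpha>D: "real_of_int \<bar>\<alpha> v\<bar> ^ n \<le> real_of_int \<bar>D\<bar>"
      unfolding Dr using qp(1)[OF d(1)] mult_right_mono[of 1 "real q ^ i v" "real_of_int \<bar>\<alpha> v\<bar> ^ n"] by simp
    have D\<alpha>: "real_of_int \<bar>D\<bar> \<le> U * real_of_int \<bar>\<alpha> v\<bar> ^ n"
      unfolding Dr using qp(2)[OF d(1)] by (intro mult_right_mono) auto
    have DC: "\<bar>D\<bar> \<le> 2 * \<bar>C\<bar>" "\<bar>C\<bar> \<le> 2 * \<bar>D\<bar>" "\<bar>E\<bar> \<le> \<bar>D\<bar>" using CE unfolding D_def by (simp_all add: abs_if split: if_splits)
    have DCr: "real_of_int \<bar>D\<bar> \<le> 2 * real_of_int \<bar>C\<bar>" "real_of_int \<bar>C\<bar> \<le> 2 * real_of_int \<bar>D\<bar>"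
      using DC(1,2)[folded of_int_le_iff[where 'a = real]] by simp_all
    show "real_of_int \<bar>\<alpha> v\<bar> ^ n \<le> 2 * real_of_int \<bar>num v\<bar>" using \<alpha>D DCr by (simp add: C_def)
    have "real_of_int \<bar>C\<bar> > 0" using CE by simp
    have "real_of_int E * real_of_int \<bar>C\<bar> \<le> real_of_int E * (2 * U * real_of_int (\<bar>\<alpha> v\<bar> ^ n))"
      using D\<alpha> DCr CE by (intro mult_left_mono) auto
    then have "real_of_int E / real_of_int (\<bar>\<alpha> v\<bar> ^ n) \<le> 2 * U * real_of_int E / real_of_int \<bar>C\<bar>"
      using \<alpha>0 \<open>real_of_int \<bar>C\<bar> > 0\<close> by (simp add: field_simps)
    then show "real_of_int (den v) / real_of_int (\<bar>\<alpha> v\<bar> ^ n) \<le> 2 * U / real_of_rat \<bar>v\<bar>"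
      unfolding real_abs_eq by (simp add: C_def E_def)
    have qodd: "odd q" using q prime_odd_nat by fastforce
    have S1: "\<bar>C\<bar> ^ k \<le> 2 * \<bar>power_quotient q C E\<bar>"
    proof -
      have "\<bar>D\<bar> * \<bar>C\<bar> ^ k \<le> \<bar>D\<bar> * (2 * \<bar>power_quotient q C E\<bar>)"
        using abs_power_diff_ge[OF qodd, of C E] unfolding power_quotient D_def k_def by (simp add: abs_mult mult_ac)
      then show ?thesis using D0 by simp
    qed
    have "real_of_int \<bar>C\<bar> ^ k \<le> 2 * real_of_int \<bar>power_quotient q C E\<bar>"
      using S1[folded of_int_le_iff[where 'a = real]] by simp
    also have "real_of_int \<bar>power_quotient q C E\<bar> = real q ^ j v * real_of_int \<bar>\<beta> v\<bar> ^ n"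
      by (simp add: d(4) abs_mult power_abs)
    also have "\<dots> \<le> U * real_of_int \<bar>\<beta> v\<bar> ^ n" using qp(2)[OF d(2)] by (intro mult_right_mono) auto
    finally have Ck: "real_of_int \<bar>C\<bar> ^ k \<le> 2 * U * real_of_int \<bar>\<beta> v\<bar> ^ n" by simp
    have "(real_of_int \<bar>\<alpha> v\<bar> ^ k) ^ n = (real_of_int \<bar>\<alpha> v\<bar> ^ n) ^ k" by (simp add: mult.commute flip: power_mult)
    also have "\<dots> \<le> (2 * real_of_int \<bar>C\<bar>) ^ k" using \<alpha>D DCr by (intro power_mono) auto
    also have "\<dots> \<le> 2 ^ k * (2 * U * real_of_int \<bar>\<beta> v\<bar> ^ n)"
      unfolding power_mult_distrib using Ck by (intro mult_left_mono) auto
    also have "\<dots> = T * real_of_int \<bar>\<beta> v\<bar> ^ n" by (simp add: T_def k(2))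
    also have "\<dots> \<le> T ^ n * real_of_int \<bar>\<beta> v\<bar> ^ n" using T1 n0 by (intro mult_right_mono self_le_power) auto
    also have "\<dots> = (T * real_of_int \<bar>\<beta> v\<bar>) ^ n" by (simp add: power_mult_distrib)
    finally show "real_of_int \<bar>\<alpha> v\<bar> ^ k \<le> T * real_of_int \<bar>\<beta> v\<bar>"
      using T1 n0 power_mono_iff[of "real_of_int \<bar>\<alpha> v\<bar> ^ k" "T * real_of_int \<bar>\<beta> v\<bar>" n] by simp
    obtain R where R: "power_quotient q C E = D ^ (q - 1) + E * R" "\<bar>R\<bar> \<le> int q * 2 ^ q * \<bar>D\<bar> ^ (q - 2)"
      using power_quotient_expand[of E C q] DC(3) q unfolding D_def by auto
    have "D ^ (q - 1) = int q ^ (i v * k) * \<alpha> v ^ (n * k)"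
      by (simp add: d(3) k_def power_mult_distrib flip: power_mult)
    moreover have "real_of_int \<bar>R\<bar> \<le> K0 * real_of_int (\<bar>\<alpha> v\<bar> ^ (n * (k - 1)))"
    proof -
      have "real_of_int \<bar>R\<bar> \<le> real q * 2 ^ q * real_of_int \<bar>D\<bar> ^ (q - 2)"
        using R(2)[folded of_int_le_iff[where 'a = real]] by simp
      also have "\<dots> \<le> real q * 2 ^ q * (U * real_of_int \<bar>\<alpha> v\<bar> ^ n) ^ (q - 2)"
        using D\<alpha> by (intro mult_left_mono power_mono) auto
      also have "\<dots> = real q * 2 ^ q * U ^ (q - 2) * real_of_int (\<bar>\<alpha> v\<bar> ^ (n * (k - 1)))"
        unfolding k(3) by (simp add: power_mult_distrib power_mult)
      also have "\<dots> \<le> K0 * real_of_int (\<bar>\<alpha> v\<bar> ^ (n * (k - 1)))"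
        unfolding K0_def using U1 by (intro mult_right_mono mult_left_mono power_increasing) auto
      finally show ?thesis .
    qed
    ultimately show "\<exists>R. power_quotient q (num v) (den v) = int q ^ (i v * k) * \<alpha> v ^ (n * k) + den v * R \<and>
      real_of_int \<bar>R\<bar> \<le> K0 * real_of_int (\<bar>\<alpha> v\<bar> ^ (n * (k - 1)))"
      using R(1) unfolding C_def E_def by auto
  qed
  have main: "(of_int (den v) * real_of_rat (min \<bar>v\<bar> \<bar>w\<bar>)) ^ 3 \<le> (4 * K1 ^ 3) * (of_int \<bar>num v\<bar> * of_int \<bar>num w\<bar>)"
    if P: "P v" "P w" "cls v = cls w" and ne: "v \<noteq> w" and d: "den v dvd den w" for v w
  proof -
    obtain m where m: "den v dvd b ^ m" using P unfolding P_def admissible_def by blast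
    have v4: "\<bar>v\<bar> \<ge> 4" "\<bar>w\<bar> \<ge> 4" using P unfolding P_def admissible_def by blast+
    define g where "g = int q ^ j v"
    define h where "h = int q ^ (i v * k)"
    have ij: "i w = i v" "j w = j v" using P(3) by (simp_all add: cls_def)
    obtain R R' where R: "power_quotient q (num v) (den v) = h * \<alpha> v ^ (n * k) + den v * R"
      "power_quotient q (num w) (den w) = h * \<alpha> w ^ (n * k) + den w * R'"
      "real_of_int \<bar>R\<bar> \<le> K0 * real_of_int (\<bar>\<alpha> v\<bar> ^ (n * (k - 1)))"
      "real_of_int \<bar>R'\<bar> \<le> K0 * real_of_int (\<bar>\<alpha> w\<bar> ^ (n * (k - 1)))"
      using facts(5)[OF P(1)] facts(5)[OF P(2)] unfolding ij h_def by blast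
    have S: "power_quotient q (num v) (den v) = g * \<beta> v ^ n" "power_quotient q (num w) (den w) = g * \<beta> w ^ n"
      "num v - den v = int q ^ i v * \<alpha> v ^ n" "num w - den w = int q ^ i v * \<alpha> w ^ n"
      and cop: "coprime g b" "coprime (\<alpha> v) b" "coprime (\<alpha> w) b" "coprime (\<beta> v) b" "coprime (\<beta> w) b"
      using dec[OF P(1)] dec[OF P(2)] unfolding dec_def ij g_def by blast+
    \<comment> \<open>Equality would make the ratios quotient/(num - den)^(q-1) of v and w
      coincide.\<close>
    have ne': "\<beta> v * \<alpha> w ^ k \<noteq> \<beta> w * \<alpha> v ^ k"
    proof
      assume "\<beta> v * \<alpha> w ^ k = \<beta> w * \<alpha> v ^ k"
      then have "(\<beta> v * \<alpha> w ^ k) ^ n = (\<beta> w * \<alpha> v ^ k) ^ n" by simp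
      then have "\<beta> v ^ n * (\<alpha> w ^ n) ^ k = \<beta> w ^ n * (\<alpha> v ^ n) ^ k"
        by (simp add: power_mult_distrib mult.commute flip: power_mult)
      then have "power_quotient q (num v) (den v) * (num w - den w) ^ (q - 1) = power_quotient q (num w) (den w) * (num v - den v) ^ (q - 1)"
        unfolding S by (simp add: power_mult_distrib k_def)
      then show False using catalan_ratio_inj[of q v w] v4 q ne by simp
    qed
    let ?r = "real_of_int (den v) / real_of_int (\<bar>\<alpha> v\<bar> ^ n) + real_of_int (den w) / real_of_int (\<bar>\<alpha> w\<bar> ^ n)"
    have gap: "real_of_int (den v) \<le> 2 * real n * K0 * T ^ (n - 1) * real_of_int ((\<bar>\<alpha> v\<bar> * \<bar>\<alpha> w\<bar>) ^ k) * ?r"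
    proof (rule gap_of_congruent_solutions[where g = g and h = h and R = R and R' = R' and b = b and m = m and \<beta> = "\<beta> v" and \<beta>' = "\<beta> w"])
      show "den v dvd b ^ m" "den v dvd den w" by fact+
      show "den v > 0" "den w > 0" using den_pos by simp_all
      show "g > 0" using q by (simp add: g_def)
      show "g * \<beta> v ^ n = h * \<alpha> v ^ (n * k) + den v * R" using S(1) R(1) by simp
      show "g * \<beta> w ^ n = h * \<alpha> w ^ (n * k) + den w * R'" using S(2) R(2) by simp
      have "N dvd \<alpha> v - \<alpha> w" "N dvd \<beta> v - \<beta> w" using P(3) by (simp_all add: cls_def mod_eq_dvd_iff)
      moreover have "int n * b dvd N" by (simp add: N_def)
      ultimately show "int n * b dvd \<alpha> v - \<alpha> w" "int n * b dvd \<beta> v - \<beta> w" using dvd_trans by blast+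
      show "real_of_int \<bar>\<alpha> v\<bar> ^ k \<le> T * real_of_int \<bar>\<beta> v\<bar>" "\<alpha> v \<noteq> 0" "\<alpha> w \<noteq> 0" using facts P by blast+
      show "0 < T" "0 \<le> K0" using T1 K01 by simp_all
    qed (fact n(1) k(1) R cop ne')+
    define V where "V = real_of_rat (min \<bar>v\<bar> \<bar>w\<bar>)"
    have "real_of_rat 4 \<le> V" using v4 unfolding V_def by (simp only: of_rat_less_eq min.bounded_iff)
    then have V4: "V \<ge> 4" by simp
    have t: "2 * U / real_of_rat \<bar>u\<bar> \<le> 2 * U / V" if "u = v \<or> u = w" for u
      using that V4 U1 unfolding V_def by (intro frac_le) (auto simp: of_rat_less_eq)
    have "?r \<le> 2 * U / V + 2 * U / V" using facts(4)[OF P(1)] facts(4)[OF P(2)] t[of v] t[of w] by simp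
    then have "2 * real n * K0 * T ^ (n - 1) * real_of_int ((\<bar>\<alpha> v\<bar> * \<bar>\<alpha> w\<bar>) ^ k) * ?r \<le> 
        2 * real n * K0 * T ^ (n - 1) * real_of_int ((\<bar>\<alpha> v\<bar> * \<bar>\<alpha> w\<bar>) ^ k) * (4 * U / V)"
      using K01 T1 by (intro mult_left_mono) auto
    with gap have "real_of_int (den v) \<le> K1 * real_of_int ((\<bar>\<alpha> v\<bar> * \<bar>\<alpha> w\<bar>) ^ k) / V"
      by (simp add: K1_def mult_ac)
    then have "real_of_int (den v) * V \<le> K1 * real_of_int ((\<bar>\<alpha> v\<bar> * \<bar>\<alpha> w\<bar>) ^ k)"
      using V4 by (simp add: field_simps)
    then have "(real_of_int (den v) * V) ^ 3 \<le> (K1 * real_of_int ((\<bar>\<alpha> v\<bar> * \<bar>\<alpha> w\<bar>) ^ k)) ^ 3"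
      using den_pos[of v] V4 by (intro power_mono) auto
    also have "\<dots> = K1 ^ 3 * real_of_int (\<bar>\<alpha> v\<bar> * \<bar>\<alpha> w\<bar>) ^ (3 * k)"
      by (simp add: power_mult_distrib mult.commute[of 3 k] power_mult)
    also have "\<dots> \<le> K1 ^ 3 * real_of_int (\<bar>\<alpha> v\<bar> * \<bar>\<alpha> w\<bar>) ^ n"
    proof (intro mult_left_mono power_increasing)
      show "3 * k \<le> n" using n by (simp add: k_def)
      have "\<alpha> v \<noteq> 0" "\<alpha> w \<noteq> 0" using facts P by blast+
      then have "\<bar>\<alpha> v\<bar> * \<bar>\<alpha> w\<bar> > 0" by simp
      then have "1 \<le> \<bar>\<alpha> v\<bar> * \<bar>\<alpha> w\<bar>" by linarith
      then show "1 \<le> real_of_int (\<bar>\<alpha> v\<bar> * \<bar>\<alpha> w\<bar>)" by (simp only: of_int_1_le_iff)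
    qed (use K11 in simp)
    also have "\<dots> = K1 ^ 3 * (real_of_int \<bar>\<alpha> v\<bar> ^ n * real_of_int \<bar>\<alpha> w\<bar> ^ n)" by (simp add: power_mult_distrib)
    also have "\<dots> \<le> K1 ^ 3 * ((2 * real_of_int \<bar>num v\<bar>) * (2 * real_of_int \<bar>num w\<bar>))"
      using facts(3)[OF P(1)] facts(3)[OF P(2)] K11 by (intro mult_left_mono mult_mono) auto
    finally show ?thesis by (simp add: V_def mult_ac)
  qed
  have "1 \<le> 4 * K1 ^ 3" using one_le_power[OF K11, of 3] by simp
  moreover have "finite F" by (simp add: F_def)
  moreover have "cls v \<in> F" if "P v" for v using N dec[OF that] by (simp add: F_def cls_def dec_def)
  ultimately show ?thesis using main unfolding sparse_def P_def by blast
qed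

section \<open>Counting collisions\<close>

text \<open>Refine each class by the integer part of log Q to base 5/4. Two points of one cell
  satisfy Q w <= 5/4 * Q v, whereas the gap inequality reads, in logarithms, roughly 3 * Q v *
  (\<beta> + L) <= (Q v + Q w) * (\<beta> + L), which fails for large L. So each cell holds at most
  one point. \<open>C\<close> and \<open>L0\<close> depend on \<open>P\<close> only, while
  \<open>S\<close>, \<open>Q\<close>, \<open>X\<close>, \<beta> and \<open>L\<close> are free to
  vary with the starting point.\<close>

lemma sparse_count:
  assumes "sparse P"
  obtains C L0 where "C \<ge> 0" "\<And>S Q X \<beta> L. \<lbrakk>\<And>v. v \<in> S \<Longrightarrow> P v \<and> \<bar>v\<bar> \<ge> 4 \<and> 1 \<le> Q v \<and> Q v \<le> X \<and>
        ln (real_of_int (den v)) = Q v * \<beta> \<and> \<bar>ln (real_of_rat \<bar>v\<bar>) - Q v * L\<bar> \<le> Q v * ln 2;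
      \<And>v w. v \<in> S \<Longrightarrow> w \<in> S \<Longrightarrow> Q v \<le> Q w \<Longrightarrow> den v dvd den w; L \<ge> L0; \<beta> \<ge> 0; X \<ge> 1\<rbrakk>
      \<Longrightarrow> finite S \<and> real (card S) \<le> C * (1 + ln X)"
proof -
  obtain K F and cls :: "rat \<Rightarrow> nat \<times> nat \<times> int \<times> int" where K: "K \<ge> 1" and F: "finite F" "\<And>v. P v \<Longrightarrow> cls v \<in> F"
    and gap: "\<And>v w. P v \<Longrightarrow> P w \<Longrightarrow> cls v = cls w \<Longrightarrow> v \<noteq> w \<Longrightarrow> den v dvd den w \<Longrightarrow>
        (of_int (den v) * real_of_rat (min \<bar>v\<bar> \<bar>w\<bar>)) ^ 3 \<le> K * (of_int \<bar>num v\<bar> * of_int \<bar>num w\<bar>)"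
    using assms unfolding sparse_def by metis
  define c where "c = ln (5/4 :: real)"
  have c: "c > 0" by (simp add: c_def)
  show thesis
  proof (rule that[of "real (card F) * (1 + 1 / c)" "2 * ln K + 8"])
    show "0 \<le> real (card F) * (1 + 1 / c)" using c by simp
  next
    fix S and Q :: "rat \<Rightarrow> real" and X \<beta> L :: real
    assume S: "\<And>v. v \<in> S \<Longrightarrow> P v \<and> \<bar>v\<bar> \<ge> 4 \<and> 1 \<le> Q v \<and> Q v \<le> X \<and>
        ln (real_of_int (den v)) = Q v * \<beta> \<and> \<bar>ln (real_of_rat \<bar>v\<bar>) - Q v * L\<bar> \<le> Q v * ln 2"
      and dvd: "\<And>v w. v \<in> S \<Longrightarrow> w \<in> S \<Longrightarrow> Q v \<le> Q w \<Longrightarrow> den v dvd den w"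
      and L: "L \<ge> 2 * ln K + 8" and \<beta>: "\<beta> \<ge> 0" and X: "X \<ge> 1"
    define f where "f = (\<lambda>v. (cls v, nat \<lfloor>ln (Q v) / c\<rfloor>))"
    have eq: "v = w" if v: "v \<in> S" and w: "w \<in> S" and le: "Q v \<le> Q w" and f: "f v = f w" for v w
    proof (rule ccontr)
      assume ne: "v \<noteq> w"
      note Sv = S[OF v] and Sw = S[OF w]
      have nn: "ln (Q v) / c \<ge> 0" "ln (Q w) / c \<ge> 0" using Sv Sw c by simp_all
      have "\<lfloor>ln (Q v) / c\<rfloor> = \<lfloor>ln (Q w) / c\<rfloor>"
        using f nn eq_nat_nat_iff[of "\<lfloor>ln (Q v) / c\<rfloor>" "\<lfloor>ln (Q w) / c\<rfloor>"] by (simp add: f_def)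
      then have "ln (Q w) / c < ln (Q v) / c + 1" by linarith
      then have "ln (Q w) < ln (Q v) + ln (5/4)" using c by (simp add: field_simps c_def)
      also have "\<dots> = ln (Q v * (5/4))" using Sv by (subst ln_mult) auto
      finally have Qw: "Q w \<le> 5/4 * Q v" using Sv Sw by (subst (asm) ln_less_cancel_iff) auto
      define a a' where "a = ln (real_of_rat \<bar>v\<bar>)" and "a' = ln (real_of_rat \<bar>w\<bar>)"
      have pos: "real_of_rat \<bar>v\<bar> > 0" "real_of_rat \<bar>w\<bar> > 0" using Sv Sw by auto
      have numr: "real_of_int \<bar>num u\<bar> = real_of_int (den u) * real_of_rat \<bar>u\<bar>" for u
        using den_pos[of u] unfolding real_abs_eq by simp
      have dp: "real_of_int (den u) > 0" for u using den_pos by simp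
      define \<mu> where "\<mu> = min a a'"
      define M where "M = real_of_rat (min \<bar>v\<bar> \<bar>w\<bar>)"
      have M: "M > 0" "ln M \<ge> min a a'"
        using pos unfolding M_def a_def a'_def min_def by auto
      have "(of_int (den v) * M) ^ 3 \<le> K * (of_int \<bar>num v\<bar> * of_int \<bar>num w\<bar>)"
        using gap[of v w] Sv Sw f ne dvd[OF v w le] unfolding M_def by (simp add: f_def)
      then have "ln ((of_int (den v) * M) ^ 3) \<le> ln (K * ((of_int (den v) * real_of_rat \<bar>v\<bar>) * (of_int (den w) * real_of_rat \<bar>w\<bar>)))"
        unfolding numr using K pos dp[of v] dp[of w] M by (subst ln_le_cancel_iff) auto
      moreover have "ln ((of_int (den v) * M) ^ 3) = 3 * (Q v * \<beta> + ln M)"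
        using dp[of v] M Sv by (simp add: ln_realpow ln_mult)
      moreover have "ln (K * ((of_int (den v) * real_of_rat \<bar>v\<bar>) * (of_int (den w) * real_of_rat \<bar>w\<bar>))) = ln K + (Q v * \<beta> + a + (Q w * \<beta> + a'))"
        using dp[of v] dp[of w] pos K Sv Sw by (simp add: ln_mult a_def a'_def)
      ultimately have main: "3 * (Q v * \<beta> + min a a') \<le> ln K + (Q v * \<beta> + a + (Q w * \<beta> + a'))"
        using M(2) by (metis (no_types, lifting) add_left_mono mult_left_mono order_trans zero_le_numeral)
      have l2: "ln 2 \<le> (1::real)" using ln_le_minus_one[of "2::real"] by simp
      have L2: "L - ln 2 \<ge> 0" using L K l2 ln_ge_zero[OF K] by linarith
      have a: "a \<ge> Q v * (L - ln 2)" "a \<le> Q v * (L + ln 2)" "a' \<ge> Q w * (L - ln 2)" "a' \<le> Q w * (L + ln 2)"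
        using Sv Sw unfolding a_def a'_def by (auto simp: algebra_simps abs_le_iff)
      have "Q v * (L - ln 2) \<le> Q w * (L - ln 2)" using le L2 by (rule mult_right_mono)
      then have m: "min a a' \<ge> Q v * (L - ln 2)" using a by simp
      have "ln 2 \<ge> (0::real)" by simp
      then have bL: "\<beta> + (L + ln 2) \<ge> 0" using \<beta> L2 by linarith
      have "Q w * (\<beta> + (L + ln 2)) \<le> 5/4 * Q v * (\<beta> + (L + ln 2))" using Qw bL by (intro mult_right_mono) auto
      moreover have "a + Q v * \<beta> \<le> Q v * (\<beta> + (L + ln 2))" using a(2) by (simp add: algebra_simps)
      moreover have "a' + Q w * \<beta> \<le> Q w * (\<beta> + (L + ln 2))" using a(4) by (simp add: algebra_simps)
      ultimately have "3 * (Q v * \<beta> + Q v * (L - ln 2)) \<le> ln K + (Q v * (\<beta> + (L + ln 2)) + 5/4 * Q v * (\<beta> + (L + ln 2)))"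
        using main[folded \<mu>_def] m[folded \<mu>_def] by argo
      \<comment> \<open>3 - 1 - 5/4 = 3/4 is the surplus of the main terms, and (3 + 1 + 5/4) * ln 2
        = 21/4 * ln 2 collects the errors in ln |v| and ln |w|; the bound
        \<open>2 * ln K + 8\<close> for L outweighs these together with ln K.\<close>
      then have "Q v * (3/4 * \<beta> + 3/4 * L - 21/4 * ln 2) \<le> ln K" by argo
      moreover have "ln K + 1/2 \<le> 1 * (3/4 * \<beta> + 3/4 * L - 21/4 * ln 2)"
        using L \<beta> ln_ge_zero[OF K] l2 by argo
      moreover have "1 * (3/4 * \<beta> + 3/4 * L - 21/4 * ln 2) \<le> Q v * (3/4 * \<beta> + 3/4 * L - 21/4 * ln 2)"
        using Sv calculation(2) ln_ge_zero[OF K] by (intro mult_right_mono) auto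
      ultimately show False by linarith
    qed
    have inj: "inj_on f S"
      using eq by (intro inj_onI) (metis linorder_linear)
    define T where "T = F \<times> {..nat \<lfloor>ln X / c\<rfloor>}"
    have "f v \<in> T" if "v \<in> S" for v
    proof -
      have "ln (Q v) / c \<le> ln X / c" using S[OF that] c X by (intro divide_right_mono) auto
      then show ?thesis using F(2) S[OF that] by (auto simp: T_def f_def intro!: nat_mono floor_mono)
    qed
    then have sub: "f ` S \<subseteq> T" by blast
    have fin: "finite T" using F by (simp add: T_def)
    have "card S \<le> card T" using inj sub fin by (rule card_inj_on_le)
    also have "card T = card F * Suc (nat \<lfloor>ln X / c\<rfloor>)" by (simp add: T_def card_cartesian_product)
    finally have "real (card S) \<le> real (card F) * (1 + real (nat \<lfloor>ln X / c\<rfloor>))"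
      by (metis of_nat_Suc of_nat_le_iff of_nat_mult add.commute)
    also have "real (nat \<lfloor>ln X / c\<rfloor>) \<le> ln X / c" using X c by (intro of_nat_floor) simp
    then have "real (card F) * (1 + real (nat \<lfloor>ln X / c\<rfloor>)) \<le> real (card F) * (1 + ln X / c)"
      by (intro mult_left_mono) auto
    also have "\<dots> \<le> real (card F) * ((1 + 1 / c) * (1 + ln X))"
      using c X by (intro mult_left_mono) (auto simp: field_simps)
    finally have "real (card S) \<le> real (card F) * (1 + 1 / c) * (1 + ln X)" by (simp add: mult.assoc)
    moreover have "finite S" using inj_on_finite[OF inj sub fin] .
    ultimately show "finite S \<and> real (card S) \<le> real (card F) * (1 + 1 / c) * (1 + ln X)" by simp
  qed
qed

section \<open>Seven Mersenne primes\<close>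

text \<open>The primes 2^n - 1 for n = 2, 3, 5, 7, 13, 17, 19. The lower estimate is drawn from
  words in these alone: a finite alphabet has a largest letter, and its collisions involve only
  finitely many pairs of exponents.\<close>

definition letters :: "nat set" where
  "letters = {3, 7, 31, 127, 8191, 131071, 524287}"

text \<open>Every prime divisor of \<open>2 ^ p - 1\<close> is congruent to 1 modulo \<open>p\<close>.\<close>

lemma mersenne_prime_check:
  fixes p K :: nat
  assumes p: "prime p" "odd p" and K: "2 ^ p - 1 < (p * K + 1) ^ 2"
    and no: "\<forall>k\<in>set [2..<K]. \<not> (p * k + 1) dvd 2 ^ p - 1"
  shows "prime (2 ^ p - 1 :: nat)"
proof (rule ccontr)
  define M :: nat where "M = 2 ^ p - 1"
  assume "\<not> prime (2 ^ p - 1 :: nat)"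
  moreover have M2: "2 ^ p \<ge> (4 :: nat)" using power_increasing[of 2 p "2::nat"] prime_ge_2_nat[OF p(1)] by simp
  then have "M > 1" by (simp add: M_def)
  ultimately obtain d e where de: "M = d * e" "d \<noteq> 1" "e \<noteq> 1"
    unfolding prime_nat_iff M_def[symmetric] by (auto elim!: dvdE)
  define c where "c = min d e"
  have c: "c dvd M" "c \<noteq> 1" "c * c \<le> M" using de by (auto simp: c_def min_def intro: mult_mono)
  then obtain l where l: "prime l" "l dvd c" using prime_factor_nat by blast
  have "c > 0" using \<open>M > 1\<close> c(1) by (metis dvd_0_left gr0I less_nat_zero_code)
  then have "l \<le> c" using l(2) by (simp add: dvd_imp_le)
  then have ll: "l ^ 2 \<le> M" using c(3) mult_mono[of l c l c] by (simp add: power2_eq_square)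
  have lM: "l dvd 2 ^ p - 1" using l(2) c(1) dvd_trans unfolding M_def by blast
  then have c1: "[2 ^ p = 1] (mod l)" using M2 by (simp add: cong_altdef_nat)
  then have "ord l 2 dvd p" by (rule iffD1[OF ord_divides])
  then have "ord l 2 = 1 \<or> ord l 2 = p" using p(1) by (auto simp: prime_nat_iff)
  moreover have "ord l 2 \<noteq> 1"
  proof
    assume "ord l 2 = 1"
    then have "[2 ^ 1 = 1] (mod l)" using ord[of 2 l] by simp
    then have "l dvd 1" by (simp add: cong_altdef_nat)
    then show False using l(1) by auto
  qed
  moreover have "\<not> l dvd 2"
  proof
    assume "l dvd 2"
    then have "l dvd 2 ^ p" using prime_gt_0_nat[OF p(1)] by (meson dvd_power dvd_trans)
    then have "l dvd 2 ^ p - (2 ^ p - 1)" using lM by (rule dvd_diff_nat)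
    then show False using l(1) M2 by simp
  qed
  then have "ord l 2 dvd l - 1" by (intro iffD1[OF ord_divides] fermat_theorem l(1))
  ultimately have "p dvd l - 1" by simp
  then obtain k where "l - 1 = p * k" by (auto elim: dvdE)
  then have k: "l = p * k + 1" using prime_gt_1_nat[OF l(1)] by simp
  have "l ^ 2 < (p * K + 1) ^ 2" using ll K by (simp add: M_def)
  then have "p * k < p * K" unfolding k using power_less_imp_less_base[of "p * k + 1" 2 "p * K + 1"] by simp
  then have "k < K" by simp
  moreover have "k \<noteq> 0" using k prime_gt_1_nat[OF l(1)] by auto
  \<comment> \<open>For k = 1 the divisor p + 1 would be even, which is why the trial divisors start
    at k = 2.\<close>
  moreover have "k \<noteq> 1"
  proof
    assume "k = 1"
    then have "even l" using k p(2) by simp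
    then have "l = 2" using l(1) prime_odd_nat[of l] prime_ge_2_nat[of l] by force
    then show False using k \<open>k = 1\<close> prime_gt_1_nat[OF p(1)] by auto
  qed
  ultimately have "k \<in> set [2..<K]" by simp
  then show False using no lM k by blast
qed

lemma letters_prime: "q \<in> letters \<Longrightarrow> prime q"
proof -
  have p: "prime (13::nat)" "prime (17::nat)" "prime (19::nat)" "prime (7::nat)" "prime (5::nat)" "prime (3::nat)" by simp_all
  have "prime (8191::nat)"
  proof -
    have "8191 = (2 ^ 13 - 1 :: nat)" by simp
    \<comment> \<open>Here and below, the last argument K makes p * K + 1 exceed the square root of
      the candidate.\<close>
    then show ?thesis by (simp only:) (rule mersenne_prime_check[OF p(1), of 8], simp_all)
  qed
  moreover have "prime (131071::nat)"
  proof -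
    have "131071 = (2 ^ 17 - 1 :: nat)" by simp
    then show ?thesis by (simp only:) (rule mersenne_prime_check[OF p(2), of 23], simp_all)
  qed
  moreover have "prime (524287::nat)"
  proof -
    have "524287 = (2 ^ 19 - 1 :: nat)" by simp
    then show ?thesis by (simp only:) (rule mersenne_prime_check[OF p(3), of 40], simp_all)
  qed
  moreover have "prime (127::nat)"
  proof -
    have "127 = (2 ^ 7 - 1 :: nat)" by simp
    then show ?thesis by (simp only:) (rule mersenne_prime_check[OF p(4), of 3], simp_all)
  qed
  moreover have "prime (31::nat)"
  proof -
    have "31 = (2 ^ 5 - 1 :: nat)" by simp
    then show ?thesis by (simp only:) (rule mersenne_prime_check[OF p(5), of 3], simp_all)
  qed
  ultimately show "q \<in> letters \<Longrightarrow> prime q" unfolding letters_def using p by blast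
qed

lemma letters_ge: "q \<in> letters \<Longrightarrow> q \<ge> 3"
  unfolding letters_def by auto

lemma letters_odd: "q \<in> letters \<Longrightarrow> odd q"
  using letters_prime[of q] letters_ge[of q] prime_odd_nat[of q] by simp

lemma letters_le: "q \<in> letters \<Longrightarrow> q \<le> 524287"
  unfolding letters_def by auto

lemma finite_letters: "finite letters"
  unfolding letters_def by simp

text \<open>This supplies the condition n >= 3 * (q - 1) of \<open>sparse_catalan\<close>. The
  tightest pair is 3 and 7, with 6 <= 7.\<close>

lemma letters_gap: "q \<in> letters \<Longrightarrow> p \<in> letters \<Longrightarrow> p < q \<Longrightarrow> 3 * (p - 1) \<le> q"
  unfolding letters_def by (elim insertE emptyE) simp_all

lemma letters_coprime: "q \<in> letters \<Longrightarrow> p \<in> letters \<Longrightarrow> p \<noteq> q \<Longrightarrow> coprime p q"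
  by (rule primes_coprime) (simp_all add: letters_prime)

section \<open>Denominators and sizes along an orbit\<close>

text \<open>No cancellation occurs, since num^q + den^q is coprime to den. Denominators along an
  orbit are thus exact powers of the initial one, and of two of them the smaller divides the
  larger.\<close>

lemma theta_num_den:
  assumes "q > 0"
  shows "num (theta q z) = num z ^ q + den z ^ q" "den (theta q z) = den z ^ q"
proof -
  have d: "(of_int (den z) :: rat) \<noteq> 0" using den_pos[of z] by simp
  have "theta q z = (of_int (num z) / of_int (den z)) ^ q + 1" unfolding theta_def using rat_eq_num_den[of z] by simp
  also have "\<dots> = of_int (num z ^ q + den z ^ q) / of_int (den z ^ q)" using d by (simp add: power_divide field_simps)
  finally have "theta q z = of_int (num z ^ q + den z ^ q) / of_int (den z ^ q)" .
  moreover have "coprime (num z ^ q + den z ^ q) (den z ^ q)"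
    using coprime_num_den[of z] by (intro coprime_add_multiple) simp_all
  moreover have "den z ^ q > 0" using den_pos[of z] by simp
  ultimately show "num (theta q z) = num z ^ q + den z ^ q" "den (theta q z) = den z ^ q"
    by (rule num_den_eqI)+
qed

lemma num_den_power: "num (z ^ q) = num z ^ q" "den (z ^ q) = den z ^ q"
proof -
  have "z ^ q = of_int (num z ^ q) / of_int (den z ^ q)" using rat_eq_num_den[of z] by (metis of_int_power power_divide)
  moreover have "coprime (num z ^ q) (den z ^ q)" using coprime_num_den[of z] by simp
  moreover have "den z ^ q > 0" using den_pos[of z] by simp
  ultimately show "num (z ^ q) = num z ^ q" "den (z ^ q) = den z ^ q" by (rule num_den_eqI)+
qed

lemma num_den_uminus: "num (- z) = - num z" "den (- z) = den z"
proof -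
  have "- z = of_int (- num z) / of_int (den z)" using rat_eq_num_den[of z] by simp
  moreover have "coprime (- num z) (den z)" using coprime_num_den[of z] by simp
  ultimately show "num (- z) = - num z" "den (- z) = den z" using den_pos[of z] by (rule num_den_eqI)+
qed

lemma den_fold_theta: "set ws \<subseteq> letters \<Longrightarrow> den (fold theta ws r) = den r ^ prod_list ws"
proof (induction ws rule: rev_induct)
  case (snoc q ws)
  then have "q > 0" using letters_ge[of q] by auto
  then show ?case using snoc by (simp add: theta_num_den flip: power_mult)
qed simp

lemma prod_list_pos: "set ws \<subseteq> letters \<Longrightarrow> prod_list ws \<ge> 1"
proof (induction ws)
  case (Cons q ws)
  then show ?case using letters_ge[of q] mult_le_mono[of 1 q 1 "prod_list ws"] by simp
qed simp

lemma ln_theta: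
  fixes z :: real
  assumes "\<bar>z\<bar> \<ge> 4" "q \<ge> 2"
  shows "\<bar>z ^ q + 1\<bar> \<ge> \<bar>z\<bar>" "\<bar>ln \<bar>z ^ q + 1\<bar> - q * ln \<bar>z\<bar>\<bar> \<le> ln 2"
proof -
  define y where "y = \<bar>z\<bar> ^ q"
  have "\<bar>z\<bar> ^ 2 \<le> y" unfolding y_def using assms by (intro power_increasing) auto
  moreover have "4 * \<bar>z\<bar> \<le> \<bar>z\<bar> ^ 2" unfolding power2_eq_square using assms by (intro mult_right_mono) auto
  ultimately have y: "y \<ge> 4 * \<bar>z\<bar>" by simp
  have yz: "\<bar>z ^ q\<bar> = y" by (simp add: y_def power_abs)
  have b: "\<bar>z ^ q + 1\<bar> \<le> y + 1" "\<bar>z ^ q + 1\<bar> \<ge> y - 1" using yz by linarith+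
  then show "\<bar>z ^ q + 1\<bar> \<ge> \<bar>z\<bar>" using y assms by linarith
  have "ln \<bar>z ^ q + 1\<bar> \<le> ln (2 * y)" using b y assms by (subst ln_le_cancel_iff) auto
  moreover have "ln (y / 2) \<le> ln \<bar>z ^ q + 1\<bar>" using b y assms by (subst ln_le_cancel_iff) auto
  moreover have "ln (2 * y) = ln 2 + ln y" "ln (y / 2) = ln y - ln 2" using y assms by (simp_all add: ln_mult ln_div)
  moreover have "ln y = q * ln \<bar>z\<bar>" using assms by (simp add: y_def ln_realpow)
  ultimately show "\<bar>ln \<bar>z ^ q + 1\<bar> - q * ln \<bar>z\<bar>\<bar> \<le> ln 2" by linarith
qed

lemma fold_theta_size:
  assumes "set ws \<subseteq> letters" "\<bar>r\<bar> \<ge> 4"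
  shows "\<bar>fold theta ws r\<bar> \<ge> 4"
    "\<bar>ln (real_of_rat \<bar>fold theta ws r\<bar>) - real (prod_list ws) * ln (real_of_rat \<bar>r\<bar>)\<bar> \<le> real (prod_list ws) * ln 2"
proof -
  define L where "L = ln (real_of_rat \<bar>r\<bar>)"
  \<comment> \<open>The error is sharpened to (Q - 1) * ln 2, which closes the induction: q * (Q -
    1) + 1 <= q * Q - 1 because q >= 2.\<close>
  have "\<bar>real_of_rat (fold theta ws r)\<bar> \<ge> 4 \<and>
    \<bar>ln \<bar>real_of_rat (fold theta ws r)\<bar> - real (prod_list ws) * L\<bar> \<le> (real (prod_list ws) - 1) * ln 2"
    using assms(1)
  proof (induction ws rule: rev_induct)
    case Nil
    have "real_of_rat 4 \<le> real_of_rat \<bar>r\<bar>" using assms(2) by (simp only: of_rat_less_eq)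
    then show ?case by (simp add: L_def)
  next
    case (snoc q ws)
    define z Q where "z = real_of_rat (fold theta ws r)" and "Q = real (prod_list ws)"
    have IH: "\<bar>z\<bar> \<ge> 4" "\<bar>ln \<bar>z\<bar> - Q * L\<bar> \<le> (Q - 1) * ln 2" using snoc by (auto simp: z_def Q_def)
    have q: "q \<ge> 2" using snoc letters_ge[of q] by auto
    have e: "real_of_rat (fold theta (ws @ [q]) r) = z ^ q + 1"
      by (simp add: theta_def z_def of_rat_add of_rat_power)
    have "\<bar>q * ln \<bar>z\<bar> - q * (Q * L)\<bar> = q * \<bar>ln \<bar>z\<bar> - Q * L\<bar>" by (simp add: abs_mult flip: right_diff_distrib)
    also have "\<dots> \<le> q * ((Q - 1) * ln 2)" using IH by (intro mult_left_mono) auto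
    finally have "\<bar>ln \<bar>z ^ q + 1\<bar> - q * (Q * L)\<bar> \<le> ln 2 + q * ((Q - 1) * ln 2)"
      using ln_theta(2)[OF IH(1) q] by linarith
    also have "\<dots> \<le> (Q * q - 1) * ln 2"
    proof -
      have "2 * ln 2 \<le> real q * ln 2" using q by (intro mult_right_mono) auto
      then show ?thesis by (simp add: algebra_simps)
    qed
    finally have "\<bar>ln \<bar>z ^ q + 1\<bar> - q * (Q * L)\<bar> \<le> (Q * q - 1) * ln 2" .
    then show ?case using e ln_theta(1)[OF IH(1) q] IH(1) by (simp add: Q_def mult_ac)
  qed
  moreover have "(real (prod_list ws) - 1) * ln 2 \<le> real (prod_list ws) * ln 2" by (intro mult_right_mono) auto
  ultimately have "\<bar>real_of_rat (fold theta ws r)\<bar> \<ge> 4"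
    "\<bar>ln \<bar>real_of_rat (fold theta ws r)\<bar> - real (prod_list ws) * L\<bar> \<le> real (prod_list ws) * ln 2"
    by linarith+
  moreover from this(1) have "real_of_rat 4 \<le> real_of_rat \<bar>fold theta ws r\<bar>" by simp
  then show "\<bar>fold theta ws r\<bar> \<ge> 4" by (simp only: of_rat_less_eq)
  ultimately show "\<bar>ln (real_of_rat \<bar>fold theta ws r\<bar>) - real (prod_list ws) * ln (real_of_rat \<bar>r\<bar>)\<bar> \<le> real (prod_list ws) * ln 2"
    by (simp add: L_def)
qed

text \<open>With p * a = q * c + 1, the root is w = x^a / y^c.\<close>

lemma common_power:
  fixes x y :: "'a::field"
  assumes "x ^ q = y ^ p" "coprime p q" "p > 0" "y \<noteq> 0" "x \<noteq> 0"
  shows "\<exists>w. x = w ^ p"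
proof -
  obtain a c where ac: "p * a = q * c + 1" using bezout_nat[of p q] assms by auto
  have "x ^ (p * a) = x * (y ^ c) ^ p"
    unfolding ac using assms(1) by (simp add: power_add power_mult) (simp flip: power_mult add: mult.commute)
  then have "x = (x ^ a / y ^ c) ^ p" using assms by (simp add: power_divide power_mult field_simps)
  then show ?thesis by blast
qed

text \<open>The point v counted need not lie on the orbit: it may be a p-th root W of an orbit
  point. Its logarithmic height is then c = s/p times that of the preceding point, and only the p-th
  power of its denominator is known as a power of B. This corresponds to Q = c * prod and \<beta> =
  ln B / (p * c).\<close>

lemma sparse_count_words:
  assumes "sparse P"
  obtains C L0 where "C \<ge> 0" "\<And>S X B p L c. \<lbrakk>\<And>v. v \<in> S \<Longrightarrow> \<exists>ws. set ws \<subseteq> letters \<and> P v \<and> \<bar>v\<bar> \<ge> 4 \<and> c * real (prod_list ws) \<le> X \<and>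
        den v ^ p = B ^ prod_list ws \<and> \<bar>ln (real_of_rat \<bar>v\<bar>) - c * real (prod_list ws) * L\<bar> \<le> c * real (prod_list ws) * ln 2;
      B > 0; p > 0; c \<ge> 1; L \<ge> L0; X \<ge> 1\<rbrakk>
      \<Longrightarrow> finite S \<and> real (card S) \<le> C * (1 + ln X)"
proof -
  obtain C L0 where C: "C \<ge> 0" and main: "\<And>S Q X \<beta> L. \<lbrakk>\<And>v. v \<in> S \<Longrightarrow> P v \<and> \<bar>v\<bar> \<ge> 4 \<and> 1 \<le> Q v \<and> Q v \<le> X \<and>
        ln (real_of_int (den v)) = Q v * \<beta> \<and> \<bar>ln (real_of_rat \<bar>v\<bar>) - Q v * L\<bar> \<le> Q v * ln 2;
      \<And>v w. v \<in> S \<Longrightarrow> w \<in> S \<Longrightarrow> Q v \<le> Q w \<Longrightarrow> den v dvd den w; L \<ge> L0; \<beta> \<ge> 0; X \<ge> 1\<rbrakk>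
      \<Longrightarrow> finite S \<and> real (card S) \<le> C * (1 + ln X)"
    using sparse_count[OF assms] by metis
  show thesis
  proof (rule that[of C L0])
    fix S and X c L :: real and B :: int and p :: nat
    assume "\<And>v. v \<in> S \<Longrightarrow> \<exists>ws. set ws \<subseteq> letters \<and> P v \<and> \<bar>v\<bar> \<ge> 4 \<and> c * real (prod_list ws) \<le> X \<and>
        den v ^ p = B ^ prod_list ws \<and> \<bar>ln (real_of_rat \<bar>v\<bar>) - c * real (prod_list ws) * L\<bar> \<le> c * real (prod_list ws) * ln 2"
      and B: "B > 0" and p: "p > 0" and c: "c \<ge> 1" and L: "L \<ge> L0" and X: "X \<ge> 1"
    then obtain ws where ws: "\<And>v. v \<in> S \<Longrightarrow> set (ws v) \<subseteq> letters \<and> P v \<and> \<bar>v\<bar> \<ge> 4 \<and> c * real (prod_list (ws v)) \<le> X \<and>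
        den v ^ p = B ^ prod_list (ws v) \<and> \<bar>ln (real_of_rat \<bar>v\<bar>) - c * real (prod_list (ws v)) * L\<bar> \<le> c * real (prod_list (ws v)) * ln 2"
      by metis
    define Q where "Q = (\<lambda>v. c * real (prod_list (ws v)))"
    define \<beta> where "\<beta> = ln (real_of_int B) / (p * c)"
    show "finite S \<and> real (card S) \<le> C * (1 + ln X)"
    proof (rule main[of S Q X \<beta> L])
      fix v assume v: "v \<in> S"
      have "1 * 1 \<le> c * real (prod_list (ws v))" using prod_list_pos ws[OF v] c by (intro mult_mono) auto
      moreover have "ln (real_of_int (den v)) = Q v * \<beta>"
      proof -
        have "real_of_int (den v) ^ p = real_of_int B ^ prod_list (ws v)" using ws[OF v] by (metis of_int_power)
        then have "ln (real_of_int (den v) ^ p) = ln (real_of_int B ^ prod_list (ws v))" by simp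
        then have "p * ln (real_of_int (den v)) = real (prod_list (ws v)) * ln (real_of_int B)"
          using den_pos[of v] B by (simp add: ln_realpow)
        then show ?thesis using c p by (simp add: Q_def \<beta>_def field_simps)
      qed
      ultimately show "P v \<and> \<bar>v\<bar> \<ge> 4 \<and> 1 \<le> Q v \<and> Q v \<le> X \<and>
        ln (real_of_int (den v)) = Q v * \<beta> \<and> \<bar>ln (real_of_rat \<bar>v\<bar>) - Q v * L\<bar> \<le> Q v * ln 2"
        using ws[OF v] by (simp add: Q_def)
    next
      fix v w assume vw: "v \<in> S" "w \<in> S" "Q v \<le> Q w"
      then have "prod_list (ws v) \<le> prod_list (ws w)" using c by (simp add: Q_def)
      then have "B ^ prod_list (ws v) dvd B ^ prod_list (ws w)" by (rule le_imp_power_dvd)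
      then have "den v ^ p dvd den w ^ p" using ws[OF vw(1)] ws[OF vw(2)] by metis
      then show "den v dvd den w" using p by simp
    next
      show "\<beta> \<ge> 0" using B c p by (auto simp: \<beta>_def)
    qed (use L X in auto)
  qed (rule C)
qed

text \<open>Let x be the point before the last map, so x^s + 1 = W^p. The smaller exponent has to
  play the role of q in C^q - E^q = A^n. For p < s the equation is num W^p - den W^p = num x^s and
  the point counted is W. For s < p it is rewritten for -x, and for s = p it is of Fermat type in x.
  The constants depend on p, s and b, but not on r.\<close>

lemma collision_count:
  assumes p: "p \<in> letters" and s: "s \<in> letters" and b: "b > 0"
  obtains C L0 where "C \<ge> 0" "\<And>r m X. \<lbrakk>den r = b ^ m; m > 0; \<bar>r\<bar> \<ge> 4; ln (real_of_rat \<bar>r\<bar>) \<ge> L0; X \<ge> 1\<rbrakk> \<Longrightarrow>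
    finite {x. \<exists>ws W. set ws \<subseteq> letters \<and> real (prod_list ws * s) \<le> X \<and> x = theta s (fold theta ws r) \<and> x = W ^ p} \<and>
    real (card {x. \<exists>ws W. set ws \<subseteq> letters \<and> real (prod_list ws * s) \<le> X \<and> x = theta s (fold theta ws r) \<and> x = W ^ p}) \<le> C * (1 + ln X)"
proof -
  define Z where "Z = (\<lambda>r X. {x. \<exists>ws W. set ws \<subseteq> letters \<and> real (prod_list ws * s) \<le> X \<and> x = theta s (fold theta ws r) \<and> x = W ^ p})"
  have ps: "p \<ge> 3" "s \<ge> 3" "odd p" "odd s" "prime p" "prime s"
    using p s by (simp_all add: letters_ge letters_odd letters_prime)
  have eq: "num W ^ p = num x ^ s + den x ^ s" "den W ^ p = den x ^ s" if "theta s x = W ^ p" for x W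
    using theta_num_den[of s x] num_den_power[of W p] that ps by simp_all
  have adm: "admissible b v" if "\<bar>v\<bar> \<ge> 4" "den v ^ i = b ^ j" "i > 0" "j > 0" for v i j
  proof -
    have "den v dvd b ^ j" using that by (metis dvd_power)
    moreover have "b dvd den v ^ i" using that by (metis dvd_power)
    ultimately show ?thesis unfolding admissible_def using that by blast
  qed
  have orbit: "den (fold theta ws r) = b ^ (m * prod_list ws)" "m * prod_list ws > 0"
    if "den r = b ^ m" "m > 0" "set ws \<subseteq> letters" for r m ws
    using den_fold_theta[OF that(3), of r] prod_list_pos[OF that(3)] that by (simp_all add: power_mult)
  have image: "finite (Z r X) \<and> real (card (Z r X)) \<le> c" if "Z r X \<subseteq> f ` S" "finite S" "real (card S) \<le> c" for r X f c and S :: "rat set"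
  proof -
    have "card (Z r X) \<le> card (f ` S)" using that by (intro card_mono) auto
    also have "\<dots> \<le> card S" using that by (intro card_image_le) auto
    finally show ?thesis using that finite_subset by fastforce
  qed
  have "\<exists>C L0. C \<ge> 0 \<and> (\<forall>r m X. den r = b ^ m \<longrightarrow> m > 0 \<longrightarrow> \<bar>r\<bar> \<ge> 4 \<longrightarrow> ln (real_of_rat \<bar>r\<bar>) \<ge> L0 \<longrightarrow> X \<ge> 1 \<longrightarrow>
    finite (Z r X) \<and> real (card (Z r X)) \<le> C * (1 + ln X))"
  proof (cases "p < s")
    case True
    define P where "P = (\<lambda>v. admissible b v \<and> (\<exists>A. num v ^ p - den v ^ p = A ^ s))"
    have "sparse P" unfolding P_def using ps letters_gap[OF s p True] by (intro sparse_catalan) auto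
    then obtain C L0 where C: "C \<ge> 0" and main: "\<And>S X B p L c. \<lbrakk>\<And>v. v \<in> S \<Longrightarrow> \<exists>ws. set ws \<subseteq> letters \<and> P v \<and> \<bar>v\<bar> \<ge> 4 \<and> c * real (prod_list ws) \<le> X \<and>
        den v ^ p = B ^ prod_list ws \<and> \<bar>ln (real_of_rat \<bar>v\<bar>) - c * real (prod_list ws) * L\<bar> \<le> c * real (prod_list ws) * ln 2;
      B > 0; p > 0; c \<ge> 1; L \<ge> L0; X \<ge> 1\<rbrakk>
      \<Longrightarrow> finite S \<and> real (card S) \<le> C * (1 + ln X)"
      using sparse_count_words by metis
    \<comment> \<open>The 3 ensures |W| >= 4: since s/p * Q >= 1, one gets ln |W| >= 3 - ln 2 >= 2
      >= ln 4.\<close>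
    have "finite (Z r X) \<and> real (card (Z r X)) \<le> C * (1 + ln X)"
      if r: "den r = b ^ m" "m > 0" "\<bar>r\<bar> \<ge> 4" "ln (real_of_rat \<bar>r\<bar>) \<ge> max L0 3" "X \<ge> 1" for r m X
    proof -
      define S where "S = {W. \<exists>ws. set ws \<subseteq> letters \<and> real (prod_list ws * s) \<le> X \<and> theta s (fold theta ws r) = W ^ p}"
      have "finite S \<and> real (card S) \<le> C * (1 + ln X)"
      proof (rule main[where B = "den r ^ s" and p = p and c = "real s / real p" and L = "ln (real_of_rat \<bar>r\<bar>)"])
        fix W assume "W \<in> S"
        then obtain ws where ws: "set ws \<subseteq> letters" "real (prod_list ws * s) \<le> X" "theta s (fold theta ws r) = W ^ p"
          by (auto simp: S_def)
        define x where "x = fold theta ws r"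
        define Q where "Q = real (prod_list ws)"
        have Q1: "Q \<ge> 1" using prod_list_pos[OF ws(1)] by (simp add: Q_def)
        note e = eq[OF ws(3), folded x_def]
        have dx: "den x = b ^ (m * prod_list ws)" "m * prod_list ws > 0" using orbit[OF r(1,2) ws(1)] by (simp_all add: x_def)
        have W0: "W \<noteq> 0"
        proof
          assume "W = 0"
          then have "fold theta (ws @ [s]) r = 0" using ws(3) ps by simp
          then show False using fold_theta_size(1)[of "ws @ [s]" r] ws(1) s r(3) by simp
        qed
        have "real_of_rat \<bar>fold theta (ws @ [s]) r\<bar> = real_of_rat \<bar>W\<bar> ^ p"
          using ws(3) by (simp add: power_abs of_rat_power flip: abs_of_rat)
        then have "ln (real_of_rat \<bar>fold theta (ws @ [s]) r\<bar>) = p * ln (real_of_rat \<bar>W\<bar>)"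
          using W0 by (simp add: ln_realpow)
        then have "\<bar>p * ln (real_of_rat \<bar>W\<bar>) - Q * s * ln (real_of_rat \<bar>r\<bar>)\<bar> \<le> Q * s * ln 2"
          using fold_theta_size(2)[of "ws @ [s]" r] ws(1) s r(3) by (simp add: Q_def)
        then have "\<bar>p * ln (real_of_rat \<bar>W\<bar>) - Q * s * ln (real_of_rat \<bar>r\<bar>)\<bar> / p \<le> Q * s * ln 2 / p"
          by (intro divide_right_mono) auto
        moreover have "\<bar>p * ln (real_of_rat \<bar>W\<bar>) - Q * s * ln (real_of_rat \<bar>r\<bar>)\<bar> / p = \<bar>ln (real_of_rat \<bar>W\<bar>) - real s / real p * Q * ln (real_of_rat \<bar>r\<bar>)\<bar>"
        proof -
          have "\<bar>p * ln (real_of_rat \<bar>W\<bar>) - Q * s * ln (real_of_rat \<bar>r\<bar>)\<bar> / p = \<bar>(p * ln (real_of_rat \<bar>W\<bar>) - Q * s * ln (real_of_rat \<bar>r\<bar>)) / p\<bar>"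
            by (simp add: abs_divide)
          also have "(p * ln (real_of_rat \<bar>W\<bar>) - Q * s * ln (real_of_rat \<bar>r\<bar>)) / p = ln (real_of_rat \<bar>W\<bar>) - real s / real p * Q * ln (real_of_rat \<bar>r\<bar>)"
            using ps by (simp add: field_simps)
          finally show ?thesis .
        qed
        ultimately have size: "\<bar>ln (real_of_rat \<bar>W\<bar>) - real s / real p * Q * ln (real_of_rat \<bar>r\<bar>)\<bar> \<le> real s / real p * Q * ln 2"
          by (simp add: mult_ac)
        have l2: "ln 2 \<le> (1::real)" using ln_le_minus_one[of "2::real"] by simp
        have c1: "1 * 1 \<le> real s / real p * Q" using True ps Q1 by (intro mult_mono) auto
        have "1 * (ln (real_of_rat \<bar>r\<bar>) - ln 2) \<le> (real s / real p * Q) * (ln (real_of_rat \<bar>r\<bar>) - ln 2)"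
          using c1 r(4) l2 by (intro mult_right_mono) auto
        then have "2 \<le> ln (real_of_rat \<bar>W\<bar>)" using size r(4) l2 by (simp add: algebra_simps abs_le_iff)
        moreover have "ln 4 \<le> (2::real)" using ln_realpow[of 2 2] l2 by simp
        ultimately have "ln 4 \<le> ln (real_of_rat \<bar>W\<bar>)" by simp
        then have "real_of_rat 4 \<le> real_of_rat \<bar>W\<bar>" using W0 by (subst (asm) ln_le_cancel_iff) auto
        then have W4: "\<bar>W\<bar> \<ge> 4" by (simp only: of_rat_less_eq)
        have "den W ^ p = b ^ (m * prod_list ws * s)" unfolding e(2) dx(1) by (simp add: power_mult)
        then have "admissible b W" using W4 ps dx(2) by (intro adm[of W p "m * prod_list ws * s"]) auto
        moreover have "num W ^ p - den W ^ p = num x ^ s" using e by simp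
        ultimately have "P W" unfolding P_def by blast
        moreover have "den W ^ p = (den r ^ s) ^ prod_list ws"
          unfolding e(2) x_def den_fold_theta[OF ws(1)] by (simp add: mult.commute flip: power_mult)
        moreover have "real s / real p * real (prod_list ws) \<le> X"
        proof -
          have "real (prod_list ws * s) / real p \<le> real (prod_list ws * s) / 1" using ps by (intro divide_left_mono) auto
          then show ?thesis using ws(2) by (simp add: mult.commute)
        qed
        ultimately show "\<exists>ws. set ws \<subseteq> letters \<and> P W \<and> \<bar>W\<bar> \<ge> 4 \<and> real s / real p * real (prod_list ws) \<le> X \<and>
            den W ^ p = (den r ^ s) ^ prod_list ws \<and> \<bar>ln (real_of_rat \<bar>W\<bar>) - real s / real p * real (prod_list ws) * ln (real_of_rat \<bar>r\<bar>)\<bar> \<le> real s / real p * real (prod_list ws) * ln 2"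
          using ws(1) W4 size unfolding Q_def by blast
      next
        show "den r ^ s > 0" using den_pos[of r] by simp
        show "p > 0" "1 \<le> real s / real p" using ps True by auto
        show "L0 \<le> ln (real_of_rat \<bar>r\<bar>)" "1 \<le> X" using r by auto
      qed
      moreover have "Z r X \<subseteq> (\<lambda>W. W ^ p) ` S" by (auto simp: Z_def S_def)
      ultimately show ?thesis using image by blast
    qed
    then show ?thesis using C by blast
  next
    case False
    define P where "P = (if s = p then (\<lambda>v. admissible b v \<and> (\<exists>A. num v ^ p + den v ^ p = A ^ p))
        else (\<lambda>v. admissible b v \<and> (\<exists>A. num v ^ s - den v ^ s = A ^ p)))"
    \<comment> \<open>Negation turns the sum into a difference: for odd s and p, num x^s + den x^s =
      num W^p becomes num (-x)^s - den x^s = (- num W)^p. Being an involution, g also recovers x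
      from the point counted.\<close>
    define g :: "rat \<Rightarrow> rat" where "g = (if s = p then id else uminus)"
    have "sparse P"
    proof (cases "s = p")
      case True then show ?thesis unfolding P_def using ps b sparse_fermat by simp
    next
      case F: False
      then have "s < p" using False by simp
      then show ?thesis using F unfolding P_def using ps letters_gap[OF p s] sparse_catalan[of s p b] by simp
    qed
    then obtain C L0 where C: "C \<ge> 0" and main: "\<And>S X B p L c. \<lbrakk>\<And>v. v \<in> S \<Longrightarrow> \<exists>ws. set ws \<subseteq> letters \<and> P v \<and> \<bar>v\<bar> \<ge> 4 \<and> c * real (prod_list ws) \<le> X \<and>
        den v ^ p = B ^ prod_list ws \<and> \<bar>ln (real_of_rat \<bar>v\<bar>) - c * real (prod_list ws) * L\<bar> \<le> c * real (prod_list ws) * ln 2;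
      B > 0; p > 0; c \<ge> 1; L \<ge> L0; X \<ge> 1\<rbrakk>
      \<Longrightarrow> finite S \<and> real (card S) \<le> C * (1 + ln X)"
      using sparse_count_words by metis
    have "finite (Z r X) \<and> real (card (Z r X)) \<le> C * (1 + ln X)"
      if r: "den r = b ^ m" "m > 0" "\<bar>r\<bar> \<ge> 4" "ln (real_of_rat \<bar>r\<bar>) \<ge> L0" "X \<ge> 1" for r m X
    proof -
      define S where "S = {v. \<exists>ws W. set ws \<subseteq> letters \<and> real (prod_list ws * s) \<le> X \<and> v = g (fold theta ws r) \<and> theta s (fold theta ws r) = W ^ p}"
      have "finite S \<and> real (card S) \<le> C * (1 + ln X)"
      proof (rule main[where B = "den r" and p = 1 and c = 1 and L = "ln (real_of_rat \<bar>r\<bar>)"])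
        fix v assume "v \<in> S"
        then obtain ws W where ws: "set ws \<subseteq> letters" "real (prod_list ws * s) \<le> X" "v = g (fold theta ws r)" "theta s (fold theta ws r) = W ^ p"
          by (auto simp: S_def)
        define x where "x = fold theta ws r"
        note e = eq[OF ws(4), folded x_def]
        have vx: "\<bar>v\<bar> = \<bar>x\<bar>" "den v = den x" unfolding ws(3) x_def g_def by (simp_all add: num_den_uminus)
        have v4: "\<bar>v\<bar> \<ge> 4" unfolding vx x_def using fold_theta_size(1)[OF ws(1) r(3)] .
        have dx: "den x = b ^ (m * prod_list ws)" "m * prod_list ws > 0" using orbit[OF r(1,2) ws(1)] by (simp_all add: x_def)
        have "admissible b v" using v4 dx vx by (intro adm[of v 1 "m * prod_list ws"]) auto
        moreover have "num v ^ s - den v ^ s = (- num W) ^ p" if "s \<noteq> p"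
          using that e ps unfolding ws(3) g_def x_def by (simp add: num_den_uminus)
        moreover have "num v ^ p + den v ^ p = num W ^ p" if "s = p"
          using that e unfolding ws(3) g_def x_def by simp
        ultimately have "P v" unfolding P_def by auto
        moreover have "den v ^ 1 = den r ^ prod_list ws" unfolding vx x_def by (simp add: den_fold_theta[OF ws(1)])
        moreover have "1 * real (prod_list ws) \<le> X"
        proof -
          have "real (prod_list ws * 1) \<le> real (prod_list ws * s)" using ps by (intro of_nat_mono mult_le_mono2) auto
          then show ?thesis using ws(2) by simp
        qed
        moreover have "\<bar>ln (real_of_rat \<bar>v\<bar>) - 1 * real (prod_list ws) * ln (real_of_rat \<bar>r\<bar>)\<bar> \<le> 1 * real (prod_list ws) * ln 2"
          unfolding vx x_def using fold_theta_size(2)[OF ws(1) r(3)] by simp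
        ultimately show "\<exists>ws. set ws \<subseteq> letters \<and> P v \<and> \<bar>v\<bar> \<ge> 4 \<and> 1 * real (prod_list ws) \<le> X \<and>
            den v ^ 1 = den r ^ prod_list ws \<and> \<bar>ln (real_of_rat \<bar>v\<bar>) - 1 * real (prod_list ws) * ln (real_of_rat \<bar>r\<bar>)\<bar> \<le> 1 * real (prod_list ws) * ln 2"
          using ws(1) v4 by blast
      qed (use r den_pos[of r] in auto)
      moreover have "Z r X \<subseteq> (\<lambda>v. theta s (g v)) ` S"
      proof
        fix x assume "x \<in> Z r X"
        then obtain ws W where ws: "set ws \<subseteq> letters" "real (prod_list ws * s) \<le> X" "x = theta s (fold theta ws r)" "x = W ^ p"
          unfolding Z_def by blast
        then have "theta s (fold theta ws r) = W ^ p" by simp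
        then have "g (fold theta ws r) \<in> S" unfolding S_def using ws(1,2) by blast
        moreover have "x = theta s (g (g (fold theta ws r)))" using ws(3) by (simp add: g_def)
        ultimately show "x \<in> (\<lambda>v. theta s (g v)) ` S" by blast
      qed
      ultimately show ?thesis using image by blast
    qed
    then show ?thesis using C by blast
  qed
  then obtain C L0 where CL: "C \<ge> 0" "\<And>r m X. \<lbrakk>den r = b ^ m; m > 0; \<bar>r\<bar> \<ge> 4; ln (real_of_rat \<bar>r\<bar>) \<ge> L0; X \<ge> 1\<rbrakk> \<Longrightarrow>
    finite (Z r X) \<and> real (card (Z r X)) \<le> C * (1 + ln X)" by blast
  show thesis by (rule that[OF CL[unfolded Z_def]])
qed

section \<open>Growth of the set of values\<close>

definition words :: "nat set \<Rightarrow> real \<Rightarrow> nat list set" where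
  "words A X = {ws. set ws \<subseteq> A \<and> real (prod_list ws) \<le> X}"

lemma finite_words:
  assumes "\<And>q. q \<in> A \<Longrightarrow> q \<ge> 2"
  shows "finite (words A X)"
proof -
  define N where "N = nat \<lfloor>X\<rfloor>"
  have bd: "length ws \<le> prod_list ws \<and> set ws \<subseteq> {..prod_list ws} \<and> prod_list ws \<ge> 1" if "set ws \<subseteq> A" for ws
    using that
  proof (induction ws)
    case (Cons q ws)
    have q: "q \<ge> 2" and IH: "length ws \<le> prod_list ws" "set ws \<subseteq> {..prod_list ws}" "prod_list ws \<ge> 1"
      using Cons assms by auto
    have "2 * prod_list ws \<le> q * prod_list ws" "q * 1 \<le> q * prod_list ws" using q IH by (intro mult_le_mono; simp)+
    then have "Suc (length ws) \<le> q * prod_list ws" "prod_list ws \<le> q * prod_list ws" "q \<le> q * prod_list ws" "q * prod_list ws \<ge> 1" 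
      using IH q by linarith+
    then show ?case using order_trans[OF _ \<open>prod_list ws \<le> q * prod_list ws\<close>] IH(2) by auto
  qed simp
  have "words A X \<subseteq> {ws. set ws \<subseteq> {..N} \<and> length ws \<le> N}"
  proof
    fix ws assume "ws \<in> words A X"
    then have ws: "set ws \<subseteq> A" "real (prod_list ws) \<le> X" by (auto simp: words_def)
    then have "prod_list ws \<le> N" unfolding N_def by (simp add: le_nat_floor)
    then show "ws \<in> {ws. set ws \<subseteq> {..N} \<and> length ws \<le> N}" using bd[OF ws(1)] by fastforce
  qed
  then show ?thesis using finite_lists_length_le[of "{..N}" N] finite_subset by auto
qed

definition reach :: "rat \<Rightarrow> real \<Rightarrow> rat set" where
  "reach r X = (\<lambda>ws. fold theta ws r) ` words letters X"

text \<open>If x^q = y^p for distinct letters, then x is a p-th power. Outside this set, images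
  under different letters cannot coincide.\<close>

definition reach_powers :: "rat \<Rightarrow> real \<Rightarrow> rat set" where
  "reach_powers r X = {x \<in> reach r X. \<exists>p\<in>letters. \<exists>W. x = W ^ p}"

lemma finite_reach: "finite (reach r X)" "finite (reach_powers r X)"
proof -
  have "finite (words letters X)" by (rule finite_words) (use letters_ge in force)
  then show "finite (reach r X)" by (simp add: reach_def)
  then show "finite (reach_powers r X)" by (simp add: reach_powers_def)
qed

lemma reach_abs_ge: "x \<in> reach r X \<Longrightarrow> \<bar>r\<bar> \<ge> 4 \<Longrightarrow> \<bar>x\<bar> \<ge> 4"
  using fold_theta_size(1) by (auto simp: reach_def words_def)

lemma theta_inject: "odd q \<Longrightarrow> theta q x = theta q y \<Longrightarrow> x = y"
  unfolding theta_def using odd_power_inject[of q x y] by simp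

lemma theta_mem_reach:
  assumes "q \<in> letters" "x \<in> reach r (X / q)"
  shows "theta q x \<in> reach r X"
proof -
  obtain ws where ws: "set ws \<subseteq> letters" "real (prod_list ws) \<le> X / q" "x = fold theta ws r"
    using assms(2) by (auto simp: reach_def words_def)
  have "ws @ [q] \<in> words letters X"
    using ws assms(1) letters_ge[OF assms(1)] by (simp add: words_def field_simps)
  moreover have "theta q x = fold theta (ws @ [q]) r" using ws by simp
  ultimately show ?thesis unfolding reach_def by blast
qed

text \<open>Values are sorted by the outermost map. Each \<open>theta q\<close> is injective because
  q is odd, and once the perfect powers are removed the images for different q are disjoint, so
  their cardinalities add up.\<close>

lemma reach_recurrence:
  assumes "\<bar>r\<bar> \<ge> 4"
  shows "(\<Sum>q\<in>letters. real (card (reach r (X / q))) - real (card (reach_powers r (X / q)))) \<le> real (card (reach r X))"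
proof -
  define G where "G = (\<lambda>q. theta q ` (reach r (X / real q) - reach_powers r (X / real q)))"
  have sub: "reach_powers r Y \<subseteq> reach r Y" for Y by (auto simp: reach_powers_def)
  have card_G: "real (card (G q)) = real (card (reach r (X / q))) - real (card (reach_powers r (X / q)))" if "q \<in> letters" for q
  proof -
    have "inj_on (theta q) (reach r (X / real q) - reach_powers r (X / real q))"
      using theta_inject[OF letters_odd[OF that]] by (auto intro: inj_onI)
    then have "card (G q) = card (reach r (X / real q) - reach_powers r (X / real q))" unfolding G_def by (rule card_image)
    also have "\<dots> = card (reach r (X / real q)) - card (reach_powers r (X / real q))"
      using sub finite_reach by (intro card_Diff_subset)
    finally show ?thesis using card_mono[OF finite_reach(1) sub, of "X / real q"] by (simp add: of_nat_diff)
  qed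
  have disj: "G q \<inter> G p = {}" if qp: "q \<in> letters" "p \<in> letters" "q \<noteq> p" for q p
  proof (rule ccontr)
    assume "G q \<inter> G p \<noteq> {}"
    then obtain x y where xy: "x \<in> reach r (X / real q)" "x \<notin> reach_powers r (X / real q)" "y \<in> reach r (X / real p)" "theta q x = theta p y"
      unfolding G_def by auto
    have "x \<noteq> 0" "y \<noteq> 0" using reach_abs_ge[OF xy(1) assms] reach_abs_ge[OF xy(3) assms] by auto
    moreover have "x ^ q = y ^ p" using xy(4) by (simp add: theta_def)
    ultimately have "\<exists>W. x = W ^ p"
      using letters_coprime[OF qp(1,2)] qp letters_ge[OF qp(2)] by (intro common_power[where q = q and y = y]) auto
    then show False using xy(1,2) qp by (auto simp: reach_powers_def)
  qed
  have "(\<Sum>q\<in>letters. real (card (reach r (X / q))) - real (card (reach_powers r (X / q)))) = (\<Sum>q\<in>letters. real (card (G q)))"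
    using card_G by simp
  also have "\<dots> = real (card (\<Union>q\<in>letters. G q))"
    using disj finite_letters finite_reach by (subst card_UN_disjoint) (auto simp: G_def)
  also have "\<dots> \<le> real (card (reach r X))"
    using theta_mem_reach finite_reach by (intro of_nat_mono card_mono) (auto simp: G_def)
  finally show ?thesis .
qed

text \<open>A perfect power on the orbit is either the starting point, which accounts for the
  summand 1, or ends in some \<open>theta s\<close> and is counted for one of the 49 pairs (p,
  s).\<close>

lemma reach_powers_count:
  assumes b: "b > 0"
  obtains C L0 where "C \<ge> 0" "\<And>r m X. \<lbrakk>den r = b ^ m; m > 0; \<bar>r\<bar> \<ge> 4; ln (real_of_rat \<bar>r\<bar>) \<ge> L0; X \<ge> 1\<rbrakk> \<Longrightarrow>
    real (card (reach_powers r X)) \<le> C * (1 + ln X)"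
proof -
  define Z where "Z = (\<lambda>p s r X. {x. \<exists>ws W. set ws \<subseteq> letters \<and> real (prod_list ws * s) \<le> X \<and> x = theta s (fold theta ws r) \<and> x = W ^ p})"
  have "\<exists>C L0. C \<ge> 0 \<and> (\<forall>r m X. den r = b ^ m \<longrightarrow> m > 0 \<longrightarrow> \<bar>r\<bar> \<ge> 4 \<longrightarrow> ln (real_of_rat \<bar>r\<bar>) \<ge> L0 \<longrightarrow> X \<ge> 1 \<longrightarrow>
    finite (Z p s r X) \<and> real (card (Z p s r X)) \<le> C * (1 + ln X))" if "p \<in> letters" "s \<in> letters" for p s
    by (rule collision_count[OF that b]) (unfold Z_def, blast)
  then obtain C L0 where CL: "\<And>p s. p \<in> letters \<Longrightarrow> s \<in> letters \<Longrightarrow> C p s \<ge> 0"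
    "\<And>p s r m X. \<lbrakk>p \<in> letters; s \<in> letters; den r = b ^ m; m > 0; \<bar>r\<bar> \<ge> 4; ln (real_of_rat \<bar>r\<bar>) \<ge> L0 p s; X \<ge> 1\<rbrakk> \<Longrightarrow>
    finite (Z p s r X) \<and> real (card (Z p s r X)) \<le> C p s * (1 + ln X)" by metis
  define L where "L = Max ((\<lambda>(p, s). L0 p s) ` (letters \<times> letters))"
  have L: "L0 p s \<le> L" if "p \<in> letters" "s \<in> letters" for p s
    unfolding L_def using that finite_letters by (intro Max_ge) auto
  show thesis
  proof (rule that[of "1 + (\<Sum>p\<in>letters. \<Sum>s\<in>letters. C p s)" L])
    have s0: "(\<Sum>p\<in>letters. \<Sum>s\<in>letters. C p s) \<ge> 0" using CL(1) by (intro sum_nonneg) auto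
    then show "0 \<le> 1 + (\<Sum>p\<in>letters. \<Sum>s\<in>letters. C p s)" by simp
    fix r m and X :: real
    assume r: "den r = b ^ m" "m > 0" "\<bar>r\<bar> \<ge> 4" "ln (real_of_rat \<bar>r\<bar>) \<ge> L" "X \<ge> 1"
    have Z: "finite (Z p s r X)" "real (card (Z p s r X)) \<le> C p s * (1 + ln X)" if "p \<in> letters" "s \<in> letters" for p s
      using CL(2)[OF that r(1-3) _ r(5)] L[OF that] r(4) by auto
    have "reach_powers r X \<subseteq> insert r (\<Union>p\<in>letters. \<Union>s\<in>letters. Z p s r X)"
    proof
      fix x assume "x \<in> reach_powers r X"
      then obtain p W ws where p: "p \<in> letters" "x = W ^ p" "set ws \<subseteq> letters" "real (prod_list ws) \<le> X" "x = fold theta ws r"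
        unfolding reach_powers_def reach_def words_def by blast
      show "x \<in> insert r (\<Union>p\<in>letters. \<Union>s\<in>letters. Z p s r X)"
      proof (cases ws rule: rev_cases)
        case Nil then show ?thesis using p by simp
      next
        case (snoc us s)
        then have "x = theta s (fold theta us r)" "real (prod_list us * s) \<le> X" "set us \<subseteq> letters" "s \<in> letters" using p by auto
        then show ?thesis using p(1,2) unfolding Z_def by blast
      qed
    qed
    then have "card (reach_powers r X) \<le> card (insert r (\<Union>p\<in>letters. \<Union>s\<in>letters. Z p s r X))"
      using Z finite_letters by (intro card_mono) auto
    also have "\<dots> \<le> Suc (card (\<Union>p\<in>letters. \<Union>s\<in>letters. Z p s r X))" using Z finite_letters by (simp add: card_insert_if)
    also have "card (\<Union>p\<in>letters. \<Union>s\<in>letters. Z p s r X) \<le> (\<Sum>p\<in>letters. card (\<Union>s\<in>letters. Z p s r X))"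
      using finite_letters by (rule card_UN_le)
    also have "\<dots> \<le> (\<Sum>p\<in>letters. \<Sum>s\<in>letters. card (Z p s r X))"
      by (intro sum_mono card_UN_le finite_letters)
    finally have "real (card (reach_powers r X)) \<le> 1 + (\<Sum>p\<in>letters. \<Sum>s\<in>letters. real (card (Z p s r X)))"
      by (simp flip: of_nat_sum)
    also have "(\<Sum>p\<in>letters. \<Sum>s\<in>letters. real (card (Z p s r X))) \<le> (\<Sum>p\<in>letters. \<Sum>s\<in>letters. C p s * (1 + ln X))"
      by (intro sum_mono Z)
    also have "\<dots> = (\<Sum>p\<in>letters. \<Sum>s\<in>letters. C p s) * (1 + ln X)" by (simp add: sum_distrib_right)
    also have "1 + \<dots> \<le> (1 + (\<Sum>p\<in>letters. \<Sum>s\<in>letters. C p s)) * (1 + ln X)"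
      using r(5) by (simp add: algebra_simps)
    finally show "real (card (reach_powers r X)) \<le> (1 + (\<Sum>p\<in>letters. \<Sum>s\<in>letters. C p s)) * (1 + ln X)" by simp
  qed
qed

lemma fold_replicate_inject:
  assumes "odd q" "fold theta (replicate i q) x = fold theta (replicate i q) y" shows "x = y"
  using assms(2)
proof (induction i arbitrary: x y)
  case (Suc i)
  then have "theta q x = theta q y" by simp
  then show ?case by (rule theta_inject[OF assms(1)])
qed simp

lemma three_seven_eq:
  fixes i j k :: nat
  assumes "7 ^ j = (3 ^ i * 7 ^ k :: nat)"
  shows "i = 0 \<and> j = k"
proof -
  have i: "i = 0"
  proof (rule ccontr)
    assume "i \<noteq> 0"
    then have "3 dvd (3 ^ i * 7 ^ k :: nat)" by (simp add: dvd_mult2)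
    then have "3 dvd (7 ^ j :: nat)" using assms by simp
    then have "3 dvd (7 :: nat)" using prime_dvd_power[of "3::nat" 7 j] by simp
    then show False by simp
  qed
  then show ?thesis using assms power_inject_exp[of "7::nat" j k] by simp
qed

text \<open>Points reached by j steps with 7 followed by i steps with 3 are pairwise distinct for j
  < J. Common outer steps with 3 are stripped by injectivity. What remains are two points whose
  weights 7^j and 3^i * 7^k differ unless the words agree, and a large ln |r| separates their sizes.
  About ln X / ln 3 values of i are available for each j.\<close>

lemma reach_base:
  fixes J :: nat and r :: rat and X :: real
  assumes r: "\<bar>r\<bar> \<ge> 4" and L: "ln (real_of_rat \<bar>r\<bar>) \<ge> 2 * 7 ^ J + 2" and X: "X \<ge> 7 ^ J"
  shows "real J * ((ln X - J * ln 7) / ln 3) \<le> real (card (reach r X))"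
proof -
  define L where "L = ln (real_of_rat \<bar>r\<bar>)"
  define y where "y = (\<lambda>i j. fold theta (replicate j 7 @ replicate i 3) r)"
  have l37: "3 \<in> letters" "7 \<in> letters" by (simp_all add: letters_def)
  have size: "\<bar>ln (real_of_rat \<bar>y i j\<bar>) - real (3 ^ i * 7 ^ j) * L\<bar> \<le> real (3 ^ i * 7 ^ j) * ln 2" for i j
    using fold_theta_size(2)[of "replicate j 7 @ replicate i 3" r] l37 r
    by (simp add: y_def L_def set_replicate_conv_if mult.commute split: if_splits)
  \<comment> \<open>Only the weight a = 7^j is bounded by 7^J; the other weight b may be arbitrarily
    large. This suffices because a + b <= |a - b| * (2 * a + 1) as soon as |a - b| >= 1.\<close>
  have key: "i = 0 \<and> j = k" if e: "y 0 j = y i k" and j: "j < J" for i j k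
  proof (rule ccontr)
    assume "\<not> (i = 0 \<and> j = k)"
    then have ne: "7 ^ j \<noteq> (3 ^ i * 7 ^ k :: nat)" using three_seven_eq by blast
    define a b where "a = real (7 ^ j)" and "b = real (3 ^ i * 7 ^ k)"
    have d1: "\<bar>a - b\<bar> \<ge> 1" using ne unfolding a_def b_def by linarith
    have aJ: "a \<le> 7 ^ J" unfolding a_def using j by (simp add: power_increasing)
    have "\<bar>ln (real_of_rat \<bar>y 0 j\<bar>) - a * L\<bar> \<le> a * ln 2" "\<bar>ln (real_of_rat \<bar>y 0 j\<bar>) - b * L\<bar> \<le> b * ln 2"
      using size[of 0 j] size[of i k] unfolding e a_def b_def by simp_all
    then have "\<bar>a * L - b * L\<bar> \<le> a * ln 2 + b * ln 2" by linarith
    moreover have "\<bar>a * L - b * L\<bar> = \<bar>a - b\<bar> * L"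
      using L unfolding left_diff_distrib[symmetric] abs_mult L_def by (simp add: order_trans[OF _ L])
    ultimately have "\<bar>a - b\<bar> * L \<le> (a + b) * ln 2" by (simp add: distrib_right)
    also have "\<dots> \<le> (a + b) * 1"
      using ln_le_minus_one[of "2::real"] by (intro mult_left_mono) (auto simp: a_def b_def)
    also have "\<dots> \<le> \<bar>a - b\<bar> * (2 * a + 1)"
    proof -
      have "a + b \<le> 2 * a + \<bar>a - b\<bar>" by linarith
      moreover have "2 * a * 1 \<le> 2 * a * \<bar>a - b\<bar>" using d1 by (intro mult_left_mono) (auto simp: a_def)
      ultimately have "a + b \<le> 2 * a * \<bar>a - b\<bar> + \<bar>a - b\<bar>" by linarith
      then show ?thesis by (simp add: algebra_simps)
    qed
    finally have "\<bar>a - b\<bar> * L \<le> \<bar>a - b\<bar> * (2 * a + 1)" .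
    moreover have "\<bar>a - b\<bar> > 0" using d1 by linarith
    ultimately have "L \<le> 2 * a + 1" by (simp only: mult_le_cancel_left_pos)
    then show False using L aJ unfolding L_def by linarith
  qed
  have append: "y (i + m) j = fold theta (replicate i 3) (y m j)" for i m j
    by (simp add: y_def funpow_add)
  have inj: "i = m \<and> j = k" if e: "y i j = y m k" and "i \<le> m" "j < J" for i j m k
  proof -
    obtain d where d: "m = i + d" using \<open>i \<le> m\<close> le_Suc_ex by blast
    have "fold theta (replicate i 3) (y 0 j) = fold theta (replicate i 3) (y d k)"
      using e append[of i 0 j] append[of i d k] d by simp
    then have "y 0 j = y d k" by (rule fold_replicate_inject[of 3, rotated]) simp
    then show ?thesis using key \<open>j < J\<close> d by auto
  qed
  define n where "n = Suc (nat \<lfloor>(ln X - J * ln 7) / ln 3\<rfloor>)"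
  define T where "T = {..<n} \<times> {..<J}"
  have "inj_on (\<lambda>(i, j). y i j) T"
  proof (rule inj_onI, clarify)
    fix i j m k assume "(i, j) \<in> T" "(m, k) \<in> T" "y i j = y m k"
    then show "i = m \<and> j = k" using inj[of i j m k] inj[of m k i j] by (cases "i \<le> m") (auto simp: T_def)
  qed
  moreover have "(\<lambda>(i, j). y i j) ` T \<subseteq> reach r X"
  proof clarify
    fix i j assume "(i, j) \<in> T"
    then have ij: "i < n" "j < J" by (auto simp: T_def)
    have X0: "X > 0" using X by (rule less_le_trans[rotated]) simp
    have nn: "(ln X - J * ln 7) / ln 3 \<ge> 0"
    proof -
      have "ln (7 ^ J) \<le> ln X" using X X0 by (subst ln_le_cancel_iff) auto
      then show ?thesis by (simp add: ln_realpow)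
    qed
    have "real i \<le> real (nat \<lfloor>(ln X - J * ln 7) / ln 3\<rfloor>)" using ij by (simp add: n_def)
    also have "\<dots> \<le> (ln X - J * ln 7) / ln 3" using nn by (rule of_nat_floor)
    finally have "real i * ln 3 + J * ln 7 \<le> ln X" by (simp add: field_simps)
    moreover have "real j * ln 7 \<le> J * ln 7" using ij by (intro mult_right_mono) auto
    ultimately have "real i * ln 3 + real j * ln 7 \<le> ln X" by linarith
    then have "ln (3 ^ i * 7 ^ j) \<le> ln X" by (simp add: ln_mult ln_realpow)
    then have "3 ^ i * 7 ^ j \<le> X" using X0 by (subst (asm) ln_le_cancel_iff) auto
    then have "replicate j 7 @ replicate i 3 \<in> words letters X"
      using l37 by (auto simp: words_def mult.commute set_replicate_conv_if)
    then show "y i j \<in> reach r X" unfolding y_def reach_def by blast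
  qed
  ultimately have "card T \<le> card (reach r X)" using finite_reach(1) by (rule card_inj_on_le)
  then have "n * J \<le> card (reach r X)" by (simp add: T_def card_cartesian_product)
  then have "real (n * J) \<le> real (card (reach r X))" by (simp only: of_nat_le_iff)
  moreover have "(ln X - J * ln 7) / ln 3 \<le> real n" unfolding n_def by linarith
  then have "real J * ((ln X - J * ln 7) / ln 3) \<le> real J * real n" by (intro mult_left_mono) auto
  ultimately show ?thesis by (simp add: mult.commute)
qed

text \<open>The recurrence loses a multiple of \<open>ln X\<close> that depends on \<open>b\<close> only, whereas the values found in
  \<open>reach_base\<close> number \<open>J * ln X\<close> with \<open>J\<close> at our disposal: this is what starts the induction.\<close>

lemma reach_growth:
  assumes b: "b > 0" and \<rho>: "(\<Sum>q\<in>letters. real q powr - \<rho>) \<ge> 1" "\<rho> \<ge> 0"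
  obtains L where "\<And>r m. \<lbrakk>den r = b ^ m; m > 0; \<bar>r\<bar> \<ge> 4; ln (real_of_rat \<bar>r\<bar>) \<ge> L\<rbrakk> \<Longrightarrow>
    \<exists>c>0. \<exists>X1\<ge>1. \<forall>X\<ge>X1. c * X powr \<rho> \<le> real (card (reach r X))"
proof -
  obtain C L0 where C: "C \<ge> 0" and CL: "\<And>r m X. \<lbrakk>den r = b ^ m; m > 0; \<bar>r\<bar> \<ge> 4; ln (real_of_rat \<bar>r\<bar>) \<ge> L0; X \<ge> 1\<rbrakk> \<Longrightarrow>
    real (card (reach_powers r X)) \<le> C * (1 + ln X)" using reach_powers_count[OF b] by blast
  define F where "F = 7 * C"
  define S where "S = (\<Sum>q\<in>letters. ln (real q))"
  have card7: "card letters = 7" by (simp add: letters_def)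
  have S0: "S \<ge> 0" unfolding S_def by (intro sum_nonneg) (use letters_ge in force)
  \<comment> \<open>Chosen so that 6 * G = F * S + F: the six copies of G gained in one induction
    step repay the F * S coming from the terms ln q and the constant part F of the loss.\<close>
  define G where "G = (F * S + F) / 6"
  have F0: "F \<ge> 0" using C by (simp add: F_def)
  have G0: "G \<ge> 0" using F0 S0 by (simp add: G_def)
  \<comment> \<open>As ln 3 <= 2, this J gives J / ln 3 >= F + 1, so the initial values exceed F *
    ln X by at least ln X - K.\<close>
  define J where "J = nat \<lceil>2 * (F + 1)\<rceil>"
  have J: "real J \<ge> 2 * (F + 1)" using F0 unfolding J_def by linarith
  define K where "K = real J * (J * ln 7) / ln 3"
  have K0: "K \<ge> 0" unfolding K_def by simp
  define M :: real where "M = 524287"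
  have M: "M \<ge> 3" "\<And>q. q \<in> letters \<Longrightarrow> real q \<le> M" using letters_le by (force simp: M_def)+
  define X1 where "X1 = max M (max (7 ^ J) (exp (K + G + 1)))"
  have X1: "X1 \<ge> M" "X1 \<ge> 7 ^ J" "X1 \<ge> exp (K + G + 1)" by (simp_all add: X1_def)
  \<comment> \<open>Normalised so that c * X^\<rho> <= 1 throughout the initial range up to M *
    X1.\<close>
  define c where "c = (M * X1) powr - \<rho>"
  have MX: "M * X1 > 0" using M X1 by simp
  have c: "c > 0" using M X1 by (simp add: c_def)
  show thesis
  proof (rule that[of "max L0 (2 * 7 ^ J + 2)"])
    fix r m
    assume r: "den r = b ^ m" "m > 0" "\<bar>r\<bar> \<ge> 4" "ln (real_of_rat \<bar>r\<bar>) \<ge> max L0 (2 * 7 ^ J + 2)"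
    define D where "D = (\<lambda>X. real (card (reach r X)))"
    have rec: "(\<Sum>q\<in>letters. D (X / q)) - F * (1 + ln X) \<le> D X" if X: "X \<ge> M" for X
    proof -
      have "real (card (reach_powers r (X / q))) \<le> C * (1 + ln X)" if q: "q \<in> letters" for q
      proof -
        have "X / q \<ge> 1" "X / q \<le> X" "X / q > 0" using M(2)[OF q] X M letters_ge[OF q] by (simp_all add: field_simps)
        moreover have "real (card (reach_powers r (X / q))) \<le> C * (1 + ln (X / q))" using CL[OF r(1-3)] r(4) \<open>X / q \<ge> 1\<close> by simp
        moreover have "C * (1 + ln (X / q)) \<le> C * (1 + ln X)"
          using C calculation(2,3) by (intro mult_left_mono add_left_mono) auto
        ultimately show ?thesis by linarith
      qed
      then have "(\<Sum>q\<in>letters. real (card (reach_powers r (X / q)))) \<le> (\<Sum>q\<in>letters. C * (1 + ln X))" by (rule sum_mono)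
      also have "\<dots> = F * (1 + ln X)" by (simp add: card7 F_def)
      finally show ?thesis using reach_recurrence[OF r(3), of X] by (simp add: D_def sum_subtractf)
    qed
    have base: "c * X powr \<rho> + F * ln X + G \<le> D X" if X: "X1 \<le> X" "X \<le> M * X1" for X
    proof -
      have X0: "X > 0" using X X1 M by linarith
      have "X powr \<rho> \<le> (M * X1) powr \<rho>" using X X0 \<rho> by (intro powr_mono2) auto
      then have "c * X powr \<rho> \<le> c * (M * X1) powr \<rho>" using c by (intro mult_left_mono) auto
      also have "\<dots> = 1" using M X1 by (simp add: c_def flip: powr_add)
      finally have "c * X powr \<rho> \<le> 1" .
      moreover have "K + G + 1 \<le> ln X" using X X1(3) X0 by (subst ln_ge_iff) auto
      moreover have "real J * ((ln X - J * ln 7) / ln 3) \<le> D X"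
        unfolding D_def using X X1 r by (intro reach_base) auto
      moreover have "real J * ((ln X - J * ln 7) / ln 3) = real J / ln 3 * ln X - K" by (simp add: K_def field_simps)
      moreover have "(F + 1) * ln X \<le> real J / ln 3 * ln X"
      proof (rule mult_right_mono)
        have l3: "ln 3 \<le> (2::real)" using ln_le_minus_one[of "3::real"] by simp
        have "(F + 1) * ln 3 \<le> (F + 1) * 2" using l3 F0 by (intro mult_left_mono) auto
        then show "F + 1 \<le> real J / ln 3" using J by (simp add: field_simps)
        show "0 \<le> ln X" using calculation(2) K0 G0 by linarith
      qed
      ultimately show ?thesis by (simp add: algebra_simps)
    qed
    \<comment> \<open>The range grows by the least letter 3, while X > M * X1 with M the largest
      letter keeps each X/q above X1. The summand F * ln X strengthens the claim: seven letters
      return it seven times, enough to pay the loss F * ln X and to restore it.\<close>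
    have claim: "c * X powr \<rho> + F * ln X + G \<le> D X" if "X1 \<le> X" "X \<le> M * X1 * 3 ^ n" for n X
      using that
    proof (induction n arbitrary: X)
      case 0 then show ?case using base by simp
    next
      case (Suc n)
      show ?case
      proof (cases "X \<le> M * X1")
        case True then show ?thesis using base Suc by blast
      next
        case False
        have X0: "X > 0" "X \<ge> M" using Suc X1 M by linarith+
        have IH: "c * (X / q) powr \<rho> + F * ln (X / q) + G \<le> D (X / q)" if q: "q \<in> letters" for q
        proof (rule Suc.IH)
          have q3: "real q \<ge> 3" using letters_ge[OF q] by simp
          have "X1 * q \<le> X1 * M" using M(2)[OF q] X1 M by (intro mult_left_mono) auto
          then show "X1 \<le> X / q" using False q3 by (simp add: field_simps)
          have "X / q \<le> X / 3" using q3 X0 by (intro divide_left_mono) auto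
          also have "X / 3 \<le> M * X1 * 3 ^ n" using Suc.prems(2) by simp
          finally show "X / q \<le> M * X1 * 3 ^ n" .
        qed
        have lnX: "ln X \<ge> 0" using X0 M by simp
        have "c * X powr \<rho> + 7 * (F * ln X) - F * S + 7 * G \<le> (\<Sum>q\<in>letters. c * (X / q) powr \<rho> + F * ln (X / q) + G)"
        proof -
          have e: "c * (X / q) powr \<rho> + F * ln (X / q) + G = c * X powr \<rho> * real q powr - \<rho> + (F * ln X - F * ln (real q)) + G" if q: "q \<in> letters" for q
            using letters_ge[OF q] X0 by (simp add: powr_divide powr_minus_divide ln_div algebra_simps)
          have "(\<Sum>q\<in>letters. c * (X / q) powr \<rho> + F * ln (X / q) + G) = c * X powr \<rho> * (\<Sum>q\<in>letters. real q powr - \<rho>) + (7 * (F * ln X) - F * S) + 7 * G"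
            by (simp add: e sum.distrib sum_subtractf card7 S_def flip: sum_distrib_left)
          moreover have "c * X powr \<rho> * 1 \<le> c * X powr \<rho> * (\<Sum>q\<in>letters. real q powr - \<rho>)"
            using \<rho>(1) c by (intro mult_left_mono) auto
          ultimately show ?thesis by simp
        qed
        also have "\<dots> \<le> (\<Sum>q\<in>letters. D (X / q))" by (intro sum_mono IH)
        also have "\<dots> \<le> D X + F * (1 + ln X)" using rec[OF X0(2)] by simp
        finally have "c * X powr \<rho> + 7 * (F * ln X) - F * S + 7 * G \<le> D X + F * (1 + ln X)" .
        moreover have "6 * G = F * S + F" by (simp add: G_def)
        moreover have "F * ln X \<ge> 0" using F0 lnX by simp
        ultimately show ?thesis by (simp add: algebra_simps)
      qed
    qed
    have "c * X powr \<rho> \<le> real (card (reach r X))" if X: "X \<ge> X1" for X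
    proof -
      have X0: "X \<ge> 1" using X X1 M by linarith
      obtain n where "X / (M * X1) < 3 ^ n" using real_arch_pow[of 3] by auto
      then have "X \<le> M * X1 * 3 ^ n" using MX by (simp add: field_simps)
      from claim[OF X this] have "c * X powr \<rho> + F * ln X + G \<le> real (card (reach r X))" by (simp add: D_def)
      moreover have "F * ln X \<ge> 0" using F0 X0 by simp
      ultimately show ?thesis using G0 by linarith
    qed
    moreover have "X1 \<ge> 1" using X1 M by linarith
    ultimately show "\<exists>c>0. \<exists>X1\<ge>1. \<forall>X\<ge>X1. c * X powr \<rho> \<le> real (card (reach r X))" using c by blast
  qed
qed

section \<open>Numerical estimates\<close>

text \<open>Raising to the b-th power clears the fractional exponent, so that comparisons with
  rational numbers become integer arithmetic.\<close>

lemma powr_minus_fraction_power: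
  assumes "q > 0" "b > 0"
  shows "(real q powr - (real a / real b)) ^ b = 1 / real q ^ a"
proof -
  have "(real q powr - (real a / real b)) ^ b = (real q powr - (real a / real b)) powr real b"
    using assms by (simp add: powr_realpow)
  also have "\<dots> = real q powr (- real a)" using assms by (simp add: powr_powr)
  also have "\<dots> = 1 / real q ^ a" using assms by (simp add: powr_minus_divide powr_realpow)
  finally show ?thesis .
qed

lemma le_powr_minus_fraction:
  assumes "l ^ b * real q ^ a \<le> 1" "q > 0" "b > 0"
  shows "l \<le> real q powr - (real a / real b)"
proof (rule ccontr)
  assume "\<not> ?thesis"
  then have "(real q powr - (real a / real b)) ^ b < l ^ b" using assms(3) by (intro power_strict_mono) auto
  then show False using assms powr_minus_fraction_power[of q b a] by (simp add: field_simps)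
qed

lemma powr_minus_fraction_le:
  assumes "1 \<le> u ^ b * real q ^ a" "u > 0" "q > 0" "b > 0"
  shows "real q powr - (real a / real b) \<le> u"
proof (rule ccontr)
  assume "\<not> ?thesis"
  then have "u ^ b < (real q powr - (real a / real b)) ^ b" using assms by (intro power_strict_mono) auto
  then show False using assms powr_minus_fraction_power[of q b a] by (simp add: field_simps)
qed

lemma sum_letters: "(\<Sum>q\<in>letters. f q) = f 3 + f 7 + f 31 + f 127 + f 8191 + f 131071 + f 524287" for f :: "nat \<Rightarrow> real"
  by (simp add: letters_def)

text \<open>Writing \<open>87/143\<close> as \<open>3/11 * (29/13)\<close> keeps the integers to be compared small.\<close>

lemma le_powr_minus_87_143:
  assumes m: "m ^ 11 * real q ^ 3 \<le> 1" "m > 0" and l: "l ^ 13 \<le> m ^ 29" and q: "q > 0"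
  shows "l \<le> real q powr - (real 87 / real 143)"
proof (rule ccontr)
  assume "\<not> ?thesis"
  then have "(real q powr - (real 87 / real 143)) ^ 13 < l ^ 13" by (intro power_strict_mono) auto
  also have "\<dots> \<le> m ^ 29" by (rule l)
  also have "m \<le> real q powr - (real 3 / real 11)" using m(1) q by (intro le_powr_minus_fraction) auto
  then have "m ^ 29 \<le> (real q powr - (real 3 / real 11)) ^ 29" using m(2) by (intro power_mono) auto
  finally show False using q by (simp add: powr_power)
qed

text \<open>The argument given for each q is a rational lower bound m of q^(-3/11), from which the
  six-digit bound for q^(-87/143) follows. These bounds add up to 1000158/10^6.\<close>

lemma letters_sum_lower: "1 \<le> (\<Sum>q\<in>letters. real q powr - (87 / 143))"
proof -
  have h0: "512534/10^6 \<le> real 3 powr - (real 87 / real 143)"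
    by (rule le_powr_minus_87_143[of "7410986/10^7"]) (simp_all add: power_divide)
  have h1: "306090/10^6 \<le> real 7 powr - (real 87 / real 143)"
    by (rule le_powr_minus_87_143[of "5881914/10^7"]) (simp_all add: power_divide)
  have h2: "123785/10^6 \<le> real 31 powr - (real 87 / real 143)"
    by (rule le_powr_minus_87_143[of "39198097/10^8"]) (simp_all add: power_divide)
  have h3: "52488/10^6 \<le> real 127 powr - (real 87 / real 143)"
    by (rule le_powr_minus_87_143[of "26683/10^5"]) (simp_all add: power_divide)
  have h4: "4160/10^6 \<le> real 8191 powr - (real 87 / real 143)"
    by (rule le_powr_minus_87_143[of "85649/10^6"]) (simp_all add: power_divide)
  have h5: "770/10^6 \<le> real 131071 powr - (real 87 / real 143)"
    by (rule le_powr_minus_87_143[of "40208/10^6"]) (simp_all add: power_divide)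
  have h6: "331/10^6 \<le> real 524287 powr - (real 87 / real 143)"
    by (rule le_powr_minus_87_143[of "2754/10^5"]) (simp_all add: power_divide)
  have "(1::real) \<le> 512534/10^6 + 306090/10^6 + 123785/10^6 + 52488/10^6 + 4160/10^6 + 770/10^6 + 331/10^6" by simp
  also have "\<dots> \<le> (\<Sum>q\<in>letters. real q powr - (real 87 / real 143))"
    unfolding sum_letters by (intro add_mono h0 h1 h2 h3 h4 h5 h6)
  finally show ?thesis by (simp only: of_nat_numeral)
qed

text \<open>What is missing to 1, namely 409/10^6, is the room left for all larger Mersenne
  primes.\<close>

lemma letters_sum_upper: "(\<Sum>q\<in>letters. real q powr - (14 / 23)) \<le> 999591/10^6"
proof -
  have h: "real 3 powr - (real 14 / real 23) \<le> 512364/10^6" "real 7 powr - (real 14 / real 23) \<le> 305910/10^6"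
    "real 31 powr - (real 14 / real 23) \<le> 123656/10^6" "real 127 powr - (real 14 / real 23) \<le> 52412/10^6"
    "real 8191 powr - (real 14 / real 23) \<le> 4150/10^6" "real 131071 powr - (real 14 / real 23) \<le> 768/10^6"
    "real 524287 powr - (real 14 / real 23) \<le> 331/10^6"
    by (rule powr_minus_fraction_le; simp add: power_divide divide_simps)+
  have "(\<Sum>q\<in>letters. real q powr - (real 14 / real 23)) \<le> 512364/10^6 + 305910/10^6 + 123656/10^6 + 52412/10^6 + 4150/10^6 + 768/10^6 + 331/10^6"
    unfolding sum_letters by (intro add_mono h)
  also have "\<dots> = 999591/10^6" by simp
  finally show ?thesis by (simp only: of_nat_numeral)
qed

text \<open>For n < 23 the factors 3 (n even), 7 (n divisible by 3) and 23 (n divisible by 11)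
  dispose of every 2^n - 1 that is not a letter, apart from the values 0 and 1.\<close>

lemma mersenne_primes_cases:
  assumes "q \<in> mersenne_primes"
  shows "q \<in> letters \<or> (\<exists>n\<ge>23. q = 2 ^ n - 1)"
proof (rule disjCI)
  assume no: "\<not> (\<exists>n\<ge>23. q = 2 ^ n - 1)"
  obtain n where n: "q = 2 ^ n - 1" and p: "prime q" using assms by (auto simp: mersenne_primes_def)
  then have "n < 23" using no not_less by blast
  have d: "\<not> 3 dvd q \<or> q = 3" "\<not> 7 dvd q \<or> q = 7" "\<not> 23 dvd q \<or> q = 23" "q \<noteq> 0" "q \<noteq> 1"
    using p by (auto simp: prime_nat_iff)
  have "n \<in> {0, 1, 2, 3, 4, 5, 6, 7, 8, 9, 10, 11, 12, 13, 14, 15, 16, 17, 18, 19, 20, 21, 22}"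
    using \<open>n < 23\<close> unfolding insert_iff empty_iff by presburger
  then show "q \<in> letters"
    using d n unfolding letters_def by (elim insertE emptyE) simp_all
qed

lemma mersenne_sum_le:
  assumes A: "finite A" "A \<subseteq> mersenne_primes"
  shows "(\<Sum>q\<in>A. real q powr - (14 / 23)) \<le> 9999/10000"
proof -
  define f where "f = (\<lambda>q. real q powr - (14 / 23))"
  \<comment> \<open>Slightly above 2^(-14/23) = 0.6557... . As 2^n - 1 is only bounded below by
    2^(n-1), exponents drop by one and the tail starts at x^22.\<close>
  define x :: real where "x = 656/1000"
  have f0: "f q \<ge> 0" for q by (simp add: f_def)
  define B where "B = A - letters"
  have B: "finite B" using A by (simp add: B_def)
  have "\<forall>q\<in>B. \<exists>n\<ge>23. q = 2 ^ n - 1" using mersenne_primes_cases A by (auto simp: B_def)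
  then obtain e where e: "\<And>q. q \<in> B \<Longrightarrow> e q \<ge> 23 \<and> q = 2 ^ e q - 1" by metis
  define N where "N = Max (insert 23 (e ` B))"
  have eN: "e q \<le> N" if "q \<in> B" for q unfolding N_def using B that by (intro Max_ge) auto
  have fx: "f (2 ^ n - 1) \<le> x ^ (n - 1)" if n: "n \<ge> 23" for n
  proof -
    obtain m where m: "n = Suc m" using n by (cases n) auto
    have "(2::nat) ^ m \<le> 2 ^ n - 1" unfolding m using one_le_power[of "2::nat" m] by simp
    then have "real (2 ^ m) \<le> real (2 ^ n - 1)" by (simp only: of_nat_le_iff)
    then have "f (2 ^ n - 1) \<le> real (2 ^ m) powr - (14 / 23)" unfolding f_def by (intro powr_mono2') auto
    also have "\<dots> = (real 2 powr - (real 14 / real 23)) ^ m"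
      by (simp add: powr_powr mult.commute flip: powr_realpow)
    also have "real 2 powr - (real 14 / real 23) \<le> x" unfolding x_def by (rule powr_minus_fraction_le) (simp_all add: power_divide)
    then have "(real 2 powr - (real 14 / real 23)) ^ m \<le> x ^ m" by (intro power_mono) auto
    finally show ?thesis by (simp add: m)
  qed
  have "sum f B = (\<Sum>n\<in>e ` B. f (2 ^ n - 1))"
    using e by (subst sum.reindex) (auto intro!: inj_onI sum.cong, metis)
  also have "\<dots> \<le> (\<Sum>n\<in>e ` B. x ^ (n - 1))" using fx e by (intro sum_mono) auto
  also have "\<dots> \<le> (\<Sum>n\<in>{23..N}. x ^ (n - 1))" using e eN by (intro sum_mono2) (auto simp: x_def)
  also have "\<dots> = (\<Sum>n\<in>{22..N-1}. x ^ n)"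
    by (rule sum.reindex_bij_witness[of _ Suc "\<lambda>n. n - 1"]) (auto simp: N_def)
  also have "\<dots> \<le> x ^ 22 / (1 - x)"
  proof (cases "22 \<le> N - 1")
    case True
    have "(1 - x) * (\<Sum>n\<in>{22..N-1}. x ^ n) = x ^ 22 - x ^ Suc (N - 1)" using sum_gp_multiplied[OF True, of x] .
    also have "\<dots> \<le> x ^ 22" by (simp add: x_def)
    finally show ?thesis by (simp add: x_def field_simps)
  next
    case False then show ?thesis by (simp add: x_def)
  qed
  also have "\<dots> \<le> 3/10000" by (simp add: x_def field_simps)
  finally have "sum f B \<le> 3/10000" .
  moreover have "sum f A = sum f (A \<inter> letters) + sum f B" unfolding B_def using A(1) by (rule sum.Int_Diff)
  moreover have "sum f (A \<inter> letters) \<le> sum f letters" using f0 finite_letters by (intro sum_mono2) auto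
  ultimately show ?thesis using letters_sum_upper unfolding f_def by simp
qed

lemma letters_subset_mersenne_primes: "letters \<subseteq> mersenne_primes"
proof
  fix q assume q: "q \<in> letters"
  then have "q \<in> {2 ^ 2 - 1, 2 ^ 3 - 1, 2 ^ 5 - 1, 2 ^ 7 - 1, 2 ^ 13 - 1, 2 ^ 17 - 1, 2 ^ 19 - 1}" by (simp add: letters_def)
  then have "\<exists>n. q = 2 ^ n - 1" by blast
  then show "q \<in> mersenne_primes" using letters_prime[OF q] by (simp add: mersenne_primes_def)
qed

section \<open>Heights\<close>

lemma cubic_gap_ge:
  fixes y :: rat
  assumes "y \<ge> -1" shows "y ^ 3 + 1 - y \<ge> 1/2"
proof (cases "y \<ge> 0")
  case True
  \<comment> \<open>a rational double root close to the minimum at \<open>1 / sqrt 3\<close>\<close>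
  have "0 \<le> (y - 3/5)\<^sup>2 * (y + 6/5)" using True by simp
  also have "\<dots> = y ^ 3 - 27/25 * y + 54/125" by (simp add: power2_eq_square power3_eq_cube field_simps)
  finally show ?thesis using True by simp
next
  case False
  have "(- y)\<^sup>2 \<le> 1" using assms False by (intro power_le_one) auto
  then have "y\<^sup>2 \<le> 1" by simp
  then have "0 \<le> y * (y\<^sup>2 - 1)" using False by (intro mult_nonpos_nonpos) auto
  also have "\<dots> = y ^ 3 - y" by (simp add: power2_eq_square power3_eq_cube algebra_simps)
  finally show ?thesis by simp
qed

lemma cubic_gap_mono:
  fixes x y :: rat
  assumes "x \<le> y" "y \<le> -1" shows "x ^ 3 + 1 - x \<le> y ^ 3 + 1 - y"
proof -
  have "1 \<le> (- y)\<^sup>2" using assms by (intro one_le_power) simp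
  then have "1 \<le> y\<^sup>2" by simp
  moreover have "0 \<le> x\<^sup>2" "0 \<le> x * y" using assms by (auto intro: mult_nonpos_nonpos)
  ultimately have "0 \<le> y\<^sup>2 + x * y + x\<^sup>2 - 1" by linarith
  then have "0 \<le> (y - x) * (y\<^sup>2 + x * y + x\<^sup>2 - 1)" using assms by (intro mult_nonneg_nonneg) auto
  also have "\<dots> = (y ^ 3 + 1 - y) - (x ^ 3 + 1 - x)" by (simp add: power2_eq_square power3_eq_cube algebra_simps)
  finally show ?thesis by simp
qed

text \<open>The cubic does have a real fixed point, so rationality matters: a rational one would be
  an integer by comparing denominators, and a^3 - a is even, never -1.\<close>

lemma theta_three_no_fixpoint: "theta 3 r \<noteq> r"
proof
  assume "theta 3 r = r"
  then have "num r = num r ^ 3 + den r ^ 3" "den r = den r ^ 3" using theta_num_den[of 3 r] by simp_all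
  then have "den r * (den r ^ 2 - 1) = 0" by (simp add: power2_eq_square power3_eq_cube algebra_simps)
  then have "den r ^ 2 = 1" using den_pos[of r] by simp
  then have "den r = 1" using den_pos[of r] power2_eq_1_iff[of "den r"] by linarith
  then have "num r = num r ^ 3 + 1" using \<open>num r = num r ^ 3 + den r ^ 3\<close> by simp
  moreover have "even (num r ^ 3 - num r)" by simp
  ultimately show False by presburger
qed

text \<open>A large height may come from the denominator alone, whereas the size estimates need a
  point of large absolute value; the orbit under z^3 + 1 provides one. A positive initial
  displacement g stays at least min(g, 1/2), by the absolute bound above -1 and by monotonicity
  below. A negative one forces r < -1 and can only decrease further.\<close>

lemma theta_three_escapes: "\<exists>n>0. c \<le> \<bar>fold theta (replicate n 3) r\<bar>"
proof -
  define z where "z = (\<lambda>n. (theta 3 ^^ n) r)"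
  have z0: "z 0 = r" and zS: "z (Suc n) = z n ^ 3 + 1" for n by (simp_all add: z_def theta_def)
  define g where "g = r ^ 3 + 1 - r"
  have "\<exists>\<delta>>0. \<forall>n. r + of_nat n * \<delta> \<le> z n \<or> z n \<le> r - of_nat n * \<delta>"
  proof (cases "g > 0")
    case True
    define \<delta> where "\<delta> = min g (1/2)"
    have "z n ^ 3 + 1 - z n \<ge> \<delta> \<and> r + of_nat n * \<delta> \<le> z n" for n
    proof (induction n)
      case 0 then show ?case by (simp add: z0 \<delta>_def g_def)
    next
      case (Suc n)
      then have le: "z n + \<delta> \<le> z (Suc n)" by (simp add: zS)
      have "\<delta> > 0" using True by (simp add: \<delta>_def)
      have "z (Suc n) ^ 3 + 1 - z (Suc n) \<ge> \<delta>"
      proof (cases "z (Suc n) \<ge> -1")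
        case True then show ?thesis using cubic_gap_ge[of "z (Suc n)"] by (simp add: \<delta>_def)
      next
        case False
        then have "z n ^ 3 + 1 - z n \<le> z (Suc n) ^ 3 + 1 - z (Suc n)"
          using le \<open>\<delta> > 0\<close> by (intro cubic_gap_mono) auto
        then show ?thesis using Suc by linarith
      qed
      then show ?case using Suc le by (simp add: algebra_simps)
    qed
    then show ?thesis using True by (intro exI[of _ \<delta>]) (auto simp: \<delta>_def)
  next
    case False
    have "g \<noteq> 0" using theta_three_no_fixpoint[of r] by (auto simp: g_def theta_def)
    then have g: "g < 0" using False by simp
    then have r: "r < -1" using cubic_gap_ge[of r] by (force simp: g_def)
    have "z n \<le> r + of_nat n * g \<and> z n ^ 3 + 1 - z n \<le> g" for n
    proof (induction n)
      case 0 then show ?case by (simp add: z0 g_def)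
    next
      case (Suc n)
      then have le: "z (Suc n) \<le> z n + g" by (simp add: zS)
      have "of_nat n * g \<le> 0" using g by (simp add: mult_nonneg_nonpos)
      then have "z (Suc n) ^ 3 + 1 - z (Suc n) \<le> z n ^ 3 + 1 - z n"
        using le Suc g r by (intro cubic_gap_mono) auto
      then show ?case using Suc le by (auto simp: algebra_simps)
    qed
    then show ?thesis using g by (intro exI[of _ "- g"]) auto
  qed
  then obtain \<delta> where \<delta>: "\<delta> > 0" "\<And>n. r + of_nat n * \<delta> \<le> z n \<or> z n \<le> r - of_nat n * \<delta>" by blast
  obtain n where n: "(\<bar>c\<bar> + \<bar>r\<bar>) / \<delta> < of_nat n" using reals_Archimedean2 by blast
  then have "\<bar>c\<bar> + \<bar>r\<bar> < of_nat n * \<delta>" using \<delta>(1) by (simp add: field_simps)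
  also have "of_nat n * \<delta> \<le> of_nat (Suc n) * \<delta>" using \<delta>(1) by (intro mult_right_mono) auto
  finally have "c \<le> \<bar>z (Suc n)\<bar>" using \<delta>(2)[of "Suc n"] by (auto simp: abs_if split: if_splits)
  then show ?thesis by (intro exI[of _ "Suc n"]) (simp add: z_def funpow_swap1)
qed

section \<open>Heights along an orbit\<close>

lemma height_num_den: "height z = max \<bar>num z\<bar> (den z)"
  using den_pos[of z] by (simp add: height_def case_prod_beta)

lemma height_pos: "height z \<ge> 1"
  using den_pos[of z] by (simp add: height_num_den)

text \<open>Cancellation in num^q + den^q is harmless: |num|^q <= |num^q + den^q| + den^q, and den^q
  is itself the new denominator.\<close>

lemma height_theta:
  assumes "q > 0"
  shows "height (theta q z) \<le> 2 * height z ^ q" "height z ^ q \<le> 2 * height (theta q z)"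
proof -
  define a b where "a = \<bar>num z\<bar>" and "b = den z"
  have b: "b > 0" by (simp add: b_def den_pos)
  have h: "height z = max a b" "height (theta q z) = max \<bar>num z ^ q + b ^ q\<bar> (b ^ q)"
    using assms by (simp_all add: height_num_den theta_num_den a_def b_def)
  have nq: "\<bar>num z ^ q\<bar> = a ^ q" by (simp add: a_def power_abs)
  have bq: "b ^ q > 0" using b by simp
  have le: "a ^ q \<le> max a b ^ q" "b ^ q \<le> max a b ^ q" using b by (auto intro!: power_mono simp: a_def)
  have "\<bar>num z ^ q + b ^ q\<bar> \<le> a ^ q + b ^ q" "a ^ q \<le> \<bar>num z ^ q + b ^ q\<bar> + b ^ q" using nq bq by linarith+
  moreover have "max a b ^ q = a ^ q \<or> max a b ^ q = b ^ q" by (simp add: max_def)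
  moreover define M where "M = max \<bar>num z ^ q + b ^ q\<bar> (b ^ q)"
  then have "\<bar>num z ^ q + b ^ q\<bar> \<le> M" "b ^ q \<le> M" "M = \<bar>num z ^ q + b ^ q\<bar> \<or> M = b ^ q" by (auto simp: max_def)
  ultimately show "height (theta q z) \<le> 2 * height z ^ q" "height z ^ q \<le> 2 * height (theta q z)"
    unfolding h M_def[symmetric] using le bq by linarith+
qed

text \<open>A single step has an error ln 2 in either direction. Shifting the logarithmic height by
  ln 2 up or down absorbs it, as 2 * ln 2 <= q * ln 2, and leaves clean multiplicative inequalities
  that can be iterated.\<close>

lemma ln_height_theta:
  assumes "q \<ge> 2"
  shows "ln (real_of_int (height (theta q z))) + ln 2 \<le> q * (ln (real_of_int (height z)) + ln 2)"
    "q * (ln (real_of_int (height z)) - ln 2) \<le> ln (real_of_int (height (theta q z))) - ln 2"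
proof -
  define h h' where "h = real_of_int (height z)" and "h' = real_of_int (height (theta q z))"
  have pos: "h > 0" "h' > 0" using height_pos[of z] height_pos[of "theta q z"] by (simp_all add: h_def h'_def)
  have "real_of_int (height (theta q z)) \<le> real_of_int (2 * height z ^ q)" "real_of_int (height z ^ q) \<le> real_of_int (2 * height (theta q z))"
    using height_theta[of q z] assms by (simp_all only: of_int_le_iff)
  then have "h' \<le> 2 * h ^ q" "h ^ q \<le> 2 * h'" by (simp_all add: h_def h'_def)
  then have "ln h' \<le> ln (2 * h ^ q)" "ln (h ^ q) \<le> ln (2 * h')" using pos by (simp_all only: ln_le_cancel_iff zero_less_power mult_pos_pos zero_less_numeral)
  then have e: "ln h' \<le> ln 2 + q * ln h" "q * ln h \<le> ln 2 + ln h'" using pos by (simp_all add: ln_mult ln_realpow)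
  have "2 * ln 2 \<le> real q * ln 2" using assms by (intro mult_right_mono) auto
  then show "ln h' + ln 2 \<le> q * (ln h + ln 2)" "q * (ln h - ln 2) \<le> ln h' - ln 2"
    using e unfolding distrib_left right_diff_distrib by linarith+
qed

lemma ln_height_fold_theta:
  assumes "\<And>q. q \<in> set ws \<Longrightarrow> q \<ge> 2"
  shows "ln (real_of_int (height (fold theta ws z))) + ln 2 \<le> real (prod_list ws) * (ln (real_of_int (height z)) + ln 2)"
    and "real (prod_list ws) * (ln (real_of_int (height z)) - ln 2) \<le> ln (real_of_int (height (fold theta ws z))) - ln 2"
proof -
  define h where "h = (\<lambda>z. ln (real_of_int (height z)))"
  have "h (fold theta ws z) + ln 2 \<le> real (prod_list ws) * (h z + ln 2) \<and>
    real (prod_list ws) * (h z - ln 2) \<le> h (fold theta ws z) - ln 2"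
    using assms
  proof (induction ws rule: rev_induct)
    case (snoc q ws)
    have q: "q \<ge> 2" using snoc.prems by simp
    have IH: "h (fold theta ws z) + ln 2 \<le> real (prod_list ws) * (h z + ln 2)"
      "real (prod_list ws) * (h z - ln 2) \<le> h (fold theta ws z) - ln 2"
      using snoc by simp_all
    have "h (fold theta (ws @ [q]) z) + ln 2 \<le> q * (h (fold theta ws z) + ln 2)"
      using ln_height_theta(1)[OF q] by (simp add: h_def)
    also have "\<dots> \<le> q * (real (prod_list ws) * (h z + ln 2))" using IH by (intro mult_left_mono) auto
    also have "\<dots> = real (prod_list (ws @ [q])) * (h z + ln 2)" by simp
    finally have 1: "h (fold theta (ws @ [q]) z) + ln 2 \<le> real (prod_list (ws @ [q])) * (h z + ln 2)" .
    have "real (prod_list (ws @ [q])) * (h z - ln 2) = q * (real (prod_list ws) * (h z - ln 2))" by simp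
    also have "\<dots> \<le> q * (h (fold theta ws z) - ln 2)" using IH by (intro mult_left_mono) auto
    also have "\<dots> \<le> h (fold theta (ws @ [q]) z) - ln 2" using ln_height_theta(2)[OF q] by (simp add: h_def)
    finally show ?case using 1 by blast
  qed simp
  then show "ln (real_of_int (height (fold theta ws z))) + ln 2 \<le> real (prod_list ws) * (ln (real_of_int (height z)) + ln 2)"
    "real (prod_list ws) * (ln (real_of_int (height z)) - ln 2) \<le> ln (real_of_int (height (fold theta ws z))) - ln 2"
    by (simp_all add: h_def)
qed

section \<open>Counting words, and the two estimates\<close>

lemma mersenne_primes_ge_2: "q \<in> mersenne_primes \<Longrightarrow> q \<ge> 2"
  by (auto simp: mersenne_primes_def prime_ge_2_nat)

text \<open>Splitting off the first letter bounds the number of words of product at most X by 1 plus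
  the sum of the numbers for X/q. The bound X^\<sigma> / (1 - s) reproduces itself because
  X^\<sigma> + s * X^\<sigma> / (1 - s) = X^\<sigma> / (1 - s). Induction on the length is available
  since only letters up to X occur, so each step involves a finite set F.\<close>

lemma card_words_le:
  fixes X \<sigma> s :: real
  assumes A: "\<And>q. q \<in> A \<Longrightarrow> q \<ge> 2" and s: "s < 1" "\<And>F. finite F \<Longrightarrow> F \<subseteq> A \<Longrightarrow> (\<Sum>q\<in>F. real q powr - \<sigma>) \<le> s"
    and \<sigma>: "\<sigma> \<ge> 0" and X: "X > 0"
  shows "real (card (words A X)) \<le> X powr \<sigma> / (1 - s)"
proof -
  have s0: "s \<ge> 0" using s(2)[of "{}"] by simp
  have bound: "real (card {ws \<in> words A X. length ws \<le> n}) \<le> X powr \<sigma> / (1 - s)" if "X > 0" for n X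
    using that
  proof (induction n arbitrary: X)
    case 0
    show ?case
    proof (cases "X \<ge> 1")
      case True
      have "{ws \<in> words A X. length ws \<le> 0} = {[]}" using True by (auto simp: words_def)
      moreover have "1 \<le> X powr \<sigma>" using True \<sigma> by (rule ge_one_powr_ge_zero)
      then have "1 * (1 - s) \<le> X powr \<sigma> * 1" using s s0 by (intro mult_mono) auto
      ultimately show ?thesis using s by (simp add: field_simps)
    next
      case False
      then have e: "{ws \<in> words A X. length ws \<le> 0} = {}" by (auto simp: words_def)
      show ?thesis unfolding e using s(1) by simp
    qed
  next
    case (Suc n)
    define F where "F = A \<inter> {..nat \<lfloor>X\<rfloor>}"
    have F: "finite F" "F \<subseteq> A" by (auto simp: F_def)
    have prod1: "prod_list ws \<ge> 1" if "set ws \<subseteq> A" for ws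
      using that
    proof (induction ws)
      case (Cons q ws) then show ?case using A[of q] mult_le_mono[of 1 q 1 "prod_list ws"] by simp
    qed simp
    show ?case
    proof (cases "X \<ge> 1")
      case False
      have "words A X = {}"
      proof -
        have "\<not> real (prod_list ws) \<le> X" if "set ws \<subseteq> A" for ws
        proof -
          have "1 \<le> real (prod_list ws)" using prod1[OF that] by simp
          then show ?thesis using False by linarith
        qed
        then show ?thesis by (auto simp: words_def)
      qed
      then show ?thesis using s by simp
    next
      case True
      have "{ws \<in> words A X. length ws \<le> Suc n} \<subseteq> insert [] (\<Union>q\<in>F. Cons q ` {ws \<in> words A (X / q). length ws \<le> n})"
      proof
        fix ws assume ws: "ws \<in> {ws \<in> words A X. length ws \<le> Suc n}"
        show "ws \<in> insert [] (\<Union>q\<in>F. Cons q ` {ws \<in> words A (X / q). length ws \<le> n})"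
        proof (cases ws)
          case (Cons q us)
          then have us: "q \<in> A" "set us \<subseteq> A" "real q * real (prod_list us) \<le> X" "length us \<le> n" using ws by (auto simp: words_def)
          have q0: "real q > 0" using A[OF us(1)] by simp
          have "real q * 1 \<le> real q * real (prod_list us)" using prod1[OF us(2)] by (intro mult_left_mono) auto
          then have "q \<le> nat \<lfloor>X\<rfloor>" using us(3) by (intro le_nat_floor) simp
          moreover have "real (prod_list us) \<le> X / q" using us(3) q0 by (simp add: field_simps)
          ultimately show ?thesis using us Cons by (auto simp: F_def words_def)
        qed simp
      qed
      moreover have fin: "finite (Cons q ` {ws \<in> words A (X / q). length ws \<le> n})" for q :: nat
        using finite_words[OF A] by simp
      ultimately have "card {ws \<in> words A X. length ws \<le> Suc n} \<le> card (insert [] (\<Union>q\<in>F. Cons q ` {ws \<in> words A (X / q). length ws \<le> n}))"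
        using F by (intro card_mono) auto
      also have "\<dots> \<le> Suc (card (\<Union>q\<in>F. Cons q ` {ws \<in> words A (X / q). length ws \<le> n}))"
        using F fin by (simp add: card_insert_if)
      also have "card (\<Union>q\<in>F. Cons q ` {ws \<in> words A (X / q). length ws \<le> n}) \<le> (\<Sum>q\<in>F. card (Cons q ` {ws \<in> words A (X / q). length ws \<le> n}))"
        using F(1) by (rule card_UN_le)
      also have "\<dots> = (\<Sum>q\<in>F. card {ws \<in> words A (X / q). length ws \<le> n})"
        by (intro sum.cong refl card_image) (auto intro: inj_onI)
      finally have "real (card {ws \<in> words A X. length ws \<le> Suc n}) \<le> 1 + (\<Sum>q\<in>F. real (card {ws \<in> words A (X / q). length ws \<le> n}))"
        by (simp flip: of_nat_sum)
      also have "\<dots> \<le> X powr \<sigma> + (\<Sum>q\<in>F. (X / q) powr \<sigma> / (1 - s))"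
      proof (intro add_mono sum_mono Suc.IH)
        show "1 \<le> X powr \<sigma>" using True \<sigma> by (rule ge_one_powr_ge_zero)
        fix q assume "q \<in> F" 
        then have "q \<ge> 2" using A F by auto
        then show "X / q > 0" using Suc.prems by simp
      qed
      also have "(\<Sum>q\<in>F. (X / q) powr \<sigma> / (1 - s)) = X powr \<sigma> / (1 - s) * (\<Sum>q\<in>F. real q powr - \<sigma>)"
        unfolding sum_distrib_left
      proof (rule sum.cong)
        fix q assume "q \<in> F" 
        then have "q \<ge> 2" using A F by auto
        then show "(X / q) powr \<sigma> / (1 - s) = X powr \<sigma> / (1 - s) * real q powr - \<sigma>"
          using Suc.prems by (simp add: powr_divide powr_minus_divide)
      qed simp
      also have "X powr \<sigma> + \<dots> \<le> X powr \<sigma> + X powr \<sigma> / (1 - s) * s"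
        using s F by (intro add_left_mono mult_left_mono) auto
      also have "\<dots> = X powr \<sigma> / (1 - s)" using s(1) by (simp add: field_simps)
      finally show ?thesis .
    qed
  qed
  obtain n where n: "\<And>ws. ws \<in> words A X \<Longrightarrow> length ws \<le> n"
  proof -
    have "finite (length ` words A X)" using finite_words[OF A] by simp
    then obtain n where "\<forall>l\<in>length ` words A X. l \<le> n" using finite_nat_set_iff_bounded_le by blast
    then show ?thesis using that by blast
  qed
  then have "words A X = {ws \<in> words A X. length ws \<le> n}" by blast
  then show ?thesis using bound[OF X, of n] by simp
qed

text \<open>A height above 4 gives ln (height r) - ln 2 >= ln 2, so a value of height at most B
  comes from a word of product at most ln B / ln 2. Counting words instead of values can only
  increase the number. The factor 10000 is 1/(1 - 9999/10000).\<close>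

lemma card_mersenne_values_le:
  assumes r: "height r > 4" and B: "B \<ge> exp 1"
  shows "real (card (mersenne_values r B)) \<le> (ln B / ln 2) powr (14/23) * 10000"
proof -
  define X where "X = ln B / ln 2"
  have B0: "B > 0" using B less_le_trans[OF exp_gt_zero] by blast
  then have "ln B \<ge> 1" using B by (simp add: ln_ge_iff)
  then have X: "X > 0" by (simp add: X_def)
  have h4: "ln 2 \<le> ln (real_of_int (height r)) - ln 2"
  proof -
    have "ln (2 * 2) \<le> ln (real_of_int (height r))" using r by (subst ln_le_cancel_iff) auto
    moreover have "ln (2 * 2) = ln 2 + ln (2::real)" by (subst ln_mult) auto
    ultimately show ?thesis by linarith
  qed
  have "mersenne_values r B \<subseteq> (\<lambda>ws. fold theta ws r) ` words mersenne_primes X"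
  proof
    fix t assume "t \<in> mersenne_values r B"
    then obtain ws where ws: "set ws \<subseteq> mersenne_primes" "t = fold theta ws r" "real_of_int (height t) \<le> B"
      by (auto simp: mersenne_values_def)
    have "real (prod_list ws) * ln 2 \<le> real (prod_list ws) * (ln (real_of_int (height r)) - ln 2)"
      using h4 by (intro mult_left_mono) auto
    also have "\<dots> \<le> ln (real_of_int (height t)) - ln 2"
      unfolding ws(2) using ws(1) mersenne_primes_ge_2 by (intro ln_height_fold_theta(2)) auto
    also have "\<dots> \<le> ln (real_of_int (height t))" by simp
    also have "\<dots> \<le> ln B" using ws(3) height_pos[of t] B0 by (subst ln_le_cancel_iff) auto
    finally have "real (prod_list ws) \<le> X" by (simp add: X_def field_simps)
    then show "t \<in> (\<lambda>ws. fold theta ws r) ` words mersenne_primes X" using ws by (auto simp: words_def)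
  qed
  moreover have fin: "finite (words mersenne_primes X)" using finite_words mersenne_primes_ge_2 by blast
  ultimately have "card (mersenne_values r B) \<le> card (words mersenne_primes X)"
    using surj_card_le by blast
  then have "real (card (mersenne_values r B)) \<le> real (card (words mersenne_primes X))" by simp
  also have "\<dots> \<le> X powr (14/23) / (1 - 9999/10000)"
    by (rule card_words_le[OF mersenne_primes_ge_2 _ mersenne_sum_le _ X]) auto
  finally show ?thesis by (simp add: X_def)
qed

lemma card_mersenne_values_ge:
  obtains c B0 where "c > 0" "\<And>B. B \<ge> B0 \<Longrightarrow> (ln B) powr (87/143) \<le> c * real (card (mersenne_values r B))"
proof -
  obtain L where L: "\<And>z m. \<lbrakk>den z = den r ^ m; m > 0; \<bar>z\<bar> \<ge> 4; ln (real_of_rat \<bar>z\<bar>) \<ge> L\<rbrakk> \<Longrightarrow>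
    \<exists>c>0. \<exists>X1\<ge>1. \<forall>X\<ge>X1. c * X powr (87/143) \<le> real (card (reach z X))"
    by (rule reach_growth[OF den_pos[of r] letters_sum_lower]) auto
  \<comment> \<open>The escape lemma takes a rational bound, so the real number exp L is replaced by
    an integer above it; the added 4 secures |z| >= 4.\<close>
  obtain k :: nat where k: "exp L \<le> real k" using real_arch_simple by blast
  obtain n where n: "n > 0" "of_nat (k + 4) \<le> \<bar>fold theta (replicate n 3) r\<bar>"
    using theta_three_escapes by blast
  define z where "z = fold theta (replicate n 3) r"
  have l3: "set (replicate n 3) \<subseteq> letters" by (auto simp: letters_def)
  have z4: "\<bar>z\<bar> \<ge> 4" using n(2) by (simp add: z_def)
  have "real_of_rat (of_nat (k + 4)) \<le> real_of_rat \<bar>z\<bar>" using n(2) unfolding z_def by (simp only: of_rat_less_eq)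
  then have "real (k + 4) \<le> real_of_rat \<bar>z\<bar>" by (simp only: of_rat_of_nat_eq)
  then have "exp L \<le> real_of_rat \<bar>z\<bar>" using k by simp
  then have "L \<le> ln (real_of_rat \<bar>z\<bar>)" using z4 by (subst ln_ge_iff) auto
  moreover have "den z = den r ^ (3 ^ n)" using den_fold_theta[OF l3, of r] by (simp add: z_def)
  ultimately obtain c X1 where c: "c > 0" "X1 \<ge> 1" "\<And>X. X \<ge> X1 \<Longrightarrow> c * X powr (87/143) \<le> real (card (reach z X))"
    using L[of z "3 ^ n"] z4 by auto
  \<comment> \<open>A word of product P continued from z has logarithmic height at most P *
    \<kappa>: the n initial steps contribute the factor 3^n.\<close>
  define \<kappa> where "\<kappa> = 3 ^ n * (ln (real_of_int (height r)) + ln 2)"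
  have "ln (real_of_int (height r)) \<ge> 0" using height_pos[of r] by simp
  then have \<kappa>: "\<kappa> > 0" unfolding \<kappa>_def by (intro mult_pos_pos add_nonneg_pos) auto
  show thesis
  proof (rule that[of "\<kappa> powr (87/143) / c" "exp (\<kappa> * X1)"])
    show "\<kappa> powr (87/143) / c > 0" using c \<kappa> by simp
    fix B :: real assume B: "B \<ge> exp (\<kappa> * X1)"
    then have B0: "B > 0" using less_le_trans[OF exp_gt_zero] by blast
    define X where "X = ln B / \<kappa>"
    have "\<kappa> * X1 \<le> ln B" using B B0 by (simp add: ln_ge_iff)
    then have X: "X \<ge> X1" using \<kappa> by (simp add: X_def field_simps)
    have "reach z X \<subseteq> mersenne_values r B"
    proof
      fix t assume "t \<in> reach z X"
      then obtain ws where ws: "set ws \<subseteq> letters" "real (prod_list ws) \<le> X" "t = fold theta ws z"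
        by (auto simp: reach_def words_def)
      \<comment> \<open>Prepending the path from r to z turns a possibly empty word at z into a
        non-empty word at r.\<close>
      define us where "us = replicate n 3 @ ws"
      have us: "set us \<subseteq> letters" "us \<noteq> []" "t = fold theta us r" "prod_list us = 3 ^ n * prod_list ws"
        using ws l3 n(1) by (auto simp: us_def z_def)
      have "ln (real_of_int (height t)) + ln 2 \<le> real (prod_list us) * (ln (real_of_int (height r)) + ln 2)"
        unfolding us(3) using us(1) letters_ge by (intro ln_height_fold_theta(1)) force
      also have "\<dots> = real (prod_list ws) * \<kappa>" by (simp add: us(4) \<kappa>_def)
      also have "\<dots> \<le> X * \<kappa>" using ws(2) \<kappa> by (intro mult_right_mono) auto
      also have "\<dots> = ln B" using \<kappa> by (simp add: X_def)
      finally have "ln (real_of_int (height t)) + ln 2 \<le> ln B" .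
      moreover have "ln 2 \<ge> (0::real)" by simp
      ultimately have "ln (real_of_int (height t)) \<le> ln B" by linarith
      then have "real_of_int (height t) \<le> B" using height_pos[of t] B0 by (subst (asm) ln_le_cancel_iff) auto
      then show "t \<in> mersenne_values r B"
        using us letters_subset_mersenne_primes unfolding mersenne_values_def by blast
    qed
    then have "card (reach z X) \<le> card (mersenne_values r B)"
      by (intro card_mono finite_mersenne_values)
    then have "c * X powr (87/143) \<le> real (card (mersenne_values r B))" using c(3)[OF X] by linarith
    moreover have "(ln B) powr (87/143) = \<kappa> powr (87/143) * X powr (87/143)"
    proof -
      have "ln B = \<kappa> * X" using \<kappa> by (simp add: X_def)
      then show ?thesis using \<kappa> X c(2) by (simp add: powr_mult)
    qed
    ultimately show "(ln B) powr (87/143) \<le> \<kappa> powr (87/143) / c * real (card (mersenne_values r B))"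
      using c(1) \<kappa> by (simp add: field_simps)
  qed
qed

theorem corollary1p4:
  fixes r :: rat
  assumes "height r > 4"
  shows "((\<lambda>B. (ln B) powr 0.60839) \<ll> (\<lambda>B. real (card (mersenne_values r B))))
       \<and> ((\<lambda>B. real (card (mersenne_values r B))) \<ll> (\<lambda>B. (ln B) powr 0.60872))"
proof
  obtain c B0 where c: "c > 0" "\<And>B. B \<ge> B0 \<Longrightarrow> (ln B) powr (87/143) \<le> c * real (card (mersenne_values r B))"
    using card_mersenne_values_ge by blast
  have ln1: "ln B \<ge> 1" if "B \<ge> exp 1" for B :: real
  proof -
    have "B > 0" using that less_le_trans[OF exp_gt_zero] by blast
    then show ?thesis using that by (simp add: ln_ge_iff)
  qed
  show "(\<lambda>B. (ln B) powr 0.60839) \<ll> (\<lambda>B. real (card (mersenne_values r B)))"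
    unfolding vinogradov_def
  proof (rule exI[of _ c], intro conjI c(1), rule exI[of _ "max B0 (exp 1)"], intro allI impI)
    fix B :: real assume B: "B \<ge> max B0 (exp 1)"
    \<comment> \<open>Since 0.60839 < 87/143 and 14/23 < 0.60872, the threshold exp 1, which gives
      ln B >= 1, makes both powers comparable.\<close>
    then have "(ln B) powr 0.60839 \<le> (ln B) powr (87/143)" using ln1 by (intro powr_mono) auto
    also have "\<dots> \<le> c * real (card (mersenne_values r B))" using B c(2) by simp
    finally show "(ln B) powr 0.60839 \<le> c * real (card (mersenne_values r B))" .
  qed
  show "(\<lambda>B. real (card (mersenne_values r B))) \<ll> (\<lambda>B. (ln B) powr 0.60872)"
    unfolding vinogradov_def
  proof (rule exI[of _ "10000 / ln 2 powr (14/23)"], intro conjI, simp, rule exI[of _ "exp 1"], intro allI impI)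
    fix B :: real assume B: "B \<ge> exp 1"
    have "real (card (mersenne_values r B)) \<le> (ln B / ln 2) powr (14/23) * 10000"
      by (rule card_mersenne_values_le[OF assms B])
    also have "\<dots> = 10000 / ln 2 powr (14/23) * (ln B) powr (14/23)"
      using ln1[OF B] by (simp add: powr_divide)
    also have "\<dots> \<le> 10000 / ln 2 powr (14/23) * (ln B) powr 0.60872"
      using ln1[OF B] by (intro mult_left_mono powr_mono) auto
    finally show "real (card (mersenne_values r B)) \<le> 10000 / ln 2 powr (14/23) * (ln B) powr 0.60872" .
  qed
qed

end
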